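(* Let $T=\mathbb{Z}^d$ or $T=\mathbb{R}^d$. (i) Let $\{\xi_t,\,t\in T\}$ be a symmetric stochastic process with $\xi_t$ integrable for all $t\in T$, and let $X_t=\sum_{k=1}^\infty \Gamma_k^{-1}\xi^{(k)}_t$, $t\in T$, be the symmetric $1$-stable process given by its LePage series. Then $X$ is stationary if and only if $\xi$ is zonoid stationary. (ii) Let $\{\xi_t,\,t\in T\}$ be a positive stochastic process with $\xi_t$ integrable for all $t\in T$, such that the max-stable process $Y_t=\max_{k\ge1}\Gamma_k^{-1}\xi^{(k)}_t$, $t\in T$, has unit Fréchet marginals. Then $Y$ is stationary if and only if $\xi$ is zonoid stationary.
   Context: Here $\Gamma_k=\zeta_1+\cdots+\zeta_k$, $k\ge1$, are successive sums of i.i.d. standard exponential random variables $\zeta_1,\zeta_2,\ldots$, and $\xi^{(1)},\xi^{(2)},\ldots$ are i.i.d. copies of the process $\xi$, independent of $\{\Gamma_k\}$. A process is symmetric if $\xi$ and $-\xi$ have the same finite-dimensional distributions; positive means that all $\xi_t$ are (almost surely) strictly positive. Stationarity means that all finite-dimensional distributions are invariant under the shifts $t\mapsto t+s$, $s\in T$. Unit Fréchet: distribution function $x\mapsto e^{-1/x}$, $x>0$. Two integrable random vectors $\eta,\eta^*$ in $\mathbb{R}^n$ are zonoid equivalent if $\mathbf{E}|\langle u,\eta\rangle|=\mathbf{E}|\langle u,\eta^*\rangle|$ for all $u\in\mathbb{R}^n$; two families of integrable random variables $\{\xi_t,t\in T\}$ and $\{\xi^*_t,t\in T\}$ are zonoid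 equivalent if $(\xi_{t_1},\ldots,\xi_{t_n})$ and $(\xi^*_{t_1},\ldots,\xi^*_{t_n})$ are zonoid equivalent for all $n\ge1$ and $t_1,\ldots,t_n\in T$. The process $\{\xi_t,t\in T\}$ is zonoid stationary if $\{\xi_t,t\in T\}$ and $\{\xi_{t+s},t\in T\}$ are zonoid equivalent for all $s\in T$. *)

theory Defs
  imports "HOL-Probability.Probability"
begin

text \<open>
  A process indexed by \<open>T\<close> is a function \<open>X :: 't \<Rightarrow> 'w \<Rightarrow> real\<close> of which only the values
  \<open>X t\<close> with \<open>t \<in> T\<close> matter. Time points may repeat in the tuples \<open>t 0, \<dots>, t (n - 1)\<close>.
\<close>

definition same_fdd ::
  "'t set \<Rightarrow> 'v measure \<Rightarrow> ('t \<Rightarrow> 'v \<Rightarrow> real) \<Rightarrow> 'w measure \<Rightarrow> ('t \<Rightarrow> 'w \<Rightarrow> real) \<Rightarrow> bool" where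
  "same_fdd T P X Q Y \<longleftrightarrow>
     (\<forall>n. \<forall>t \<in> {..<n::nat} \<rightarrow> T.
        distr P (\<Pi>\<^sub>M i\<in>{..<n}. borel) (\<lambda>\<omega>. \<lambda>i\<in>{..<n}. X (t i) \<omega>) =
        distr Q (\<Pi>\<^sub>M i\<in>{..<n}. borel) (\<lambda>\<omega>. \<lambda>i\<in>{..<n}. Y (t i) \<omega>))"

definition symmetric_process :: "'t set \<Rightarrow> 'w measure \<Rightarrow> ('t \<Rightarrow> 'w \<Rightarrow> real) \<Rightarrow> bool" where
  "symmetric_process T P X \<longleftrightarrow> same_fdd T P X P (\<lambda>t \<omega>. - X t \<omega>)"

definition positive_process :: "'t set \<Rightarrow> 'w measure \<Rightarrow> ('t \<Rightarrow> 'w \<Rightarrow> real) \<Rightarrow> bool" where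
  "positive_process T P X \<longleftrightarrow> (\<forall>t\<in>T. AE \<omega> in P. X t \<omega> > 0)"

definition stationary ::
  "'t::plus set \<Rightarrow> 'w measure \<Rightarrow> ('t \<Rightarrow> 'w \<Rightarrow> real) \<Rightarrow> bool" where
  "stationary T P X \<longleftrightarrow> (\<forall>s\<in>T. same_fdd T P X P (\<lambda>t. X (t + s)))"

text \<open>A random vector in \<open>\<real>\<^sup>n\<close> is given by its components \<open>\<eta> 0, \<dots>, \<eta> (n - 1)\<close>.\<close>

definition zonoid_equiv_vec ::
  "nat \<Rightarrow> 'v measure \<Rightarrow> (nat \<Rightarrow> 'v \<Rightarrow> real) \<Rightarrow> 'w measure \<Rightarrow> (nat \<Rightarrow> 'w \<Rightarrow> real) \<Rightarrow> bool" where
  "zonoid_equiv_vec n P \<eta> Q \<eta>' \<longleftrightarrow>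
     (\<forall>i<n. integrable P (\<eta> i)) \<and> (\<forall>i<n. integrable Q (\<eta>' i)) \<and>
     (\<forall>u :: nat \<Rightarrow> real.
        (\<integral>\<omega>. \<bar>\<Sum>i<n. u i * \<eta> i \<omega>\<bar> \<partial>P) = (\<integral>\<omega>. \<bar>\<Sum>i<n. u i * \<eta>' i \<omega>\<bar> \<partial>Q))"

definition zonoid_equiv ::
  "'t set \<Rightarrow> 'v measure \<Rightarrow> ('t \<Rightarrow> 'v \<Rightarrow> real) \<Rightarrow> 'w measure \<Rightarrow> ('t \<Rightarrow> 'w \<Rightarrow> real) \<Rightarrow> bool" where
  "zonoid_equiv T P X Q Y \<longleftrightarrow>
     (\<forall>n\<ge>1. \<forall>t \<in> {..<n} \<rightarrow> T. zonoid_equiv_vec n P (\<lambda>i. X (t i)) Q (\<lambda>i. Y (t i)))"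

definition zonoid_stationary ::
  "'t::plus set \<Rightarrow> 'w measure \<Rightarrow> ('t \<Rightarrow> 'w \<Rightarrow> real) \<Rightarrow> bool" where
  "zonoid_stationary T P X \<longleftrightarrow> (\<forall>s\<in>T. zonoid_equiv T P X P (\<lambda>t. X (t + s)))"

definition unit_frechet :: "'w measure \<Rightarrow> ('w \<Rightarrow> real) \<Rightarrow> bool" where
  "unit_frechet P V \<longleftrightarrow>
     V \<in> borel_measurable P \<and> (\<forall>x>0. cdf (distr P borel V) x = exp (- 1 / x))"

definition iid_std_exponential :: "'w measure \<Rightarrow> (nat \<Rightarrow> 'w \<Rightarrow> real) \<Rightarrow> bool" where
  "iid_std_exponential P \<zeta> \<longleftrightarrow>
     prob_space.indep_vars P (\<lambda>_. borel) \<zeta> UNIV \<and>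
     (\<forall>k. distributed P lborel (\<zeta> k) (exponential_density 1))"

text \<open>Sequences are indexed from 0, so \<open>arrival \<zeta> k\<close> is the sum of the first \<open>k + 1\<close> variables.\<close>

definition arrival :: "(nat \<Rightarrow> 'w \<Rightarrow> real) \<Rightarrow> nat \<Rightarrow> 'w \<Rightarrow> real" where
  "arrival \<zeta> k \<omega> = (\<Sum>i\<le>k. \<zeta> i \<omega>)"

definition sample_path :: "'t set \<Rightarrow> ('t \<Rightarrow> 'w \<Rightarrow> real) \<Rightarrow> 'w \<Rightarrow> 't \<Rightarrow> real" where
  "sample_path T X \<omega> = (\<lambda>t\<in>T. X t \<omega>)"

text \<open>
  Independence of whole processes is independence of their paths as random elements of the
  product space, i.e. of the \<open>\<sigma>\<close>-algebras generated by all their values.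
\<close>

definition iid_copies ::
  "'t set \<Rightarrow> 'v measure \<Rightarrow> (nat \<Rightarrow> 't \<Rightarrow> 'v \<Rightarrow> real) \<Rightarrow> 'w measure \<Rightarrow> ('t \<Rightarrow> 'w \<Rightarrow> real) \<Rightarrow> bool" where
  "iid_copies T P \<Xi> Q \<xi> \<longleftrightarrow>
     prob_space.indep_vars P (\<lambda>_. \<Pi>\<^sub>M t\<in>T. borel) (\<lambda>k. sample_path T (\<Xi> k)) UNIV \<and>
     (\<forall>k. same_fdd T P (\<Xi> k) Q \<xi>)"

definition indep_seq_processes ::
  "'t set \<Rightarrow> 'w measure \<Rightarrow> (nat \<Rightarrow> 'w \<Rightarrow> real) \<Rightarrow> (nat \<Rightarrow> 't \<Rightarrow> 'w \<Rightarrow> real) \<Rightarrow> bool" where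
  "indep_seq_processes T P \<Gamma> \<Xi> \<longleftrightarrow>
     prob_space.indep_set P
       (sets (vimage_algebra (space P) (\<lambda>\<omega> k. \<Gamma> k \<omega>) (\<Pi>\<^sub>M k\<in>UNIV. borel)))
       (sets (vimage_algebra (space P) (\<lambda>\<omega> k. sample_path T (\<Xi> k) \<omega>) (\<Pi>\<^sub>M k\<in>UNIV. \<Pi>\<^sub>M t\<in>T. borel)))"

text \<open>
  For symmetric integrable \<open>\<xi>\<close> the series converges almost surely (in general not absolutely);
  for positive integrable \<open>\<xi>\<close> its terms are almost surely positive and tend to 0, so that
  the supremum is an attained maximum. On the exceptional null sets the values are unspecified.
\<close>

definition lepage_series ::
  "(nat \<Rightarrow> 'w \<Rightarrow> real) \<Rightarrow> (nat \<Rightarrow> 't \<Rightarrow> 'w \<Rightarrow> real) \<Rightarrow> 't \<Rightarrow> 'w \<Rightarrow> real" where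
  "lepage_series \<Gamma> \<Xi> t \<omega> = (\<Sum>k. inverse (\<Gamma> k \<omega>) * \<Xi> k t \<omega>)"

definition lepage_max ::
  "(nat \<Rightarrow> 'w \<Rightarrow> real) \<Rightarrow> (nat \<Rightarrow> 't \<Rightarrow> 'w \<Rightarrow> real) \<Rightarrow> 't \<Rightarrow> 'w \<Rightarrow> real" where
  "lepage_max \<Gamma> \<Xi> t \<omega> = (SUP k. inverse (\<Gamma> k \<omega>) * \<Xi> k t \<omega>)"

end

theory Submission imports Defs begin

text \<open>
  Everything rests on one computation for i.i.d. marks \<open>\<eta>\<^sub>k\<close> independent of the arrival times
  \<open>\<Gamma>\<^sub>k\<close>: if \<open>f x = E h x \<eta>\<^sub>1\<close> and \<open>1 - f\<close> is integrable on \<open>(0, \<infinity>)\<close>, then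
  \<open>E (\<Prod>\<^sub>k h \<Gamma>\<^sub>k \<eta>\<^sub>k) = exp (- \<integral>\<^sub>0\<^sup>\<infinity> (1 - f))\<close>. For \<open>h x y = exp (\<i> y / x)\<close> and symmetric marks the
  integral is \<open>c E \<bar>\<eta>\<^sub>1\<bar>\<close> with a constant \<open>c > 0\<close>, so the characteristic function of
  \<open>\<Sum>\<^sub>i u\<^sub>i X\<^sub>t\<^sub>i\<close> at 1 is \<open>exp (- c E \<bar>\<Sum>\<^sub>i u\<^sub>i \<xi>\<^sub>t\<^sub>i\<bar>)\<close>, and uniqueness of characteristic functions gives (i).
  For \<open>h\<close> the indicator of \<open>y \<le> x\<close> and nonnegative marks it is \<open>E \<eta>\<^sub>1\<close>, so the distribution
  function of \<open>(Y\<^sub>t\<^sub>i)\<close> is \<open>exp (- E max\<^sub>i \<xi>\<^sub>t\<^sub>i / x\<^sub>i)\<close>. It remains to see that the functionals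
  \<open>E \<bar>\<Sum>\<^sub>i u\<^sub>i \<xi>\<^sub>i\<bar>\<close> and \<open>E max\<^sub>i a\<^sub>i \<xi>\<^sub>i\<close> of a positive vector determine each other: each of them,
  differentiated in the coefficient of \<open>\<xi>\<^sub>0\<close>, determines the law of the ratios \<open>\<xi>\<^sub>i / \<xi>\<^sub>0\<close> under the
  measure with density \<open>\<xi>\<^sub>0\<close>, which in turn determines both.
\<close>

subsection \<open>The renewal equation\<close>

text \<open>The product formula is the exponential formula of a marked Poisson process, but no point
  process is constructed. The exponential of minus the integral of \<open>1 - f\<close> over
  \<open>{x<..}\<close> is a guess for the expected value of the remaining factors once an arrival
  has occurred at \<open>x\<close>; one differential equation confirms the guess. Two obstacles
  shape the rest. In (i) the terms are of order \<open>1 / k\<close>, so the series need not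
  converge absolutely; symmetry of the marks and a martingale argument have to supply almost sure
  convergence. In (ii) neither functional determines the law of the vector itself, because both see
  it only through 1-homogeneous functions. Hence the detour over ratios: weighting by the first
  coordinate turns expectations of 1-homogeneous functions into expectations of functions of the
  ratios. The Frechet marginals force all means to be 1, so that the weighted measure is a
  probability measure, whichever time point comes first.\<close>

lemma has_real_derivative_tail_integral:
  fixes q :: "real \<Rightarrow> real"
  assumes cont: "continuous_on {0<..} q" and int: "set_integrable lborel {0<..} q" and x: "0 < x"
  shows "((\<lambda>x. LBINT t:{x<..}. q t) has_real_derivative - q x) (at x)"
proof -
  \<comment> \<open>Any compact interval in \<open>{0<..}\<close> with \<open>x\<close> inside would
    do. With its left end fixed, the tail integral is a constant minus
    \<open>integral {a..u} q\<close>, to which the fundamental theorem of calculus applies.\<close>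
  define a where "a = x / 2"
  define b where "b = 2 * x"
  have ab: "0 < a" "a < x" "x < b" using x by (auto simp: a_def b_def)
  have sub: "set_integrable lborel A q" if "A \<in> sets borel" "A \<subseteq> {0<..}" for A
    using set_integrable_subset[OF int] that by simp
  have eq: "(LBINT t:{u<..}. q t) = (LBINT t:{a<..}. q t) - integral {a..u} q" if "u \<in> {a<..<b}" for u
  proof -
    have "{a<..} = {a<..u} \<union> {u<..}" using that by auto
    moreover have "(LBINT t:{a<..u} \<union> {u<..}. q t) = (LBINT t:{a<..u}. q t) + (LBINT t:{u<..}. q t)"
      using that ab by (intro set_integral_Un sub) auto
    ultimately have "(LBINT t:{a<..}. q t) = (LBINT t:{a<..u}. q t) + (LBINT t:{u<..}. q t)"
      by simp
    also have "(LBINT t:{a<..u}. q t) = integral {a<..u} q"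
      using ab by (intro set_borel_integral_eq_integral sub) auto
    also have "\<dots> = integral {a..u} q"
      by (rule integral_subset_negligible)
         (auto intro: negligible_subset[of "{a}"] integral_spike_set)
    finally show ?thesis by simp
  qed
  have "((\<lambda>u. integral {a..u} q) has_real_derivative q x) (at x within {a..b})"
    using ab by (intro integral_has_real_derivative continuous_on_subset[OF cont]) auto
  then have "((\<lambda>u. integral {a..u} q) has_real_derivative q x) (at x)"
    using ab by (simp add: at_within_Icc_at)
  then have "((\<lambda>u. (LBINT t:{a<..}. q t) - integral {a..u} q) has_real_derivative 0 - q x) (at x)"
    by (intro derivative_intros)
  moreover have "\<forall>\<^sub>F u in nhds x. u \<in> {a<..<b}"
    using ab by (intro eventually_nhds_in_open) auto
  ultimately show ?thesis
    by (subst DERIV_cong_ev[OF refl _ refl]) (auto elim!: eventually_mono simp: eq)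
qed

text \<open>Dominated convergence, with the integrand on all of \<open>{0<..}\<close> as bound. The
  right limit is needed down to \<open>x = 0\<close>, where no derivative is available but where the
  renewal equation starts: before the first arrival the elapsed time is 0.\<close>

lemma
  fixes q :: "real \<Rightarrow> real"
  assumes "set_integrable lborel {0<..} q"
  shows tendsto_tail_integral_at_top: "((\<lambda>x. LBINT t:{x<..}. q t) \<longlongrightarrow> 0) at_top"
    and tendsto_tail_integral_at_right:
      "0 \<le> x \<Longrightarrow> ((\<lambda>x. LBINT t:{x<..}. q t) \<longlongrightarrow> (LBINT t:{x<..}. q t)) (at_right x)"
proof -
  have int: "integrable lborel (\<lambda>t. indicator {0<..} t * q t)"
    using assms by (simp add: set_integrable_def)
  have meas: "(\<lambda>t. indicator {x<..} t * q t) \<in> borel_measurable borel" if "0 \<le> x" for x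
  proof -
    have "set_integrable lborel {x<..} q"
      by (rule set_integrable_subset[OF assms]) (use that in auto)
    then show ?thesis by (auto simp: set_integrable_def)
  qed
  show "((\<lambda>x. LBINT t:{x<..}. q t) \<longlongrightarrow> 0) at_top"
  proof (rule tendsto_at_topI_sequentially)
    fix X :: "nat \<Rightarrow> real" assume X: "filterlim X at_top sequentially"
    \<comment> \<open>Early terms of \<open>X\<close> may be negative, where nothing is known about
      \<open>q\<close>. Clipping at 0 keeps the bound valid and alters only finitely many
      terms.\<close>
    have "(\<lambda>n. \<integral>t. indicator {max 0 (X n)<..} t * q t \<partial>lborel) \<longlonglongrightarrow> (\<integral>t. 0 \<partial>(lborel :: real measure))"
    proof (rule integral_dominated_convergence)
      show "integrable lborel (\<lambda>t. \<bar>indicator {0<..} t * q t\<bar>)" using int by simp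
      show "AE t in lborel. (\<lambda>n. indicator {max 0 (X n)<..} t * q t) \<longlonglongrightarrow> 0"
      proof (rule AE_I2, rule tendsto_eventually)
        fix t show "\<forall>\<^sub>F n in sequentially. indicator {max 0 (X n)<..} t * q t = 0"
          using filterlim_at_top_ge[THEN iffD1, OF X, rule_format, of t t]
          by (rule eventually_mono) (auto simp: indicator_def)
      qed
      show "(\<lambda>t. indicator {max 0 (X n)<..} t * q t) \<in> borel_measurable lborel" for n
        using meas[of "max 0 (X n)"] by simp
    qed (auto simp: indicator_def abs_mult)
    moreover have "\<forall>\<^sub>F n in sequentially.
        (\<integral>t. indicator {max 0 (X n)<..} t * q t \<partial>lborel) = (LBINT t:{X n<..}. q t)"
      using filterlim_at_top_ge[THEN iffD1, OF X, rule_format, of 0 0]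
      by (rule eventually_mono) (auto simp: set_lebesgue_integral_def max_def)
    ultimately show "(\<lambda>n. LBINT t:{X n<..}. q t) \<longlonglongrightarrow> 0"
      by (simp add: tendsto_cong)
  qed
  show "((\<lambda>x. LBINT t:{x<..}. q t) \<longlongrightarrow> (LBINT t:{x<..}. q t)) (at_right x)" if x: "0 \<le> x"
  proof (rule tendsto_at_right_sequentially[of x "x + 1"])
    fix S :: "nat \<Rightarrow> real" assume S: "\<And>n. x < S n" "S \<longlonglongrightarrow> x"
    show "(\<lambda>n. LBINT t:{S n<..}. q t) \<longlonglongrightarrow> (LBINT t:{x<..}. q t)"
      unfolding set_lebesgue_integral_def real_scaleR_def
    proof (rule integral_dominated_convergence)
      show "integrable lborel (\<lambda>t. \<bar>indicator {0<..} t * q t\<bar>)" using int by simp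
      show "AE t in lborel. (\<lambda>n. indicator {S n<..} t * q t) \<longlonglongrightarrow> indicator {x<..} t * q t"
      proof (rule AE_I2, rule tendsto_eventually)
        fix t show "\<forall>\<^sub>F n in sequentially. indicator {S n<..} t * q t = indicator {x<..} t * q t"
        proof (cases "x < t")
          case True
          then show ?thesis
            by (intro eventually_mono[OF order_tendstoD(2)[OF S(2), of t]]) (auto simp: indicator_def)
        next
          case False
          then have "\<not> S n < t" for n using S(1)[of n] by simp
          then show ?thesis using False by simp
        qed
      qed
      have Sn: "0 < S n" for n using x S(1)[of n] by simp
      show "(\<lambda>t. indicator {S n<..} t * q t) \<in> borel_measurable lborel" for n
        using meas[OF less_imp_le[OF Sn]] by simp
      show "AE t in lborel. norm (indicator {S n<..} t * q t) \<le> \<bar>indicator {0<..} t * q t\<bar>" for n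
        using Sn[of n] by (auto simp: indicator_def)
    qed (use meas[OF x] in simp)
  qed simp
qed

text \<open>\<open>G' = (1 - f) G\<close>, so \<open>- (exp (- x) * G x)\<close> is an
  antiderivative of \<open>exp (- x) * (f x * G x)\<close>. It rises from
  \<open>- (exp (- g) * G g)\<close> to 0, and the shift \<open>x = g + z\<close> cancels
  \<open>exp (- g)\<close>. Probabilistically, \<open>G g\<close> is reproduced by waiting a
  standard exponential time and multiplying by \<open>f\<close> at the time reached.\<close>

lemma exponential_renewal:
  fixes f :: "real \<Rightarrow> real"
  assumes cont: "continuous_on {0<..} f" and bound: "\<And>x. 0 < x \<Longrightarrow> \<bar>f x\<bar> \<le> 1"
    and int: "set_integrable lborel {0<..} (\<lambda>x. 1 - f x)" and g: "0 \<le> g"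
  defines "G \<equiv> \<lambda>x. exp (- (LBINT t:{x<..}. 1 - f t))"
  shows "(LBINT z:{0<..}. exp (- z) * (f (g + z) * G (g + z))) = G g"
proof -
  let ?h = "\<lambda>x. exp (- x) * (f x * G x)"
  have dL: "((\<lambda>x. LBINT t:{x<..}. 1 - f t) has_real_derivative - (1 - f x)) (at x)" if "0 < x" for x
    using that int cont by (intro has_real_derivative_tail_integral continuous_intros)
  have dG: "(G has_real_derivative G x * (1 - f x)) (at x)" if "0 < x" for x
    unfolding G_def using that by (auto intro!: derivative_eq_intros dL)
  have contG: "isCont G x" if "0 < x" for x
    using dG[OF that] DERIV_isCont by blast
  have contf: "isCont f x" if "0 < x" for x
    using cont that by (simp add: continuous_on_eq_continuous_at)
  have G_top: "(G \<longlongrightarrow> 1) at_top"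
    unfolding G_def using tendsto_tail_integral_at_top[OF int] by (auto intro!: tendsto_eq_intros)
  have G_right: "(G \<longlongrightarrow> G g) (at_right g)"
    unfolding G_def using tendsto_tail_integral_at_right[OF int g] by (auto intro!: tendsto_eq_intros)
  have "\<bar>LBINT t:{x<..}. 1 - f t\<bar> \<le> (LBINT t:{0<..}. \<bar>1 - f t\<bar>)" if "0 \<le> x" for x
  proof -
    have i: "set_integrable lborel {x<..} (\<lambda>x. 1 - f x)"
      by (rule set_integrable_subset[OF int]) (use that in auto)
    have "\<bar>LBINT t:{x<..}. 1 - f t\<bar> \<le> (LBINT t:{x<..}. \<bar>1 - f t\<bar>)"
      using set_integral_norm_bound[OF i] by simp
    also have "\<dots> \<le> (LBINT t:{0<..}. \<bar>1 - f t\<bar>)"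
      using set_integrable_abs[OF i] set_integrable_abs[OF int] that
      unfolding set_lebesgue_integral_def set_integrable_def
      by (intro integral_mono) (auto simp: indicator_def)
    finally show ?thesis .
  qed
  then have G_le: "\<bar>G x\<bar> \<le> exp (LBINT t:{0<..}. \<bar>1 - f t\<bar>)" (is "_ \<le> ?B") if "0 \<le> x" for x
    using that unfolding G_def by (force simp: abs_le_iff)
  have hint: "set_integrable lborel {0<..} ?h"
  proof (rule set_integrable_bound[where f="\<lambda>x. ?B * exp (- x)"])
    show "set_integrable lborel {0<..} (\<lambda>x. ?B * exp (- x))"
    proof -
      have "set_integrable lborel {0<..} (\<lambda>x::real. exp (- x))"
        using integrable_I0i_exp_mscale[of 1] by simp
      then show ?thesis by (rule set_integrable_mult_right)
    qed
    show "set_borel_measurable lborel {0<..} ?h"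
      unfolding set_borel_measurable_def
      using contG contf
      by (subst measurable_lborel2, intro borel_measurable_continuous_on_indicator)
         (auto intro!: continuous_at_imp_continuous_on continuous_intros)
    show "AE x in lborel. x \<in> {0<..} \<longrightarrow> norm (?h x) \<le> norm (?B * exp (- x))"
    proof (intro AE_I2 impI)
      fix x :: real assume "x \<in> {0<..}"
      then have "\<bar>f x\<bar> * \<bar>G x\<bar> \<le> 1 * ?B"
        by (intro mult_mono bound G_le) auto
      then show "norm (?h x) \<le> norm (?B * exp (- x))"
        by (simp add: abs_mult)
    qed
  qed
  have "(LBINT x=ereal g..\<infinity>. ?h x) = 0 - (- (exp (- g) * G g))"
  proof (rule interval_integral_FTC_integrable)
    show "((\<lambda>x. - (exp (- x) * G x)) has_vector_derivative ?h x) (at x)" if "ereal g < ereal x" for x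
      unfolding has_real_derivative_iff_has_vector_derivative[symmetric]
      using that g by (auto intro!: derivative_eq_intros dG simp: algebra_simps)
    show "isCont ?h x" if "ereal g < ereal x" for x
      using that g contG contf by (auto intro!: continuous_intros)
    show "set_integrable lborel (einterval (ereal g) \<infinity>) ?h"
      by (rule set_integrable_subset[OF hint]) (use g in \<open>auto simp: einterval_def\<close>)
    show "(((\<lambda>x. - (exp (- x) * G x)) \<circ> real_of_ereal) \<longlongrightarrow> - (exp (- g) * G g)) (at_right (ereal g))"
      unfolding ereal_tendsto_simps using G_right by (auto intro!: tendsto_eq_intros)
    show "(((\<lambda>x. - (exp (- x) * G x)) \<circ> real_of_ereal) \<longlongrightarrow> 0) (at_left \<infinity>)"
      unfolding ereal_tendsto_simps
    proof -
      have "((\<lambda>x::real. exp (- x)) \<longlongrightarrow> 0) at_top"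
        by (intro filterlim_compose[OF exp_at_bot] filterlim_uminus_at_bot_at_top)
      then show "((\<lambda>x. - (exp (- x) * G x)) \<longlongrightarrow> 0) at_top"
        using tendsto_minus[OF tendsto_mult[OF _ G_top]] by force
    qed
  qed auto
  then have "(LBINT x:{g<..}. ?h x) = exp (- g) * G g"
    by (simp add: interval_integral_to_infinity_eq)
  moreover have "(LBINT x:{g<..}. ?h x) = (LBINT z:{0<..}. ?h (g + z))"
    unfolding set_lebesgue_integral_def
    by (subst lborel_integral_real_affine[where c=1 and t=g]) (auto simp: indicator_def intro!: Bochner_Integration.integral_cong)
  moreover have "(LBINT z:{0<..}. ?h (g + z)) = exp (- g) * (LBINT z:{0<..}. exp (- z) * (f (g + z) * G (g + z)))"
    by (simp add: exp_diff exp_minus field_simps flip: set_integral_mult_right)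
  ultimately show ?thesis by simp
qed

subsection \<open>Marked arrivals\<close>

text \<open>Gaps and marks form a single independent family over \<open>nat + nat\<close>, so that
  independence of past and future becomes independence of disjoint sets of indices.\<close>

locale marked_arrivals = prob_space M for M :: "'v measure" +
  fixes \<zeta> \<eta> :: "nat \<Rightarrow> 'v \<Rightarrow> real" and D :: "real measure"
  assumes indep: "indep_vars (\<lambda>_. borel) (case_sum \<zeta> \<eta>) UNIV"
    and exp: "\<And>k. distributed M lborel (\<zeta> k) (exponential_density 1)"
    and law: "\<And>k. distr M borel (\<eta> k) = D"
begin

lemma measurable_zeta [measurable]: "\<zeta> k \<in> borel_measurable M"
  using exp[of k] by (simp add: distributed_def)

lemma measurable_eta [measurable]: "\<eta> k \<in> borel_measurable M"
  using indep unfolding indep_vars_def by (auto dest: spec[where x="Inr k"])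

lemma sets_D [simp, measurable_cong]: "sets D = sets borel"
  using law[of 0] by auto

lemma space_D [simp]: "space D = UNIV"
  using sets_eq_imp_space_eq[OF sets_D] by simp

lemma prob_space_D: "prob_space D"
  using prob_space_distr[of "\<eta> 0" borel] law[of 0] by simp

definition expd :: "real measure" where
  "expd = density lborel (exponential_density 1)"

lemma sets_expd [simp, measurable_cong]: "sets expd = sets borel"
  by (simp add: expd_def)

lemma prob_space_expd: "prob_space expd"
  unfolding expd_def by (rule prob_space_exponential_density) simp

lemma distr_zeta: "distr M borel (\<zeta> k) = expd"
  using distributed_distr_eq_density[OF exp[of k]] unfolding expd_def
  by (metis distr_cong sets_lborel)

definition past_idx :: "nat \<Rightarrow> (nat + nat) set" where
  "past_idx n = Inl ` {..<n} \<union> Inr ` {..<n}"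

text \<open>Gap \<open>n\<close> and mark \<open>n\<close> are left out: \<open>past n\<close> knows
  the arrivals of index below \<open>n\<close> but not arrival \<open>n\<close>, so the next gap and
  mark are fresh.\<close>

definition past :: "nat \<Rightarrow> 'v measure" where
  "past n = vimage_algebra (space M) (\<lambda>\<omega>. \<lambda>j\<in>past_idx n. case_sum \<zeta> \<eta> j \<omega>) (\<Pi>\<^sub>M j\<in>past_idx n. borel)"

lemma space_past [simp]: "space (past n) = space M"
  by (simp add: past_def)

lemma measurable_past:
  assumes "j \<in> past_idx n"
  shows "case_sum \<zeta> \<eta> j \<in> borel_measurable (past n)"
proof -
  have "(\<lambda>\<omega>. (\<lambda>j\<in>past_idx n. case_sum \<zeta> \<eta> j \<omega>) j) \<in> borel_measurable (past n)"
    unfolding past_def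
    by (rule measurable_compose[OF measurable_vimage_algebra1 measurable_component_singleton])
       (auto simp: space_PiM assms)
  then show ?thesis using assms by simp
qed

lemma measurable_past_zeta [measurable (raw)]: "k < n \<Longrightarrow> \<zeta> k \<in> borel_measurable (past n)"
  using measurable_past[of "Inl k" n] by (auto simp: past_idx_def)

lemma measurable_past_eta [measurable (raw)]: "k < n \<Longrightarrow> \<eta> k \<in> borel_measurable (past n)"
  using measurable_past[of "Inr k" n] by (auto simp: past_idx_def)

lemma rv_restrict: "random_variable (\<Pi>\<^sub>M j\<in>J. borel) (\<lambda>\<omega>. \<lambda>j\<in>J. case_sum \<zeta> \<eta> j \<omega>)"
  by (intro measurable_restrict) (auto split: sum.split)

lemma measurable_from_past:
  assumes "V \<in> measurable (past n) S"
  shows "V \<in> measurable M S"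
proof -
  have "sets (past n) \<subseteq> sets M"
    unfolding past_def using rv_restrict[of "past_idx n"]
    by (auto simp: sets_vimage_algebra2 measurable_def)
  then show ?thesis
    using assms by (auto simp: measurable_def)
qed

text \<open>An event of \<open>past n\<close> is the preimage of a measurable set under the
  coordinates in \<open>past_idx n\<close>, and this index set is disjoint from
  \<open>{Inl n, Inr n}\<close>.\<close>

lemma indep_past:
  assumes V: "V \<in> measurable (past n) S" and A: "A \<in> sets S" and B: "B \<in> sets (borel \<Otimes>\<^sub>M borel)"
  shows "prob {\<omega> \<in> space M. V \<omega> \<in> A \<and> (\<zeta> n \<omega>, \<eta> n \<omega>) \<in> B} =
    prob {\<omega> \<in> space M. V \<omega> \<in> A} * prob {\<omega> \<in> space M. (\<zeta> n \<omega>, \<eta> n \<omega>) \<in> B}"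
proof -
  let ?U = "\<lambda>\<omega>. \<lambda>j\<in>past_idx n. case_sum \<zeta> \<eta> j \<omega>" and ?P = "\<Pi>\<^sub>M j\<in>past_idx n. (borel :: real measure)"
  let ?J = "{Inl n, Inr n}"
  let ?W = "\<lambda>\<omega>. \<lambda>j\<in>?J. case_sum \<zeta> \<eta> j \<omega>" and ?Q = "\<Pi>\<^sub>M j\<in>?J. (borel :: real measure)"
  have ind: "indep_var ?P ?U ?Q ?W"
    by (rule indep_var_restrict[OF indep]) (auto simp: past_idx_def)
  have "V -` A \<inter> space M \<in> sets (past n)"
    using measurable_sets[OF V A] by simp
  then obtain A' where A': "A' \<in> sets ?P" "V -` A \<inter> space M = ?U -` A' \<inter> space M"
    unfolding past_def using rv_restrict[of "past_idx n"]
    by (auto simp: sets_vimage_algebra2 measurable_def)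
  have pair: "(\<lambda>x. (x (Inl n), x (Inr n))) \<in> measurable ?Q (borel \<Otimes>\<^sub>M borel)"
    by measurable
  define B' where "B' = (\<lambda>x. (x (Inl n), x (Inr n))) -` B \<inter> space ?Q"
  have B': "B' \<in> sets ?Q"
    unfolding B'_def by (rule measurable_sets[OF pair B])
  have eqB: "?W -` B' \<inter> space M = {\<omega> \<in> space M. (\<zeta> n \<omega>, \<eta> n \<omega>) \<in> B}"
    by (auto simp: B'_def space_PiM)
  have eqA: "?U -` A' \<inter> space M = {\<omega> \<in> space M. V \<omega> \<in> A}"
    unfolding A'(2)[symmetric] by auto
  have "(\<lambda>x. (?U x, ?W x)) -` (A' \<times> B') \<inter> space M =
      {\<omega> \<in> space M. V \<omega> \<in> A \<and> (\<zeta> n \<omega>, \<eta> n \<omega>) \<in> B}"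
    using eqA eqB by blast
  with indep_varD[OF ind A'(1) B'] show ?thesis
    by (simp only: eqA eqB)
qed

lemma distr_zeta_eta: "distr M (borel \<Otimes>\<^sub>M borel) (\<lambda>\<omega>. (\<zeta> n \<omega>, \<eta> n \<omega>)) = expd \<Otimes>\<^sub>M D"
proof -
  have "indep_var (\<Pi>\<^sub>M j\<in>{Inl n}. borel) (\<lambda>\<omega>. \<lambda>j\<in>{Inl n}. case_sum \<zeta> \<eta> j \<omega>)
      (\<Pi>\<^sub>M j\<in>{Inr n}. borel) (\<lambda>\<omega>. \<lambda>j\<in>{Inr n}. case_sum \<zeta> \<eta> j \<omega>)"
    by (rule indep_var_restrict[OF indep]) auto
  from indep_var_compose[OF this, where ?Y1.0="\<lambda>x. x (Inl n)" and ?N1.0=borel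
      and ?Y2.0="\<lambda>x. x (Inr n)" and ?N2.0=borel]
  have "indep_var borel (\<zeta> n) borel (\<eta> n)" by (simp add: comp_def)
  then show ?thesis
    by (simp add: indep_var_distribution_eq distr_zeta law)
qed

lemma distr_past:
  assumes V: "V \<in> measurable (past n) S"
  shows "distr M (S \<Otimes>\<^sub>M (borel \<Otimes>\<^sub>M borel)) (\<lambda>\<omega>. (V \<omega>, \<zeta> n \<omega>, \<eta> n \<omega>)) = distr M S V \<Otimes>\<^sub>M (expd \<Otimes>\<^sub>M D)"
proof -
  note [measurable] = measurable_from_past[OF V]
  interpret E: prob_space expd by (rule prob_space_expd)
  interpret D: prob_space D by (rule prob_space_D)
  interpret V: prob_space "distr M S V" by (rule prob_space_distr) simp
  interpret ED: pair_prob_space expd D ..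
  have "distr M S V \<Otimes>\<^sub>M (expd \<Otimes>\<^sub>M D) = distr M (S \<Otimes>\<^sub>M (borel \<Otimes>\<^sub>M borel)) (\<lambda>\<omega>. (V \<omega>, \<zeta> n \<omega>, \<eta> n \<omega>))"
  proof (rule pair_measure_eqI)
    fix A B assume [measurable]: "A \<in> sets (distr M S V)" and B: "B \<in> sets (expd \<Otimes>\<^sub>M D)"
    have [measurable_cong]: "sets (expd \<Otimes>\<^sub>M D) = sets (borel \<Otimes>\<^sub>M borel)"
      by (intro sets_pair_measure_cong) simp_all
    have [measurable]: "A \<in> sets S" "B \<in> sets (borel \<Otimes>\<^sub>M borel)"
      using \<open>A \<in> _\<close> B by simp_all
    have "emeasure (distr M S V) A * emeasure (expd \<Otimes>\<^sub>M D) B =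
        emeasure M {\<omega> \<in> space M. V \<omega> \<in> A} * emeasure M {\<omega> \<in> space M. (\<zeta> n \<omega>, \<eta> n \<omega>) \<in> B}"
      by (simp add: distr_zeta_eta[of n, symmetric] emeasure_distr vimage_def Int_def conj_commute)
    also have "\<dots> = emeasure M {\<omega> \<in> space M. V \<omega> \<in> A \<and> (\<zeta> n \<omega>, \<eta> n \<omega>) \<in> B}"
      by (simp add: emeasure_eq_measure ennreal_mult'[symmetric] indep_past[OF V])
    also have "\<dots> = emeasure (distr M (S \<Otimes>\<^sub>M (borel \<Otimes>\<^sub>M borel)) (\<lambda>\<omega>. (V \<omega>, \<zeta> n \<omega>, \<eta> n \<omega>))) (A \<times> B)"
      by (subst emeasure_distr) (auto intro!: arg_cong[where f="emeasure M"])
    finally show "emeasure (distr M S V) A * emeasure (expd \<Otimes>\<^sub>M D) B =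
        emeasure (distr M (S \<Otimes>\<^sub>M (borel \<Otimes>\<^sub>M borel)) (\<lambda>\<omega>. (V \<omega>, \<zeta> n \<omega>, \<eta> n \<omega>))) (A \<times> B)" .
  next
    show "sigma_finite_measure (distr M S V)" "sigma_finite_measure (expd \<Otimes>\<^sub>M D)"
      by unfold_locales
    show "sets (distr M S V \<Otimes>\<^sub>M (expd \<Otimes>\<^sub>M D)) =
        sets (distr M (S \<Otimes>\<^sub>M (borel \<Otimes>\<^sub>M borel)) (\<lambda>\<omega>. (V \<omega>, \<zeta> n \<omega>, \<eta> n \<omega>)))"
      unfolding sets_distr by (intro sets_pair_measure_cong) simp_all
  qed
  then show ?thesis by simp
qed

text \<open>Freezing: the past value is held fixed while the fresh gap and mark are integrated
  against their product law. This and its bounded vector-valued companion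
  \<open>integral_step\<close> stand in for conditional expectations.\<close>

lemma nn_integral_step:
  assumes V: "V \<in> measurable (past n) S" and [measurable]: "\<Phi> \<in> borel_measurable (S \<Otimes>\<^sub>M (borel \<Otimes>\<^sub>M borel))"
  shows "(\<integral>\<^sup>+\<omega>. \<Phi> (V \<omega>, \<zeta> n \<omega>, \<eta> n \<omega>) \<partial>M) = (\<integral>\<^sup>+\<omega>. \<integral>\<^sup>+z. \<integral>\<^sup>+y. \<Phi> (V \<omega>, z, y) \<partial>D \<partial>expd \<partial>M)"
proof -
  note [measurable] = measurable_from_past[OF V]
  interpret E: prob_space expd by (rule prob_space_expd)
  interpret D: prob_space D by (rule prob_space_D)
  interpret ED: pair_prob_space expd D ..
  have "(\<integral>\<^sup>+\<omega>. \<Phi> (V \<omega>, \<zeta> n \<omega>, \<eta> n \<omega>) \<partial>M) = (\<integral>\<^sup>+x. \<Phi> x \<partial>(distr M S V \<Otimes>\<^sub>M (expd \<Otimes>\<^sub>M D)))"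
    by (subst distr_past[OF V, symmetric]) (simp add: nn_integral_distr)
  also have "\<dots> = (\<integral>\<^sup>+v. \<integral>\<^sup>+x. \<Phi> (v, x) \<partial>(expd \<Otimes>\<^sub>M D) \<partial>distr M S V)"
    by (subst ED.nn_integral_fst[symmetric]) simp_all
  also have "\<dots> = (\<integral>\<^sup>+v. \<integral>\<^sup>+z. \<integral>\<^sup>+y. \<Phi> (v, z, y) \<partial>D \<partial>expd \<partial>distr M S V)"
    by (intro nn_integral_cong, subst D.nn_integral_fst[symmetric]) simp_all
  also have "\<dots> = (\<integral>\<^sup>+\<omega>. \<integral>\<^sup>+z. \<integral>\<^sup>+y. \<Phi> (V \<omega>, z, y) \<partial>D \<partial>expd \<partial>M)"
    by (subst nn_integral_distr) simp_all
  finally show ?thesis .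
qed

lemma integral_step:
  fixes \<Phi> :: "_ \<Rightarrow> 'b :: {banach, second_countable_topology}"
  assumes V: "V \<in> measurable (past n) S" and [measurable]: "\<Phi> \<in> borel_measurable (S \<Otimes>\<^sub>M (borel \<Otimes>\<^sub>M borel))"
    and bound: "\<And>\<omega> z y. \<omega> \<in> space M \<Longrightarrow> norm (\<Phi> (V \<omega>, z, y)) \<le> B"
  shows "(\<integral>\<omega>. \<Phi> (V \<omega>, \<zeta> n \<omega>, \<eta> n \<omega>) \<partial>M) = (\<integral>\<omega>. \<integral>z. \<integral>y. \<Phi> (V \<omega>, z, y) \<partial>D \<partial>expd \<partial>M)"
proof -
  note [measurable] = measurable_from_past[OF V]
  interpret E: prob_space expd by (rule prob_space_expd)
  interpret D: prob_space D by (rule prob_space_D)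
  interpret V: prob_space "distr M S V" by (rule prob_space_distr) simp
  interpret ED: pair_prob_space expd D ..
  interpret VED: pair_prob_space "distr M S V" "expd \<Otimes>\<^sub>M D" ..
  have "integrable M (\<lambda>\<omega>. \<Phi> (V \<omega>, \<zeta> n \<omega>, \<eta> n \<omega>))"
    by (rule integrable_const_bound[where B=B]) (auto intro!: bound)
  then have int: "integrable (distr M S V \<Otimes>\<^sub>M (expd \<Otimes>\<^sub>M D)) \<Phi>"
    by (subst distr_past[OF V, symmetric]) (simp add: integrable_distr_eq)
  have "(\<integral>\<omega>. \<Phi> (V \<omega>, \<zeta> n \<omega>, \<eta> n \<omega>) \<partial>M) = (\<integral>x. \<Phi> x \<partial>(distr M S V \<Otimes>\<^sub>M (expd \<Otimes>\<^sub>M D)))"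
    by (subst distr_past[OF V, symmetric]) (simp add: integral_distr)
  also have "\<dots> = (\<integral>v. \<integral>x. \<Phi> (v, x) \<partial>(expd \<Otimes>\<^sub>M D) \<partial>distr M S V)"
    by (rule VED.integral_fst'[OF int, symmetric])
  also have "\<dots> = (\<integral>\<omega>. \<integral>x. \<Phi> (V \<omega>, x) \<partial>(expd \<Otimes>\<^sub>M D) \<partial>M)"
    by (subst integral_distr) simp_all
  also have "\<dots> = (\<integral>\<omega>. \<integral>z. \<integral>y. \<Phi> (V \<omega>, z, y) \<partial>D \<partial>expd \<partial>M)"
  proof (rule Bochner_Integration.integral_cong[OF refl])
    fix \<omega> assume w: "\<omega> \<in> space M"
    then have [measurable]: "V \<omega> \<in> space S"
      using measurable_space[OF measurable_from_past[OF V]] by blast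
    have "integrable (expd \<Otimes>\<^sub>M D) (\<lambda>x. \<Phi> (V \<omega>, x))"
      by (rule ED.P.integrable_const_bound[where B=B]) (auto intro!: bound w)
    from ED.integral_fst'[OF this]
    show "(\<integral>x. \<Phi> (V \<omega>, x) \<partial>(expd \<Otimes>\<^sub>M D)) = (\<integral>z. \<integral>y. \<Phi> (V \<omega>, z, y) \<partial>D \<partial>expd)" by simp
  qed
  finally show ?thesis .
qed

end

section \<open>Counting arrivals: the intensity formula and its Borel-Cantelli consequences\<close>

context marked_arrivals
begin

text \<open>The arrival time just before \<open>arrival \<zeta> n\<close>, with value 0 for
  \<open>n = 0\<close>; unlike \<open>arrival \<zeta> n\<close> it is measurable for
  \<open>past n\<close>.\<close>

definition pre :: "nat \<Rightarrow> 'v \<Rightarrow> real" where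
  "pre n \<omega> = (\<Sum>i<n. \<zeta> i \<omega>)"

lemma arrival_eq: "arrival \<zeta> k \<omega> = pre k \<omega> + \<zeta> k \<omega>"
  by (simp add: arrival_def pre_def lessThan_Suc_atMost[symmetric])

lemma pre_Suc: "pre (Suc k) = arrival \<zeta> k"
  by (simp add: pre_def arrival_def fun_eq_iff lessThan_Suc_atMost)

lemma measurable_past_pre [measurable]: "pre n \<in> borel_measurable (past n)"
  unfolding pre_def by (intro borel_measurable_sum measurable_past_zeta) simp

lemma measurable_pre [measurable]: "pre n \<in> borel_measurable M"
  unfolding pre_def by measurable

lemma measurable_arrival [measurable]: "arrival \<zeta> k \<in> borel_measurable M"
  unfolding arrival_eq[abs_def] by measurable

lemma measurable_past_arrival [measurable (raw)]: "k < n \<Longrightarrow> arrival \<zeta> k \<in> borel_measurable (past n)"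
  unfolding arrival_def by (intro borel_measurable_sum measurable_past_zeta) simp

lemma AE_expd_pos: "AE z in expd. 0 < z"
  unfolding expd_def using AE_lborel_singleton[of "0::real"]
  by (subst AE_density) (auto elim!: eventually_mono simp: exponential_density_def)

lemma AE_zeta_pos: "AE \<omega> in M. \<forall>k. 0 < \<zeta> k \<omega>"
  unfolding AE_all_countable
proof
  fix k
  show "AE \<omega> in M. 0 < \<zeta> k \<omega>"
    using AE_expd_pos unfolding distr_zeta[of k, symmetric] by (subst (asm) AE_distr_iff) auto
qed

lemma AE_arrival_pos: "AE \<omega> in M. \<forall>k. 0 < arrival \<zeta> k \<omega>"
  using AE_zeta_pos by eventually_elim (auto simp: arrival_def intro!: sum_pos)

lemma AE_pre_nonneg: "AE \<omega> in M. \<forall>k. 0 \<le> pre k \<omega>"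
  using AE_zeta_pos by eventually_elim (simp add: pre_def sum_nonneg less_imp_le)

lemma distributed_arrival: "distributed M lborel (arrival \<zeta> k) (erlang_density k 1)"
proof -
  have "distributed M lborel (\<lambda>\<omega>. \<Sum>j\<in>Inl ` {..k}. case_sum \<zeta> \<eta> j \<omega>) (erlang_density (card (Inl ` {..k} :: (nat + nat) set) - 1) 1)"
    by (intro exponential_distributed_sum indep_vars_subset[OF indep]) (auto intro: exp)
  then show ?thesis
    by (simp add: sum.reindex card_image arrival_def[abs_def])
qed

text \<open>The Poisson process of arrival times has intensity one.\<close>

lemma suminf_erlang_density:
  assumes "0 < x"
  shows "(\<Sum>k. ennreal (erlang_density k 1 x)) = 1"
proof -
  have "(\<lambda>k. x ^ k /\<^sub>R fact k * exp (- x)) sums (exp x * exp (- x))"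
    by (intro sums_mult2 exp_converges)
  then have "(\<lambda>k. erlang_density k 1 x) sums 1"
    using assms by (simp add: erlang_density_def exp_minus divide_simps mult.commute)
  then show ?thesis
    by (subst suminf_ennreal2) (auto simp: sums_iff)
qed

text \<open>Campbell's formula: the points (arrival, mark) have intensity Lebesgue measure on
  \<open>{0<..}\<close> times \<open>D\<close>. Each mark is independent of its own arrival time, so
  it may first be averaged out into \<open>\<psi>\<close>; the Erlang densities of the arrival times
  then add up to 1.\<close>

lemma nn_integral_arrivals:
  assumes [measurable]: "case_prod \<phi> \<in> borel_measurable (borel \<Otimes>\<^sub>M borel)"
  shows "(\<Sum>k. \<integral>\<^sup>+\<omega>. \<phi> (arrival \<zeta> k \<omega>) (\<eta> k \<omega>) \<partial>M) = (\<integral>\<^sup>+y. \<integral>\<^sup>+x. \<phi> x y * indicator {0<..} x \<partial>lborel \<partial>D)"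
proof -
  interpret D: prob_space D by (rule prob_space_D)
  interpret pair_sigma_finite D "lborel :: real measure" ..
  define \<psi> where "\<psi> x = (\<integral>\<^sup>+y. \<phi> x y \<partial>D)" for x
  have [measurable]: "\<psi> \<in> borel_measurable borel"
    unfolding \<psi>_def by measurable
  have "(\<integral>\<^sup>+\<omega>. \<phi> (arrival \<zeta> k \<omega>) (\<eta> k \<omega>) \<partial>M) = (\<integral>\<^sup>+x. ennreal (erlang_density k 1 x) * \<psi> x \<partial>lborel)" for k
  proof -
    have "(\<integral>\<^sup>+\<omega>. \<phi> (arrival \<zeta> k \<omega>) (\<eta> k \<omega>) \<partial>M) = (\<integral>\<^sup>+\<omega>. \<integral>\<^sup>+z. \<integral>\<^sup>+y. \<phi> (pre k \<omega> + z) y \<partial>D \<partial>expd \<partial>M)"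
      using nn_integral_step[OF measurable_past_pre, of "\<lambda>(g, z, y). \<phi> (g + z) y"]
      by (simp add: arrival_eq)
    also have "\<dots> = (\<integral>\<^sup>+\<omega>. \<integral>\<^sup>+z. \<integral>\<^sup>+y. \<psi> (pre k \<omega> + z) \<partial>D \<partial>expd \<partial>M)"
      by (simp add: \<psi>_def D.emeasure_space_1[simplified])
    also have "\<dots> = (\<integral>\<^sup>+\<omega>. \<psi> (arrival \<zeta> k \<omega>) \<partial>M)"
      using nn_integral_step[OF measurable_past_pre, of "\<lambda>(g, z, y). \<psi> (g + z)"]
      by (simp add: arrival_eq)
    also have "\<dots> = (\<integral>\<^sup>+x. ennreal (erlang_density k 1 x) * \<psi> x \<partial>lborel)"
      by (rule distributed_nn_integral[OF distributed_arrival, symmetric]) simp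
    finally show ?thesis .
  qed
  then have "(\<Sum>k. \<integral>\<^sup>+\<omega>. \<phi> (arrival \<zeta> k \<omega>) (\<eta> k \<omega>) \<partial>M) = (\<integral>\<^sup>+x. (\<Sum>k. ennreal (erlang_density k 1 x) * \<psi> x) \<partial>lborel)"
    by (simp add: nn_integral_suminf del: ennreal_suminf_multc)
  also have "\<dots> = (\<integral>\<^sup>+x. \<psi> x * indicator {0<..} x \<partial>lborel)"
  proof (rule nn_integral_cong_AE)
    \<comment> \<open>The point 0 has to be discarded: \<open>erlang_density 0 1\<close> equals 1
      there, while the indicator of \<open>{0<..}\<close> vanishes.\<close>
    show "AE x in lborel. (\<Sum>k. ennreal (erlang_density k 1 x) * \<psi> x) = \<psi> x * indicator {0<..} x"
      using AE_lborel_singleton[of "0::real"]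
    proof eventually_elim
      case (elim x)
      show ?case
      proof (cases "0 < x")
        case True
        then show ?thesis by (subst ennreal_suminf_multc, subst suminf_erlang_density) simp_all
      next
        case False
        with elim have "erlang_density k 1 x = 0" for k by (simp add: erlang_density_def)
        then show ?thesis using False by simp
      qed
    qed
  qed
  also have "\<dots> = (\<integral>\<^sup>+x. \<integral>\<^sup>+y. \<phi> x y * indicator {0<..} x \<partial>D \<partial>lborel)"
    by (simp add: \<psi>_def nn_integral_multc)
  also have "\<dots> = (\<integral>\<^sup>+y. \<integral>\<^sup>+x. \<phi> x y * indicator {0<..} x \<partial>lborel \<partial>D)"
    by (rule Fubini') simp
  finally show ?thesis .
qed

text \<open>The hypothesis says that the expected number of points in \<open>P\<close> is finite, by
  the intensity formula; this number is the sum of probabilities in the first Borel-Cantelli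
  lemma.\<close>

lemma AE_eventually_not_arrivals:
  assumes [measurable]: "Measurable.pred (borel \<Otimes>\<^sub>M borel) (case_prod P)"
    and fin: "(\<integral>\<^sup>+y. \<integral>\<^sup>+x. indicator {(x, y). P x y} (x, y) * indicator {0<..} x \<partial>lborel \<partial>D) < \<infinity>"
  shows "AE \<omega> in M. \<forall>\<^sub>F k in sequentially. \<not> P (arrival \<zeta> k \<omega>) (\<eta> k \<omega>)"
proof -
  define A where "A k = {\<omega> \<in> space M. P (arrival \<zeta> k \<omega>) (\<eta> k \<omega>)}" for k
  have [measurable]: "A k \<in> sets M" for k
    unfolding A_def by measurable
  have eq: "(\<integral>\<^sup>+\<omega>. indicator {(x, y). P x y} (arrival \<zeta> k \<omega>, \<eta> k \<omega>) \<partial>M) = emeasure M (A k)" for k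
  proof -
    have "(\<integral>\<^sup>+\<omega>. indicator {(x, y). P x y} (arrival \<zeta> k \<omega>, \<eta> k \<omega>) \<partial>M) = (\<integral>\<^sup>+\<omega>. indicator (A k) \<omega> \<partial>M)"
      by (intro nn_integral_cong) (auto simp: A_def indicator_def)
    then show ?thesis by simp
  qed
  have "(\<Sum>k. emeasure M (A k)) < \<infinity>"
    using nn_integral_arrivals[of "\<lambda>x y. indicator {(x, y). P x y} (x, y)"] fin by (simp add: eq)
  then have "summable (\<lambda>k. measure M (A k))"
    by (intro summable_suminf_not_top) (auto simp: emeasure_eq_measure less_top)
  from borel_cantelli_AE1[OF _ _ this]
  have "AE \<omega> in M. \<forall>\<^sub>F k in sequentially. \<omega> \<in> space M - A k"
    by (auto simp: emeasure_eq_measure)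
  then show ?thesis
    by eventually_elim (auto simp: A_def elim!: eventually_mono)
qed

text \<open>The expected number of arrivals before time \<open>m\<close> is \<open>m\<close>, so
  almost surely only finitely many occur there. This replaces an appeal to the law of large
  numbers.\<close>

lemma AE_arrival_at_top: "AE \<omega> in M. filterlim (\<lambda>k. arrival \<zeta> k \<omega>) at_top sequentially"
proof -
  interpret D: prob_space D by (rule prob_space_D)
  have "AE \<omega> in M. \<forall>m::nat. \<forall>\<^sub>F k in sequentially. \<not> arrival \<zeta> k \<omega> < real m"
    unfolding AE_all_countable
  proof
    fix m :: nat
    have "(\<integral>\<^sup>+x. indicator {(x, y). x < real m} (x, y) * indicator {0<..} x \<partial>lborel) = ennreal m" for y :: real
    proof -
      have "(\<integral>\<^sup>+x. indicator {(x, y). x < real m} (x, y) * indicator {0<..} x \<partial>lborel) = (\<integral>\<^sup>+x. indicator {0<..<real m} x \<partial>lborel)"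
        by (intro nn_integral_cong) (auto simp: indicator_def)
      then show ?thesis by simp
    qed
    then have "(\<integral>\<^sup>+y. \<integral>\<^sup>+x. indicator {(x, y). x < real m} (x, y) * indicator {0<..} x \<partial>lborel \<partial>D) < \<infinity>"
      using D.emeasure_space_1 by simp
    from AE_eventually_not_arrivals[OF _ this]
    show "AE \<omega> in M. \<forall>\<^sub>F k in sequentially. \<not> arrival \<zeta> k \<omega> < real m" by simp
  qed
  then show ?thesis
  proof eventually_elim
    case (elim \<omega>)
    show ?case
      unfolding filterlim_at_top
    proof
      fix Z :: real
      obtain m :: nat where "Z \<le> m" using real_arch_simple by blast
      then show "\<forall>\<^sub>F k in sequentially. Z \<le> arrival \<zeta> k \<omega>"
        using elim[rule_format, of m] by (auto elim!: eventually_mono)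
    qed
  qed
qed

text \<open>For a mark \<open>y\<close> the forbidden times form the interval from 0 to
  \<open>\<bar>y\<bar> / c\<close>, so the expected number of violations is the first absolute
  moment of \<open>D\<close> divided by \<open>c\<close>.\<close>

lemma AE_eventually_mark_le:
  assumes int: "integrable D (\<lambda>y. y)" and c: "0 < c"
  shows "AE \<omega> in M. \<forall>\<^sub>F k in sequentially. \<bar>\<eta> k \<omega>\<bar> \<le> c * arrival \<zeta> k \<omega>"
proof -
  have "(\<integral>\<^sup>+x. indicator {(x, y). \<not> \<bar>y\<bar> \<le> c * x} (x, y) * indicator {0<..} x \<partial>lborel) = ennreal (norm y) / c" for y :: real
  proof -
    have "(\<integral>\<^sup>+x. indicator {(x, y). \<not> \<bar>y\<bar> \<le> c * x} (x, y) * indicator {0<..} x \<partial>lborel) = (\<integral>\<^sup>+x. indicator {0<..<\<bar>y\<bar> / c} x \<partial>lborel)"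
      using c by (intro nn_integral_cong) (auto simp: indicator_def field_simps)
    then show ?thesis using c by (simp add: divide_ennreal)
  qed
  then have "(\<integral>\<^sup>+y. \<integral>\<^sup>+x. indicator {(x, y). \<not> \<bar>y\<bar> \<le> c * x} (x, y) * indicator {0<..} x \<partial>lborel \<partial>D) =
      (\<integral>\<^sup>+y. ennreal (norm y) \<partial>D) / c"
    by (simp add: nn_integral_divide)
  also have "\<dots> < \<infinity>"
    using int c by (auto simp: integrable_iff_bounded ennreal_divide_eq_top_iff top.not_eq_extremum[symmetric])
  finally show ?thesis
    using AE_eventually_not_arrivals[of "\<lambda>x y. \<not> \<bar>y\<bar> \<le> c * x"] by simp
qed

end

subsection \<open>Convergence of the series\<close>

text \<open>
  Kolmogorov's maximal inequality, obtained by stopping the partial sums when they leave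
  the interval of radius \<open>\<epsilon>\<close>: the stopped sum has at most the second moment of the full sum.
\<close>

lemma (in prob_space) martingale_difference_maximal:
  fixes Z :: "nat \<Rightarrow> 'a \<Rightarrow> real" and F :: "nat \<Rightarrow> 'a measure"
  assumes sub: "\<And>k V. V \<in> borel_measurable (F k) \<Longrightarrow> (V :: 'a \<Rightarrow> real) \<in> borel_measurable M"
    and adapted: "\<And>i k. i < k \<Longrightarrow> Z i \<in> borel_measurable (F k)"
    and bound: "\<And>k \<omega>. \<bar>Z k \<omega>\<bar> \<le> 1"
    and orth: "\<And>k V B. V \<in> borel_measurable (F k) \<Longrightarrow> (\<And>\<omega>. \<bar>V \<omega>\<bar> \<le> B) \<Longrightarrow> (\<integral>\<omega>. V \<omega> * Z k \<omega> \<partial>M) = 0"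
    and \<epsilon>: "0 < \<epsilon>"
  shows "prob {\<omega> \<in> space M. \<exists>k\<in>{m..n}. \<epsilon> \<le> \<bar>\<Sum>i=m..<k. Z i \<omega>\<bar>} \<le> (\<Sum>i=m..<n. \<integral>\<omega>. (Z i \<omega>)\<^sup>2 \<partial>M) / \<epsilon>\<^sup>2"
proof -
  have [measurable]: "Z i \<in> borel_measurable M" for i
    by (rule sub[OF adapted[of i "Suc i"]]) simp
  \<comment> \<open>\<open>b k\<close> is the indicator that no partial sum up to
    \<open>\<Sum>i=m..<k\<close> has left the interval. It involves only \<open>Z i\<close> with
    \<open>i < k\<close>, hence is known to \<open>F k\<close>, and so the cross terms in the second
    moment of the stopped sum \<open>T\<close> vanish by \<open>orth\<close>.\<close>
  define b where "b k \<omega> = (\<Prod>j\<in>{m..k}. if \<bar>\<Sum>i=m..<j. Z i \<omega>\<bar> < \<epsilon> then 1 else 0 :: real)" for k \<omega>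
  define T where "T k \<omega> = (\<Sum>i=m..<k. b i \<omega> * Z i \<omega>)" for k \<omega>
  have b1: "b k \<omega> = 1" if "\<And>j. m \<le> j \<Longrightarrow> j \<le> k \<Longrightarrow> \<bar>\<Sum>i=m..<j. Z i \<omega>\<bar> < \<epsilon>" for k \<omega>
    unfolding b_def using that by (intro prod.neutral) auto
  have b0: "b k \<omega> = 0" if "m \<le> j" "j \<le> k" "\<epsilon> \<le> \<bar>\<Sum>i=m..<j. Z i \<omega>\<bar>" for j k \<omega>
    unfolding b_def using that by (intro prod_zero) (auto intro!: bexI[of _ j])
  have b01: "b k \<omega> = 0 \<or> b k \<omega> = 1" for k \<omega>
    by (cases "\<forall>j. m \<le> j \<longrightarrow> j \<le> k \<longrightarrow> \<bar>\<Sum>i=m..<j. Z i \<omega>\<bar> < \<epsilon>") (auto intro: b1 b0 simp: not_less)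
  have bZ: "\<bar>b i \<omega> * Z i \<omega>\<bar> \<le> 1" for i \<omega>
    using b01[of i \<omega>] bound[of i \<omega>] by auto
  have bF: "b i \<in> borel_measurable (F k)" if "i \<le> k" for i k
  proof -
    have "(\<lambda>\<omega>. \<Sum>i=m..<j. Z i \<omega>) \<in> borel_measurable (F k)" if "j \<le> i" for j
      using that \<open>i \<le> k\<close> by (intro borel_measurable_sum adapted) auto
    then have "(\<lambda>\<omega>. if \<bar>\<Sum>i=m..<j. Z i \<omega>\<bar> < \<epsilon> then 1 else 0 :: real) \<in> borel_measurable (F k)" if "j \<le> i" for j
      using that by (intro measurable_compose[where f="\<lambda>\<omega>. \<Sum>i=m..<j. Z i \<omega>" and g="\<lambda>s. if \<bar>s\<bar> < \<epsilon> then 1 else 0"]) auto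
    then show ?thesis
      unfolding b_def by (intro borel_measurable_prod) simp
  qed
  have [measurable]: "b i \<in> borel_measurable M" for i
    by (rule sub[OF bF[of i i]]) simp
  have [measurable]: "T k \<in> borel_measurable M" for k
    unfolding T_def by measurable
  have T_bound: "\<bar>T k \<omega>\<bar> \<le> real k" for k \<omega>
  proof -
    have "\<bar>T k \<omega>\<bar> \<le> (\<Sum>i=m..<k. 1)"
      unfolding T_def by (intro order_trans[OF sum_abs] sum_mono bZ)
    then show ?thesis by simp
  qed
  have intT: "integrable M (\<lambda>\<omega>. (T k \<omega>)\<^sup>2)" for k
    by (rule integrable_const_bound[where B="(real k)\<^sup>2"])
       (use power_mono[OF T_bound[of k], where n=2] in auto)
  have T2: "(\<integral>\<omega>. (T k \<omega>)\<^sup>2 \<partial>M) \<le> (\<Sum>i=m..<k. \<integral>\<omega>. (Z i \<omega>)\<^sup>2 \<partial>M)" for k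
  proof (induction k)
    case 0 show ?case by (simp add: T_def)
  next
    case (Suc k)
    show ?case
    proof (cases "m \<le> k")
      case True
      let ?V = "\<lambda>\<omega>. T k \<omega> * b k \<omega>"
      have VB: "\<bar>?V \<omega>\<bar> \<le> real k" for \<omega>
        using b01[of k \<omega>] T_bound[of k \<omega>] by auto
      have "?V \<in> borel_measurable (F k)"
        unfolding T_def using True by (intro borel_measurable_times borel_measurable_sum bF adapted) auto
      then have 0: "(\<integral>\<omega>. ?V \<omega> * Z k \<omega> \<partial>M) = 0"
        by (rule orth) (rule VB)
      have "\<bar>?V \<omega> * Z k \<omega>\<bar> \<le> real k * 1" for \<omega>
        unfolding abs_mult[of "?V \<omega>"] by (intro mult_mono VB bound) auto
      then have i1: "integrable M (\<lambda>\<omega>. ?V \<omega> * Z k \<omega>)"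
        by (intro integrable_const_bound[where B="real k * 1"] AE_I2) (auto simp del: abs_mult)
      have i2: "integrable M (\<lambda>\<omega>. (Z k \<omega>)\<^sup>2)" "integrable M (\<lambda>\<omega>. (b k \<omega> * Z k \<omega>)\<^sup>2)"
        by (rule integrable_const_bound[where B="1"]; use bound[of k] bZ[of k] in \<open>auto simp: abs_square_le_1\<close>)+
      have "(\<integral>\<omega>. (T (Suc k) \<omega>)\<^sup>2 \<partial>M) = (\<integral>\<omega>. (T k \<omega>)\<^sup>2 + 2 * (?V \<omega> * Z k \<omega>) + (b k \<omega> * Z k \<omega>)\<^sup>2 \<partial>M)"
        using True by (intro Bochner_Integration.integral_cong) (auto simp: T_def power2_eq_square algebra_simps)
      also have "\<dots> = (\<integral>\<omega>. (T k \<omega>)\<^sup>2 \<partial>M) + (\<integral>\<omega>. (b k \<omega> * Z k \<omega>)\<^sup>2 \<partial>M)"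
        using intT[of k] i1 i2 0 by simp
      also have "(\<integral>\<omega>. (b k \<omega> * Z k \<omega>)\<^sup>2 \<partial>M) \<le> (\<integral>\<omega>. (Z k \<omega>)\<^sup>2 \<partial>M)"
      proof (rule integral_mono[OF i2(2,1)])
        show "(b k \<omega> * Z k \<omega>)\<^sup>2 \<le> (Z k \<omega>)\<^sup>2" for \<omega> using b01[of k \<omega>] by auto
      qed
      finally show ?thesis using Suc True by simp
    next
      case False
      then show ?thesis by (simp add: T_def)
    qed
  qed
  \<comment> \<open>At the first exit index \<open>k\<close> the factors \<open>b i\<close> switch
    from 1 (for \<open>i < k\<close>) to 0 (from \<open>k\<close> on), so \<open>T n\<close> stays
    frozen at the partial sum that left the interval.\<close>
  have T_exit: "\<epsilon> \<le> \<bar>T n \<omega>\<bar>" if "\<exists>k\<in>{m..n}. \<epsilon> \<le> \<bar>\<Sum>i=m..<k. Z i \<omega>\<bar>" for \<omega>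
  proof -
    define P where "P k \<longleftrightarrow> m \<le> k \<and> \<epsilon> \<le> \<bar>\<Sum>i=m..<k. Z i \<omega>\<bar>" for k
    define k where "k = (LEAST k. P k)"
    have ex: "\<exists>k. P k" using that by (auto simp: P_def)
    have k: "P k" unfolding k_def using ex by (rule LeastI_ex)
    have min: "\<not> P j" if "j < k" for j using that unfolding k_def by (rule not_less_Least)
    have "k \<le> n" using that Least_le[of P] unfolding k_def P_def by fastforce
    have "T n \<omega> = (\<Sum>i=m..<k. b i \<omega> * Z i \<omega>) + (\<Sum>i=k..<n. b i \<omega> * Z i \<omega>)"
      unfolding T_def using k \<open>k \<le> n\<close> by (intro sum.atLeastLessThan_concat[symmetric]) (auto simp: P_def)
    also have "(\<Sum>i=k..<n. b i \<omega> * Z i \<omega>) = 0"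
      using b0[of k] k by (intro sum.neutral) (auto simp: P_def)
    also have "(\<Sum>i=m..<k. b i \<omega> * Z i \<omega>) = (\<Sum>i=m..<k. Z i \<omega>)"
    proof (intro sum.cong refl)
      fix i assume "i \<in> {m..<k}"
      then have "\<not> P j" if "j \<le> i" for j using that by (intro min) auto
      then have "b i \<omega> = 1" by (intro b1) (metis P_def not_le)
      then show "b i \<omega> * Z i \<omega> = Z i \<omega>" by simp
    qed
    finally show ?thesis using k by (simp add: P_def)
  qed
  have "prob {\<omega> \<in> space M. \<exists>k\<in>{m..n}. \<epsilon> \<le> \<bar>\<Sum>i=m..<k. Z i \<omega>\<bar>} \<le> prob {\<omega> \<in> space M. \<epsilon>\<^sup>2 \<le> (T n \<omega>)\<^sup>2}"
    using T_exit \<epsilon> by (intro finite_measure_mono) (auto simp: abs_le_square_iff[symmetric])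
  also have "\<dots> \<le> (\<integral>\<omega>. (T n \<omega>)\<^sup>2 \<partial>M) / \<epsilon>\<^sup>2"
    using \<epsilon> by (intro integral_Markov_inequality_measure[where A="{}"] intT) auto
  also have "\<dots> \<le> (\<Sum>i=m..<n. \<integral>\<omega>. (Z i \<omega>)\<^sup>2 \<partial>M) / \<epsilon>\<^sup>2"
    by (intro divide_right_mono T2) simp
  finally show ?thesis .
qed

text \<open>The maximal inequality bounds the chance of an excursion of size
  \<open>\<epsilon>\<close> after index \<open>m\<close> by a tail of the variance series, which
  tends to 0 with growing \<open>m\<close>. Countably many \<open>\<epsilon>\<close> then give the
  Cauchy criterion almost surely.\<close>

lemma (in prob_space) martingale_difference_summable:
  fixes Z :: "nat \<Rightarrow> 'a \<Rightarrow> real" and F :: "nat \<Rightarrow> 'a measure"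
  assumes sub: "\<And>k V. V \<in> borel_measurable (F k) \<Longrightarrow> (V :: 'a \<Rightarrow> real) \<in> borel_measurable M"
    and adapted: "\<And>i k. i < k \<Longrightarrow> Z i \<in> borel_measurable (F k)"
    and bound: "\<And>k \<omega>. \<bar>Z k \<omega>\<bar> \<le> 1"
    and orth: "\<And>k V B. V \<in> borel_measurable (F k) \<Longrightarrow> (\<And>\<omega>. \<bar>V \<omega>\<bar> \<le> B) \<Longrightarrow> (\<integral>\<omega>. V \<omega> * Z k \<omega> \<partial>M) = 0"
    and summ: "summable (\<lambda>k. \<integral>\<omega>. (Z k \<omega>)\<^sup>2 \<partial>M)"
  shows "AE \<omega> in M. summable (\<lambda>k. Z k \<omega>)"
proof -
  have [measurable]: "Z i \<in> borel_measurable M" for i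
    by (rule sub[OF adapted[of i "Suc i"]]) simp
  let ?v = "\<lambda>k. \<integral>\<omega>. (Z k \<omega>)\<^sup>2 \<partial>M"
  have "AE \<omega> in M. \<exists>m. \<forall>n\<ge>m. \<bar>\<Sum>i=m..<n. Z i \<omega>\<bar> < \<epsilon>" if \<epsilon>: "0 < \<epsilon>" for \<epsilon>
  proof -
    define A where "A m n = {\<omega> \<in> space M. \<exists>k\<in>{m..n}. \<epsilon> \<le> \<bar>\<Sum>i=m..<k. Z i \<omega>\<bar>}" for m n
    \<comment> \<open>The bad event for \<open>\<epsilon>\<close>: whatever the starting index
      \<open>m\<close>, some later block of terms has a sum of size at least
      \<open>\<epsilon>\<close>.\<close>
    define N where "N = (\<Inter>m. \<Union>n. A m n)"
    have [measurable]: "A m n \<in> sets M" for m n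
      unfolding A_def by measurable
    have [measurable]: "N \<in> sets M" unfolding N_def by measurable
    have le: "prob N \<le> (\<Sum>i. ?v (i + m)) / \<epsilon>\<^sup>2" for m
    proof -
      have "(\<lambda>n. prob (A m n)) \<longlonglongrightarrow> prob (\<Union>n. A m n)"
        by (intro finite_Lim_measure_incseq) (force simp: A_def incseq_def)+
      moreover have "prob (A m n) \<le> (\<Sum>i. ?v (i + m)) / \<epsilon>\<^sup>2" for n
      proof -
        have "prob (A m n) \<le> (\<Sum>i=m..<n. ?v i) / \<epsilon>\<^sup>2"
          unfolding A_def by (rule martingale_difference_maximal[OF sub adapted bound orth \<epsilon>])
        also have "(\<Sum>i=m..<n. ?v i) = (\<Sum>i<n - m. ?v (i + m))"
          by (rule sum.reindex_bij_witness[of _ "\<lambda>i. i + m" "\<lambda>i. i - m"]) auto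
        also have "\<dots> \<le> (\<Sum>i. ?v (i + m))"
          using summ by (intro sum_le_suminf) (auto intro: summable_ignore_initial_segment)
        finally show ?thesis by (simp add: divide_right_mono)
      qed
      ultimately have "prob (\<Union>n. A m n) \<le> (\<Sum>i. ?v (i + m)) / \<epsilon>\<^sup>2"
        by (intro LIMSEQ_le_const2) auto
      moreover have "prob N \<le> prob (\<Union>n. A m n)"
        by (intro finite_measure_mono) (auto simp: N_def)
      ultimately show ?thesis by simp
    qed
    have "(\<lambda>m. (\<Sum>i. ?v (i + m)) / \<epsilon>\<^sup>2) \<longlonglongrightarrow> 0 / \<epsilon>\<^sup>2"
      using \<epsilon> by (intro tendsto_intros suminf_exist_split2 summ) auto
    then have "prob N \<le> 0 / \<epsilon>\<^sup>2"
      using le by (intro LIMSEQ_le_const) auto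
    then have "prob N = 0" by (simp add: measure_le_0_iff)
    then have "AE \<omega> in M. \<omega> \<notin> N" by (simp add: prob_eq_0)
    then show ?thesis
      using AE_space by eventually_elim (force simp: N_def A_def not_le)
  qed
  then have "AE \<omega> in M. \<forall>j::nat. \<exists>m. \<forall>n\<ge>m. \<bar>\<Sum>i=m..<n. Z i \<omega>\<bar> < inverse (real (Suc j))"
    unfolding AE_all_countable by simp
  then show ?thesis
  proof eventually_elim
    case (elim \<omega>)
    show ?case
      unfolding summable_Cauchy
    proof (intro allI impI)
      fix e :: real assume "0 < e"
      then obtain j where j: "inverse (real (Suc j)) < e / 2"
        using reals_Archimedean[of "e / 2"] by auto
      obtain m where m: "\<And>n. n \<ge> m \<Longrightarrow> \<bar>\<Sum>i=m..<n. Z i \<omega>\<bar> < inverse (real (Suc j))"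
        using elim by blast
      have "norm (\<Sum>i=k..<n. Z i \<omega>) < e" if "k \<ge> m" for k n
      proof (cases "k \<le> n")
        case True
        then have "(\<Sum>i=m..<k. Z i \<omega>) + (\<Sum>i=k..<n. Z i \<omega>) = (\<Sum>i=m..<n. Z i \<omega>)"
          using that by (intro sum.atLeastLessThan_concat) auto
        then show ?thesis using m[of k] m[of n] that True j by simp
      qed (use \<open>0 < e\<close> in simp)
      then show "\<exists>N. \<forall>m\<ge>N. \<forall>n. norm (\<Sum>i=m..<n. Z i \<omega>) < e" by blast
    qed
  qed
qed

section \<open>Almost sure convergence for symmetric marks, and the product formula\<close>

context marked_arrivals
begin

text \<open>The kernel \<open>c\<close> keeps exactly the terms of size at most 1. By symmetry of
  \<open>D\<close> the kept terms are centred given the past, and by the intensity formula their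
  second moments add up to the first absolute moment of \<open>D\<close>, so the martingale
  criterion applies. Integrability also ensures that truncation changes only finitely many
  terms.\<close>

lemma AE_summable_marks:
  assumes int: "integrable D (\<lambda>y. y)" and sym: "distr D borel uminus = D"
  shows "AE \<omega> in M. summable (\<lambda>k. inverse (arrival \<zeta> k \<omega>) * \<eta> k \<omega>)"
proof -
  interpret D: prob_space D by (rule prob_space_D)
  define c :: "real \<Rightarrow> real \<Rightarrow> real" where "c x y = (if \<bar>y\<bar> \<le> x then y / x else 0)" for x y
  have [measurable]: "case_prod c \<in> borel_measurable (borel \<Otimes>\<^sub>M borel)"
    unfolding c_def[abs_def] case_prod_beta by measurable
  have c1: "\<bar>c x y\<bar> \<le> 1" for x y
    by (auto simp: c_def divide_le_eq)
  have c_odd: "c x (- y) = - c x y" for x y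
    by (simp add: c_def)
  have c0: "(\<integral>y. c x y \<partial>D) = 0" for x
  proof -
    have "(\<integral>y. c x y \<partial>D) = (\<integral>y. c x y \<partial>distr D borel uminus)" by (simp add: sym)
    also have "\<dots> = - (\<integral>y. c x y \<partial>D)" by (simp add: integral_distr c_odd)
    finally show ?thesis by simp
  qed
  define Z where "Z k \<omega> = c (arrival \<zeta> k \<omega>) (\<eta> k \<omega>)" for k \<omega>
  have [measurable]: "Z k \<in> borel_measurable M" for k
    unfolding Z_def by measurable
  have "AE \<omega> in M. summable (\<lambda>k. Z k \<omega>)"
  proof (rule martingale_difference_summable[where F=past])
    show "V \<in> borel_measurable (past k) \<Longrightarrow> V \<in> borel_measurable M" for V :: "'v \<Rightarrow> real" and k
      by (rule measurable_from_past)
    show "Z i \<in> borel_measurable (past k)" if "i < k" for i k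
      unfolding Z_def using measurable_past_arrival[OF that] measurable_past_eta[OF that] by measurable
    show "\<bar>Z k \<omega>\<bar> \<le> 1" for k \<omega> by (simp add: Z_def c1)
    show "(\<integral>\<omega>. V \<omega> * Z k \<omega> \<partial>M) = 0"
      if V: "V \<in> borel_measurable (past k)" and B: "\<And>\<omega>. \<bar>V \<omega>\<bar> \<le> B" for V :: "'v \<Rightarrow> real" and B k
    proof -
      have P: "(\<lambda>\<omega>. (V \<omega>, pre k \<omega>)) \<in> measurable (past k) (borel \<Otimes>\<^sub>M borel)"
        by (intro measurable_Pair V measurable_past_pre)
      have le: "norm (V \<omega> * c (pre k \<omega> + z) y) \<le> B * 1" for \<omega> z y
        unfolding norm_mult using B[of \<omega>] by (intro mult_mono) (auto simp: c1)
      let ?\<Phi> = "\<lambda>p. fst (fst p) * c (snd (fst p) + fst (snd p)) (snd (snd p))"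
      have "(\<integral>\<omega>. ?\<Phi> ((V \<omega>, pre k \<omega>), \<zeta> k \<omega>, \<eta> k \<omega>) \<partial>M) =
          (\<integral>\<omega>. \<integral>z. \<integral>y. ?\<Phi> ((V \<omega>, pre k \<omega>), z, y) \<partial>D \<partial>expd \<partial>M)"
        by (rule integral_step[OF P, where B="B * 1"]) (use le in auto)
      then show ?thesis
        by (simp add: Z_def arrival_eq c0)
    qed
    \<comment> \<open>Truncation restricts \<open>x\<close> to at least
      \<open>\<bar>y\<bar>\<close>, and the integral of \<open>(y / x)\<^sup>2\<close> over that
      half-line is exactly \<open>\<bar>y\<bar>\<close>: a first moment controls the truncated
      second moments.\<close>
    have "(\<integral>\<^sup>+x. ennreal ((c x y)\<^sup>2) * indicator {0<..} x \<partial>lborel) = ennreal (norm y)" for y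
    proof (cases "y = 0")
      case True
      moreover have "c x 0 = 0" for x by (cases "0 \<le> x") (simp_all add: c_def)
      ultimately show ?thesis by simp
    next
      case False
      have "(\<integral>\<^sup>+x. ennreal ((c x y)\<^sup>2) * indicator {0<..} x \<partial>lborel) =
          (\<integral>\<^sup>+x. ennreal ((y / x)\<^sup>2) * indicator {\<bar>y\<bar>..} x \<partial>lborel)"
        using False by (intro nn_integral_cong) (auto simp: c_def indicator_def)
      also have "\<dots> = ennreal (0 - (- (y\<^sup>2 / \<bar>y\<bar>)))"
      proof (rule nn_integral_FTC_atLeast)
        show "((\<lambda>x. - (y\<^sup>2 / x)) has_real_derivative (y / x)\<^sup>2) (at x)" if "\<bar>y\<bar> \<le> x" for x
          using that False by (auto intro!: derivative_eq_intros simp: power2_eq_square)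
        show "((\<lambda>x. - (y\<^sup>2 / x)) \<longlongrightarrow> 0) at_top"
          using tendsto_minus[OF tendsto_divide_0[OF tendsto_const[of "y\<^sup>2"]
            filterlim_at_top_imp_at_infinity[OF filterlim_ident]]] by simp
      qed auto
      also have "0 - (- (y\<^sup>2 / \<bar>y\<bar>)) = norm y"
        by (simp add: power2_eq_square abs_if)
      finally show ?thesis .
    qed
    then have "(\<Sum>k. \<integral>\<^sup>+\<omega>. ennreal ((Z k \<omega>)\<^sup>2) \<partial>M) = (\<integral>\<^sup>+y. ennreal (norm y) \<partial>D)"
      using nn_integral_arrivals[of "\<lambda>x y. ennreal ((c x y)\<^sup>2)"] by (simp add: Z_def)
    also have "\<dots> < \<infinity>"
      using int by (simp add: integrable_iff_bounded)
    finally have "(\<Sum>k. \<integral>\<^sup>+\<omega>. ennreal ((Z k \<omega>)\<^sup>2) \<partial>M) < \<infinity>" .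
    moreover have "(\<integral>\<^sup>+\<omega>. ennreal ((Z k \<omega>)\<^sup>2) \<partial>M) = ennreal (\<integral>\<omega>. (Z k \<omega>)\<^sup>2 \<partial>M)" for k
    proof (rule nn_integral_eq_integral)
      show "integrable M (\<lambda>\<omega>. (Z k \<omega>)\<^sup>2)"
        by (rule integrable_const_bound[where B=1]) (auto simp: Z_def c1 abs_square_le_1)
    qed simp
    ultimately show "summable (\<lambda>k. \<integral>\<omega>. (Z k \<omega>)\<^sup>2 \<partial>M)"
      by (intro summable_suminf_not_top) (auto simp: less_top[symmetric])
  qed
  with AE_eventually_mark_le[OF int zero_less_one] show ?thesis
  proof eventually_elim
    case (elim \<omega>)
    then have "\<forall>\<^sub>F k in sequentially. Z k \<omega> = inverse (arrival \<zeta> k \<omega>) * \<eta> k \<omega>"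
      by (auto elim!: eventually_mono simp: Z_def c_def field_simps)
    then show ?case using elim(2) by (simp add: summable_cong)
  qed
qed

text \<open>
  With \<open>G x = exp (- \<integral>\<^sub>x\<^sup>\<infinity> (1 - f))\<close>, the products below multiplied by \<open>G (pre n)\<close> form a
  martingale, by the renewal equation for \<open>G\<close>.
\<close>

lemma expectation_prod_arrivals:
  fixes h :: "real \<Rightarrow> real \<Rightarrow> complex" and f :: "real \<Rightarrow> real"
  assumes meas: "case_prod h \<in> borel_measurable (borel \<Otimes>\<^sub>M borel)"
    and h1: "\<And>x y. norm (h x y) \<le> 1"
    and f: "\<And>x. 0 < x \<Longrightarrow> (\<integral>y. h x y \<partial>D) = of_real (f x)" and f0: "\<And>x. x \<le> 0 \<Longrightarrow> f x = 1"
    and cont: "continuous_on {0<..} f" and int: "integrable lborel (\<lambda>x. 1 - f x)"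
  shows "(\<lambda>n. \<integral>\<omega>. (\<Prod>k<n. h (arrival \<zeta> k \<omega>) (\<eta> k \<omega>)) \<partial>M) \<longlonglongrightarrow> of_real (exp (- (\<integral>x. 1 - f x \<partial>lborel)))"
proof -
  note [measurable] = meas
  interpret E: prob_space expd by (rule prob_space_expd)
  interpret D: prob_space D by (rule prob_space_D)
  define G where "G x = exp (- (LBINT t:{x<..}. 1 - f t))" for x
  have "(\<lambda>x. 1 - (1 - f x)) \<in> borel_measurable lborel"
    by (intro borel_measurable_diff borel_measurable_const borel_measurable_integrable[OF int])
  then have [measurable]: "f \<in> borel_measurable borel" by simp
  have [measurable]: "G \<in> borel_measurable borel"
    unfolding G_def set_lebesgue_integral_def indicator_def greaterThan_iff by measurable
  define B where "B = exp (\<integral>x. \<bar>1 - f x\<bar> \<partial>lborel)"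
  have GB: "\<bar>G x\<bar> \<le> B" for x
  proof -
    have "\<bar>LBINT t:{x<..}. 1 - f t\<bar> \<le> (\<integral>t. \<bar>indicator {x<..} t *\<^sub>R (1 - f t)\<bar> \<partial>lborel)"
      unfolding set_lebesgue_integral_def by (rule integral_abs_bound)
    also have "\<dots> \<le> (\<integral>t. \<bar>1 - f t\<bar> \<partial>lborel)"
      using int by (intro integral_mono integrable_abs integrable_mult_indicator) (auto simp: indicator_def)
    finally show ?thesis by (auto simp: G_def B_def abs_le_iff)
  qed
  have int0: "set_integrable lborel {0<..} (\<lambda>x. 1 - f x)"
    unfolding set_integrable_def using int by (intro integrable_mult_indicator) auto
  have G_top: "(G \<longlongrightarrow> 1) at_top"
    unfolding G_def using tendsto_tail_integral_at_top[OF int0] by (auto intro!: tendsto_eq_intros)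
  have G0: "G 0 = exp (- (\<integral>x. 1 - f x \<partial>lborel))"
    unfolding G_def set_lebesgue_integral_def
    by (auto intro!: Bochner_Integration.integral_cong simp: indicator_def f0)
  have f1: "\<bar>f x\<bar> \<le> 1" if "0 < x" for x
  proof -
    have "\<bar>f x\<bar> = norm (\<integral>y. h x y \<partial>D)" using f[OF that] by simp
    also have "\<dots> \<le> (\<integral>y. norm (h x y) \<partial>D)" by (rule integral_norm_bound)
    also have "\<dots> \<le> (\<integral>y. 1 \<partial>D)"
      by (intro integral_mono D.integrable_const_bound[where B=1]) (auto simp: h1)
    finally show ?thesis using D.prob_space by simp
  qed
  have renewal: "(\<integral>z. f (g + z) * G (g + z) \<partial>expd) = G g" if "0 \<le> g" for g
  proof -
    have "(\<integral>z. f (g + z) * G (g + z) \<partial>expd) = (LBINT z. exponential_density 1 z *\<^sub>R (f (g + z) * G (g + z)))"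
      unfolding expd_def by (subst integral_density) (auto simp: exponential_density_nonneg)
    also have "\<dots> = (LBINT z:{0<..}. exp (- z) * (f (g + z) * G (g + z)))"
      unfolding set_lebesgue_integral_def
      using AE_lborel_singleton[of "0::real"]
      by (intro integral_cong_AE) (auto elim!: eventually_mono simp: exponential_density_def indicator_def)
    also have "\<dots> = G g"
      unfolding G_def by (rule exponential_renewal[OF cont f1 int0 that])
    finally show ?thesis .
  qed
  let ?P = "\<lambda>n \<omega>. \<Prod>k<n. h (arrival \<zeta> k \<omega>) (\<eta> k \<omega>)"
  have P1: "norm (?P n \<omega>) \<le> 1" for n \<omega>
    unfolding prod_norm[symmetric] by (intro prod_le_1) (auto simp: h1)
  have mart: "(\<integral>\<omega>. ?P n \<omega> * of_real (G (pre n \<omega>)) \<partial>M) = of_real (G 0)" for n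
  proof (induction n)
    case 0
    show ?case by (simp add: pre_def prob_space)
  next
    case (Suc n)
    \<comment> \<open>The next weighted product as a function of the past pair (product, elapsed
      time) and of the fresh gap and mark. Averaging over the mark turns \<open>h\<close> into
      \<open>f\<close>, averaging over the gap is the renewal equation.\<close>
    let ?\<Phi> = "\<lambda>p. fst (fst p) * (h (snd (fst p) + fst (snd p)) (snd (snd p)) *
      of_real (G (snd (fst p) + fst (snd p))))"
    have V: "(\<lambda>\<omega>. (?P n \<omega>, pre n \<omega>)) \<in> measurable (past n) (borel \<Otimes>\<^sub>M borel)"
    proof (intro measurable_Pair measurable_past_pre borel_measurable_prod)
      fix k assume "k \<in> {..<n}"
      then have "arrival \<zeta> k \<in> borel_measurable (past n)" "\<eta> k \<in> borel_measurable (past n)"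
        by (auto intro: measurable_past_arrival measurable_past_eta)
      then show "(\<lambda>\<omega>. h (arrival \<zeta> k \<omega>) (\<eta> k \<omega>)) \<in> borel_measurable (past n)" by measurable
    qed
    have bound: "norm (?P n \<omega> * (h (pre n \<omega> + z) y * of_real (G (pre n \<omega> + z)))) \<le> 1 * (1 * B)" for \<omega> z y
      unfolding norm_mult by (intro mult_mono P1 h1) (auto simp: GB)
    have "(\<integral>\<omega>. ?P (Suc n) \<omega> * of_real (G (pre (Suc n) \<omega>)) \<partial>M) =
        (\<integral>\<omega>. ?\<Phi> ((?P n \<omega>, pre n \<omega>), \<zeta> n \<omega>, \<eta> n \<omega>) \<partial>M)"
      by (simp add: pre_Suc arrival_eq mult.assoc)
    also have "\<dots> = (\<integral>\<omega>. \<integral>z. \<integral>y. ?\<Phi> ((?P n \<omega>, pre n \<omega>), z, y) \<partial>D \<partial>expd \<partial>M)"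
      by (rule integral_step[OF V]) (use bound in auto)
    also have "\<dots> = (\<integral>\<omega>. ?P n \<omega> * of_real (G (pre n \<omega>)) \<partial>M)"
    proof (rule integral_cong_AE)
      show "AE \<omega> in M. (\<integral>z. \<integral>y. ?\<Phi> ((?P n \<omega>, pre n \<omega>), z, y) \<partial>D \<partial>expd) = ?P n \<omega> * of_real (G (pre n \<omega>))"
        using AE_pre_nonneg
      proof eventually_elim
        case (elim \<omega>)
        let ?g = "pre n \<omega>"
        have "(\<integral>z. \<integral>y. ?\<Phi> ((?P n \<omega>, ?g), z, y) \<partial>D \<partial>expd) =
            (\<integral>z. ?P n \<omega> * of_real (f (?g + z) * G (?g + z)) \<partial>expd)"
        proof (rule integral_cong_AE)
          show "AE z in expd. (\<integral>y. ?\<Phi> ((?P n \<omega>, ?g), z, y) \<partial>D) = ?P n \<omega> * of_real (f (?g + z) * G (?g + z))"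
            using AE_expd_pos
          proof eventually_elim
            case (elim z)
            then have "0 < ?g + z" using \<open>\<forall>k. 0 \<le> pre k \<omega>\<close> by (simp add: add_nonneg_pos)
            from f[OF this] show ?case by simp
          qed
        qed (simp_all only: fst_conv snd_conv, measurable)
        also have "\<dots> = ?P n \<omega> * of_real (\<integral>z. f (?g + z) * G (?g + z) \<partial>expd)"
          by (simp only: integral_mult_right_zero integral_complex_of_real)
        finally show ?case using renewal[of ?g] elim by simp
      qed
    qed measurable
    finally show ?case using Suc by simp
  qed
  \<comment> \<open>It remains to drop the weight. Since \<open>pre n\<close> tends to infinity and
    \<open>G\<close> tends to 1 there, the weight tends to 1 boundedly, and the products have norm
    at most 1.\<close>
  have "(\<lambda>n. \<integral>\<omega>. \<bar>1 - G (pre n \<omega>)\<bar> \<partial>M) \<longlonglongrightarrow> (\<integral>\<omega>. 0 \<partial>M)"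
  proof (rule integral_dominated_convergence)
    show "integrable M (\<lambda>_. 1 + B)" by simp
    show "AE \<omega> in M. (\<lambda>n. \<bar>1 - G (pre n \<omega>)\<bar>) \<longlonglongrightarrow> 0"
      using AE_arrival_at_top
    proof eventually_elim
      case (elim \<omega>)
      then have "filterlim (\<lambda>n. pre n \<omega>) at_top sequentially"
        by (subst filterlim_sequentially_Suc[symmetric]) (simp add: pre_Suc)
      from filterlim_compose[OF G_top this] show ?case
        by (auto intro!: tendsto_eq_intros)
    qed
    show "AE \<omega> in M. norm \<bar>1 - G (pre n \<omega>)\<bar> \<le> 1 + B" for n
      using GB by (auto intro!: AE_I2 order_trans[OF abs_triangle_ineq4])
  qed auto
  then have lim0: "(\<lambda>n. \<integral>\<omega>. \<bar>1 - G (pre n \<omega>)\<bar> \<partial>M) \<longlonglongrightarrow> 0" by simp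
  have "(\<lambda>n. (\<integral>\<omega>. ?P n \<omega> \<partial>M) - of_real (G 0)) \<longlonglongrightarrow> 0"
  proof (rule Lim_null_comparison[OF _ lim0], rule always_eventually, rule allI)
    fix n
    have i1: "integrable M (?P n)"
      by (rule integrable_const_bound[where B=1]) (auto intro: P1)
    have i2: "integrable M (\<lambda>\<omega>. ?P n \<omega> * of_real (G (pre n \<omega>)))"
    proof (rule integrable_const_bound[where B="1 * B"])
      show "AE \<omega> in M. norm (?P n \<omega> * of_real (G (pre n \<omega>))) \<le> 1 * B"
        unfolding norm_mult by (intro AE_I2 mult_mono P1) (auto simp: GB)
    qed measurable
    have "(\<integral>\<omega>. ?P n \<omega> \<partial>M) - of_real (G 0) = (\<integral>\<omega>. ?P n \<omega> * of_real (1 - G (pre n \<omega>)) \<partial>M)"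
      unfolding mart[of n, symmetric] using i1 i2
      by (subst Bochner_Integration.integral_diff[symmetric]) (auto simp: algebra_simps)
    also have "norm \<dots> \<le> (\<integral>\<omega>. norm (?P n \<omega> * of_real (1 - G (pre n \<omega>))) \<partial>M)"
      by (rule integral_norm_bound)
    also have "\<dots> \<le> (\<integral>\<omega>. \<bar>1 - G (pre n \<omega>)\<bar> \<partial>M)"
    proof (rule integral_mono)
      have b: "\<bar>1 - G x\<bar> \<le> 1 + B" for x using GB[of x] by linarith
      show le: "norm (?P n \<omega> * of_real (1 - G (pre n \<omega>))) \<le> \<bar>1 - G (pre n \<omega>)\<bar>" for \<omega>
        unfolding norm_mult norm_of_real by (intro mult_left_le_one_le) (auto simp: P1)
      show "integrable M (\<lambda>\<omega>. \<bar>1 - G (pre n \<omega>)\<bar>)"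
        by (rule integrable_const_bound[where B="1 + B"]) (auto simp: b)
      show "integrable M (\<lambda>\<omega>. norm (?P n \<omega> * of_real (1 - G (pre n \<omega>))))"
        by (rule integrable_const_bound[where B="1 + B"]) (use order_trans[OF le b] in auto)
    qed
    finally show "norm ((\<integral>\<omega>. ?P n \<omega> \<partial>M) - of_real (G 0)) \<le> (\<integral>\<omega>. \<bar>1 - G (pre n \<omega>)\<bar> \<partial>M)" .
  qed
  then show ?thesis
    by (simp add: LIM_zero_iff G0)
qed

end

subsection \<open>Homogeneous kernels\<close>

text \<open>Substituting \<open>y * x\<close> for \<open>x\<close> makes the dependence on
  \<open>y\<close> linear. This scaling is where the first absolute moment of the marks comes
  from.\<close>

lemma nn_integral_scale_inverse:
  fixes \<kappa> :: "real \<Rightarrow> real"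
  assumes [measurable]: "\<kappa> \<in> borel_measurable borel" and "\<kappa> 0 = 0" and "0 \<le> y"
  shows "(\<integral>\<^sup>+x. ennreal (\<kappa> (y / x)) * indicator {0<..} x \<partial>lborel) =
    ennreal y * (\<integral>\<^sup>+x. ennreal (\<kappa> (1 / x)) * indicator {0<..} x \<partial>lborel)"
proof (cases "y = 0")
  case True
  then show ?thesis using assms by simp
next
  case False
  then have "0 < y" using assms by simp
  then show ?thesis
    by (subst nn_integral_real_affine[where c=y and t=0])
       (auto intro!: arg_cong[where f="\<lambda>x. _ * x"] nn_integral_cong simp: indicator_def zero_less_mult_iff)
qed

text \<open>The constant in front of the first absolute moment in the exponent. For
  \<open>iexp\<close> its value is \<open>pi / 2\<close>, of which only finiteness and positivity
  matter; for the indicator of \<open>{..1}\<close> it is 1.\<close>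

definition kernel_mass :: "(real \<Rightarrow> complex) \<Rightarrow> ennreal" where
  "kernel_mass k = (\<integral>\<^sup>+x. ennreal (1 - Re (k (1 / x))) * indicator {0<..} x \<partial>lborel)"

context marked_arrivals
begin

text \<open>For \<open>h x y = k (y / x)\<close>, Tonelli and the scaling substitution turn the
  integral of \<open>1 - f\<close> into \<open>kernel_mass k\<close> times the first absolute
  moment. \<open>Im\<close> makes the averaged kernel real, as the product formula requires.
  \<open>even\<close> replaces \<open>y\<close> by its absolute value before scaling; it is an
  almost sure condition so that it covers even kernels as well as arbitrary kernels with nonnegative
  marks.\<close>

lemma expectation_prod_kernel:
  fixes k :: "real \<Rightarrow> complex"
  assumes cont: "continuous_on UNIV k" and k1: "\<And>r. norm (k r) \<le> 1" and k0: "k 0 = 1"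
    and mass: "kernel_mass k < \<infinity>" and int: "integrable D (\<lambda>y. y)"
    and Im: "\<And>x. 0 < x \<Longrightarrow> Im (\<integral>y. k (y / x) \<partial>D) = 0"
    and even: "AE y in D. \<forall>x. Re (k (y / x)) = Re (k (\<bar>y\<bar> / x))"
  shows "(\<lambda>n. \<integral>\<omega>. (\<Prod>i<n. k (\<eta> i \<omega> / arrival \<zeta> i \<omega>)) \<partial>M) \<longlonglongrightarrow>
    of_real (exp (- (enn2real (kernel_mass k) * (\<integral>y. \<bar>y\<bar> \<partial>D))))"
proof -
  interpret D: prob_space D by (rule prob_space_D)
  interpret pair_sigma_finite D "lborel :: real measure" ..
  have [measurable]: "k \<in> borel_measurable borel"
    using cont by (rule borel_measurable_continuous_onI)
  have Re1: "Re (k r) \<le> 1" "- 1 \<le> Re (k r)" for r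
    using abs_Re_le_cmod[of "k r"] k1[of r] by linarith+
  define f where "f x = (if 0 < x then Re (\<integral>y. k (y / x) \<partial>D) else 1)" for x
  have kint: "integrable D (\<lambda>y. k (y / x))" for x
    by (rule D.integrable_const_bound[where B=1]) (auto simp: k1)
  have [measurable]: "f \<in> borel_measurable borel"
    unfolding f_def by measurable
  have f_cont: "continuous_on {0<..} f"
    unfolding continuous_on_sequentially comp_def
  proof (intro ballI allI impI, elim conjE)
    fix x :: real and X assume x: "x \<in> {0<..}" and X: "\<forall>n. X n \<in> {0<..}" "X \<longlonglongrightarrow> x"
    have "(\<lambda>n. \<integral>y. k (y / X n) \<partial>D) \<longlonglongrightarrow> (\<integral>y. k (y / x) \<partial>D)"
    proof (rule integral_dominated_convergence[where w="\<lambda>_. 1"])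
      show "AE y in D. (\<lambda>n. k (y / X n)) \<longlonglongrightarrow> k (y / x)"
        using x X by (intro AE_I2 continuous_on_tendsto_compose[OF cont] tendsto_intros) auto
    qed (auto simp: k1)
    from tendsto_Re[OF this] show "(\<lambda>n. f (X n)) \<longlonglongrightarrow> f x"
      using x X by (simp add: f_def)
  qed
  have f_eq: "ennreal (1 - f x) = (\<integral>\<^sup>+y. ennreal (1 - Re (k (\<bar>y\<bar> / x))) * indicator {0<..} x \<partial>D)" for x
  proof (cases "0 < x")
    case True
    have i: "integrable D (\<lambda>y. 1 - Re (k (y / x)))"
      using kint[of x] by (intro Bochner_Integration.integrable_diff integrable_Re) auto
    have "1 - f x = (\<integral>y. 1 - Re (k (y / x)) \<partial>D)"
      using True kint[of x] D.prob_space by (simp add: f_def integral_Re)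
    also have "ennreal \<dots> = (\<integral>\<^sup>+y. ennreal (1 - Re (k (y / x))) \<partial>D)"
      by (rule nn_integral_eq_integral[OF i, symmetric]) (simp add: Re1)
    also have "\<dots> = (\<integral>\<^sup>+y. ennreal (1 - Re (k (\<bar>y\<bar> / x))) * indicator {0<..} x \<partial>D)"
      using even True by (intro nn_integral_cong_AE) (auto elim!: eventually_mono)
    finally show ?thesis .
  qed (simp add: f_def)
  have f_le: "f x \<le> 1" for x
  proof (cases "0 < x")
    case True
    have "Re (\<integral>y. k (y / x) \<partial>D) = (\<integral>y. Re (k (y / x)) \<partial>D)" using kint[of x] by simp
    also have "\<dots> \<le> (\<integral>y. 1 \<partial>D)" using kint[of x] by (intro integral_mono integrable_Re) (auto simp: Re1)
    finally show ?thesis using True D.prob_space by (simp add: f_def)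
  qed (simp add: f_def)
  have "(\<integral>\<^sup>+x. ennreal (1 - f x) \<partial>lborel) =
      (\<integral>\<^sup>+y. \<integral>\<^sup>+x. ennreal (1 - Re (k (\<bar>y\<bar> / x))) * indicator {0<..} x \<partial>lborel \<partial>D)"
    unfolding f_eq by (rule Fubini') measurable
  also have "\<dots> = (\<integral>\<^sup>+y. ennreal \<bar>y\<bar> * kernel_mass k \<partial>D)"
    unfolding kernel_mass_def
    by (intro nn_integral_cong nn_integral_scale_inverse[where \<kappa>="\<lambda>r. 1 - Re (k r)"]) (auto simp: k0)
  also have "\<dots> = (\<integral>\<^sup>+y. ennreal \<bar>y\<bar> \<partial>D) * kernel_mass k"
    by (rule nn_integral_multc) simp
  also have "(\<integral>\<^sup>+y. ennreal \<bar>y\<bar> \<partial>D) = ennreal (\<integral>y. \<bar>y\<bar> \<partial>D)"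
    using int by (intro nn_integral_eq_integral) auto
  also have "kernel_mass k = ennreal (enn2real (kernel_mass k))"
    using mass by simp
  finally have nn: "(\<integral>\<^sup>+x. ennreal (1 - f x) \<partial>lborel) = ennreal (enn2real (kernel_mass k) * (\<integral>y. \<bar>y\<bar> \<partial>D))"
    by (simp add: ennreal_mult'' mult.commute)
  have "integrable lborel (\<lambda>x. 1 - f x)"
    using nn f_le by (intro integrableI_nonneg) (auto simp: less_top[symmetric])
  moreover have "(\<integral>x. 1 - f x \<partial>lborel) = enn2real (kernel_mass k) * (\<integral>y. \<bar>y\<bar> \<partial>D)"
    using nn f_le by (subst integral_eq_nn_integral) auto
  moreover have "(\<integral>y. k (y / x) \<partial>D) = of_real (f x)" if "0 < x" for x
    using Im[OF that] that by (simp add: f_def complex_eq_iff)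
  ultimately show ?thesis
    using expectation_prod_arrivals[where h="\<lambda>x y. k (y / x)" and f=f] f_cont k1 by (simp add: f_def)
qed

end

lemma kernel_mass_iexp_finite: "kernel_mass iexp < \<infinity>"
proof -
  have "ennreal (1 - Re (iexp (1 / x))) * indicator {0<..} x \<le>
      2 * indicator {0..1} x + ennreal (1 / x\<^sup>2) * indicator {1..} x" for x :: real
  proof (cases "x \<le> 1")
    case True
    have "1 - Re (iexp (1 / x)) \<le> 2" by (simp add: Re_exp)
    then have "ennreal (1 - Re (iexp (1 / x))) \<le> 2"
      by (metis ennreal_leI ennreal_numeral zero_le_numeral)
    then show ?thesis using True by (auto simp: indicator_def add_increasing2)
  next
    case False
    have "1 - cos (1 / x) = 2 * (sin (1 / x / 2))\<^sup>2"
      using cos_double_sin[of "1 / x / 2"] by simp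
    also have "\<dots> \<le> 2 * (1 / x / 2)\<^sup>2"
      using abs_sin_x_le_abs_x[of "1 / x / 2"] by (simp only: abs_le_square_iff)
    also have "\<dots> \<le> 1 / x\<^sup>2" using False by (simp add: power_divide divide_simps)
    finally show ?thesis using False by (simp add: Re_exp ennreal_leI)
  qed
  then have "kernel_mass iexp \<le> (\<integral>\<^sup>+x. 2 * indicator {0..1} x + ennreal (1 / x\<^sup>2) * indicator {1..} (x :: real) \<partial>lborel)"
    unfolding kernel_mass_def by (rule nn_integral_mono)
  also have "\<dots> = 2 + (\<integral>\<^sup>+x. ennreal (1 / x\<^sup>2) * indicator {1..} x \<partial>lborel)"
    by (subst nn_integral_add) (auto simp: nn_integral_cmult)
  also have "(\<integral>\<^sup>+x. ennreal (1 / x\<^sup>2) * indicator {1..} x \<partial>lborel) = ennreal (0 - (- (1 / 1)))"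
  proof (rule nn_integral_FTC_atLeast[where F="\<lambda>x. - (1 / x)"])
    show "((\<lambda>x. - (1 / x)) has_real_derivative 1 / x\<^sup>2) (at x)" if "1 \<le> x" for x :: real
      using that by (auto intro!: derivative_eq_intros simp: power2_eq_square)
    show "((\<lambda>x::real. - (1 / x)) \<longlongrightarrow> 0) at_top"
      using tendsto_minus[OF tendsto_divide_0[OF tendsto_const[of "1 :: real"]
        filterlim_at_top_imp_at_infinity[OF filterlim_ident]]] by simp
  qed auto
  finally show ?thesis by (simp add: le_less_trans)
qed

text \<open>Positivity allows the first absolute moment to be recovered from the value of the
  characteristic function. On \<open>{1..2}\<close> the integrand is at least
  \<open>1 - cos (1 / 2)\<close>.\<close>

lemma kernel_mass_iexp_pos: "0 < enn2real (kernel_mass iexp)"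
proof -
  have "cos (1 / 2) < cos (0::real)"
    by (rule cos_monotone_0_pi) (use pi_gt3 in auto)
  then have c: "0 < 1 - cos (1 / 2 :: real)" by simp
  have "ennreal (1 - cos (1 / 2)) = (\<integral>\<^sup>+x. ennreal (1 - cos (1 / 2)) * indicator {1..2} (x :: real) \<partial>lborel)"
    by (subst nn_integral_cmult_indicator) auto
  also have "\<dots> \<le> kernel_mass iexp"
    unfolding kernel_mass_def
  proof (rule nn_integral_mono)
    fix x :: real
    show "ennreal (1 - cos (1 / 2)) * indicator {1..2} x \<le> ennreal (1 - Re (iexp (1 / x))) * indicator {0<..} x"
    proof (cases "x \<in> {1..2}")
      case True
      then have "cos (1 / x) \<le> cos (1 / 2)"
        using pi_gt3 order_trans[of "1 / x" 1 pi] by (intro cos_monotone_0_pi_le) (auto simp: field_simps)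
      then show ?thesis using True by (auto simp: Re_exp intro!: ennreal_leI)
    qed simp
  qed
  finally have "0 < kernel_mass iexp"
    using c by (simp add: less_le_trans[of _ "ennreal (1 - cos (1 / 2))"])
  then show ?thesis
    using kernel_mass_iexp_finite by (simp add: enn2real_positive_iff)
qed

text \<open>
  Continuous approximations of the indicator of \<open>{..1}\<close>, needed because the renewal equation
  has been solved for continuous \<open>f\<close> only.
\<close>

definition ramp :: "real \<Rightarrow> real \<Rightarrow> real \<Rightarrow> complex" where
  "ramp a b r = of_real (max 0 (min 1 ((b - r) / (b - a))))"

text \<open>The ramp is 1 up to \<open>a\<close> and 0 from \<open>b\<close> on. At the argument
  \<open>1 / x\<close> the integrand is therefore 1 for \<open>x\<close> up to \<open>1 / b\<close>
  and 0 beyond \<open>1 / a\<close>.\<close>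

lemma kernel_mass_ramp:
  assumes "0 < a" "a < b"
  shows "kernel_mass (ramp a b) < \<infinity>"
    and "1 / b \<le> enn2real (kernel_mass (ramp a b))" and "enn2real (kernel_mass (ramp a b)) \<le> 1 / a"
proof -
  have "ennreal (1 / b) = (\<integral>\<^sup>+x. indicator {0<..1/b} (x :: real) \<partial>lborel)"
    using assms by simp
  also have "\<dots> \<le> kernel_mass (ramp a b)"
    unfolding kernel_mass_def
  proof (rule nn_integral_mono)
    fix x :: real
    have "(b - 1 / x) / (b - a) \<le> 0" if "0 < x" "x \<le> 1 / b"
      using that assms by (intro divide_nonpos_pos) (auto simp: field_simps)
    then show "indicator {0<..1/b} x \<le> ennreal (1 - Re (ramp a b (1 / x))) * indicator {0<..} x"
      by (auto simp: indicator_def ramp_def min_def max_def)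
  qed
  finally have lower: "ennreal (1 / b) \<le> kernel_mass (ramp a b)" .
  have "kernel_mass (ramp a b) \<le> (\<integral>\<^sup>+x. indicator {0<..1/a} (x :: real) \<partial>lborel)"
    unfolding kernel_mass_def
  proof (rule nn_integral_mono)
    fix x :: real
    have "1 \<le> (b - 1 / x) / (b - a)" if "0 < x" "\<not> x \<le> 1 / a"
      using that assms by (auto simp: field_simps)
    then have "ramp a b (1 / x) = 1" if "0 < x" "\<not> x \<le> 1 / a"
      using that by (auto simp: ramp_def)
    moreover have "ennreal (1 - Re (ramp a b (1 / x))) \<le> 1"
      by (simp add: ramp_def)
    ultimately show "ennreal (1 - Re (ramp a b (1 / x))) * indicator {0<..} x \<le> indicator {0<..1/a} x"
      by (auto simp: indicator_def)
  qed
  also have "\<dots> = ennreal (1 / a)" using assms by simp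
  finally have upper: "kernel_mass (ramp a b) \<le> ennreal (1 / a)" .
  then show fin: "kernel_mass (ramp a b) < \<infinity>"
    by (rule le_less_trans) simp
  have eq: "kernel_mass (ramp a b) = ennreal (enn2real (kernel_mass (ramp a b)))"
    using fin by simp
  show "1 / b \<le> enn2real (kernel_mass (ramp a b))"
    using lower assms by (subst (asm) eq) (simp add: ennreal_le_iff)
  show "enn2real (kernel_mass (ramp a b)) \<le> 1 / a"
    using upper assms by (subst (asm) eq) (simp add: ennreal_le_iff)
qed

section \<open>Characteristic function of the series and distribution function of the
  maximum\<close>

context marked_arrivals
begin

text \<open>The finite products of \<open>iexp\<close> are the characters of the partial sums. Their
  expectations converge in two ways: by the product formula, and by dominated convergence along the
  almost surely convergent series.\<close>

lemma char_lepage_series: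
  assumes int: "integrable D (\<lambda>y. y)" and sym: "distr D borel uminus = D"
  shows "(\<integral>\<omega>. iexp (\<Sum>k. inverse (arrival \<zeta> k \<omega>) * \<eta> k \<omega>) \<partial>M) =
    of_real (exp (- (enn2real (kernel_mass iexp) * (\<integral>y. \<bar>y\<bar> \<partial>D))))"
proof (rule LIMSEQ_unique)
  interpret D: prob_space D by (rule prob_space_D)
  show "(\<lambda>n. \<integral>\<omega>. (\<Prod>i<n. iexp (\<eta> i \<omega> / arrival \<zeta> i \<omega>)) \<partial>M) \<longlonglongrightarrow>
      of_real (exp (- (enn2real (kernel_mass iexp) * (\<integral>y. \<bar>y\<bar> \<partial>D))))"
  proof (rule expectation_prod_kernel[OF _ _ _ kernel_mass_iexp_finite int])
    show "continuous_on UNIV iexp" by (intro continuous_intros)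
    \<comment> \<open>The sine is odd, so its integral against a symmetric law vanishes.\<close>
    show "Im (\<integral>y. iexp (y / x) \<partial>D) = 0" for x
    proof -
      have "integrable D (\<lambda>y. iexp (y / x))"
        by (rule D.integrable_const_bound[where B=1]) auto
      then have "Im (\<integral>y. iexp (y / x) \<partial>D) = (\<integral>y. sin (y / x) \<partial>D)"
        by (simp add: Im_exp flip: integral_Im)
      moreover have "(\<integral>y. sin (y / x) \<partial>D) = (\<integral>y. sin (y / x) \<partial>distr D borel uminus)" by (simp add: sym)
      moreover have "\<dots> = - (\<integral>y. sin (y / x) \<partial>D)" by (simp add: integral_distr)
      ultimately show ?thesis by linarith
    qed
    show "AE y in D. \<forall>x. Re (iexp (y / x)) = Re (iexp (\<bar>y\<bar> / x))"
      by (rule AE_I2) (simp add: Re_exp abs_if)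
  qed auto
  show "(\<lambda>n. \<integral>\<omega>. (\<Prod>i<n. iexp (\<eta> i \<omega> / arrival \<zeta> i \<omega>)) \<partial>M) \<longlonglongrightarrow>
      (\<integral>\<omega>. iexp (\<Sum>k. inverse (arrival \<zeta> k \<omega>) * \<eta> k \<omega>) \<partial>M)"
  proof (rule integral_dominated_convergence[where w="\<lambda>_. 1"])
    show "AE \<omega> in M. (\<lambda>n. \<Prod>i<n. iexp (\<eta> i \<omega> / arrival \<zeta> i \<omega>)) \<longlonglongrightarrow>
        iexp (\<Sum>k. inverse (arrival \<zeta> k \<omega>) * \<eta> k \<omega>)"
      using AE_summable_marks[OF int sym]
    proof eventually_elim
      case (elim \<omega>)
      have "(\<Prod>i<n. iexp (\<eta> i \<omega> / arrival \<zeta> i \<omega>)) = iexp (\<Sum>i<n. inverse (arrival \<zeta> i \<omega>) * \<eta> i \<omega>)" for n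
        by (simp add: exp_sum[symmetric] sum_distrib_left of_real_sum divide_inverse_commute)
      moreover have "(\<lambda>n. iexp (\<Sum>i<n. inverse (arrival \<zeta> i \<omega>) * \<eta> i \<omega>)) \<longlonglongrightarrow>
          iexp (\<Sum>k. inverse (arrival \<zeta> k \<omega>) * \<eta> k \<omega>)"
        using summable_LIMSEQ[OF elim] by (rule isCont_tendsto_compose[OF isCont_iexp])
      ultimately show ?case by simp
    qed
    show "AE \<omega> in M. norm (\<Prod>i<n. iexp (\<eta> i \<omega> / arrival \<zeta> i \<omega>)) \<le> 1" for n
      by (simp add: prod_norm[symmetric])
  qed auto
qed

lemma expectation_prod_ramp:
  assumes "0 < a" "a < b" and int: "integrable D (\<lambda>y. y)" and nonneg: "AE y in D. 0 \<le> y"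
  shows "(\<lambda>n. \<integral>\<omega>. (\<Prod>i<n. Re (ramp a b (\<eta> i \<omega> / arrival \<zeta> i \<omega>))) \<partial>M) \<longlonglongrightarrow>
    exp (- (enn2real (kernel_mass (ramp a b)) * (\<integral>y. y \<partial>D)))"
proof -
  have "(\<lambda>n. \<integral>\<omega>. (\<Prod>i<n. ramp a b (\<eta> i \<omega> / arrival \<zeta> i \<omega>)) \<partial>M) \<longlonglongrightarrow>
      of_real (exp (- (enn2real (kernel_mass (ramp a b)) * (\<integral>y. \<bar>y\<bar> \<partial>D))))"
  proof (rule expectation_prod_kernel[OF _ _ _ _ int])
    show "continuous_on UNIV (ramp a b)"
      unfolding ramp_def using assms by (intro continuous_intros) auto
    show "kernel_mass (ramp a b) < \<infinity>"
      by (rule kernel_mass_ramp(1)[OF assms(1,2)])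
    show "ramp a b 0 = 1" using assms by (simp add: ramp_def)
    show "Im (\<integral>y. ramp a b (y / x) \<partial>D) = 0" for x
      unfolding ramp_def by (simp only: integral_complex_of_real Im_complex_of_real)
    show "AE y in D. \<forall>x. Re (ramp a b (y / x)) = Re (ramp a b (\<bar>y\<bar> / x))"
      using nonneg by eventually_elim simp
  qed (simp add: ramp_def)
  moreover have "(\<integral>\<omega>. (\<Prod>i<n. ramp a b (\<eta> i \<omega> / arrival \<zeta> i \<omega>)) \<partial>M) =
      of_real (\<integral>\<omega>. (\<Prod>i<n. Re (ramp a b (\<eta> i \<omega> / arrival \<zeta> i \<omega>))) \<partial>M)" for n
    unfolding integral_complex_of_real[symmetric] by (simp add: ramp_def)
  moreover have "(\<integral>y. \<bar>y\<bar> \<partial>D) = (\<integral>y. y \<partial>D)"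
    using nonneg by (intro integral_cong_AE) (auto elim!: eventually_mono)
  ultimately show ?thesis by (simp add: tendsto_of_real_iff)
qed

text \<open>The indicator of \<open>r \<le> 1\<close> lies between \<open>ramp a 1\<close> and
  \<open>ramp 1 b\<close> for \<open>a < 1 < b\<close>. The resulting exponents are squeezed between
  the mean divided by \<open>b\<close> and by \<open>a\<close>, and both parameters tend to
  1.\<close>

lemma prob_marks_le:
  assumes int: "integrable D (\<lambda>y. y)" and nonneg: "AE y in D. 0 \<le> y"
  shows "prob {\<omega> \<in> space M. \<forall>k. \<eta> k \<omega> \<le> arrival \<zeta> k \<omega>} = exp (- (\<integral>y. y \<partial>D))"
proof -
  let ?E = "\<integral>y. y \<partial>D"
  let ?A = "\<lambda>n. {\<omega> \<in> space M. \<forall>k<n. \<eta> k \<omega> \<le> arrival \<zeta> k \<omega>}"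
  have E0: "0 \<le> ?E" using nonneg by (rule integral_nonneg_AE)
  have Inter: "(\<Inter>n. ?A n) = {\<omega> \<in> space M. \<forall>k. \<eta> k \<omega> \<le> arrival \<zeta> k \<omega>}" by auto
  have lim: "(\<lambda>n. prob (?A n)) \<longlonglongrightarrow> prob {\<omega> \<in> space M. \<forall>k. \<eta> k \<omega> \<le> arrival \<zeta> k \<omega>}"
    unfolding Inter[symmetric] by (intro finite_Lim_measure_decseq) (auto simp: decseq_def)
  have prod_int: "integrable M (\<lambda>\<omega>. \<Prod>i<n. Re (ramp a b (\<eta> i \<omega> / arrival \<zeta> i \<omega>)))" for a b n
    by (rule integrable_const_bound[where B=1]) (auto simp: ramp_def abs_prod intro!: prod_le_1 AE_I2)
  have ind_int: "integrable M (indicator (?A n) :: _ \<Rightarrow> real)" for n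
    by (rule integrable_real_indicator) (auto simp: emeasure_eq_measure)
  have ind: "(\<integral>\<omega>. indicator (?A n) \<omega> \<partial>M) = prob (?A n)" for n
    by (simp add: Int_absorb2)
  have upper: "prob {\<omega> \<in> space M. \<forall>k. \<eta> k \<omega> \<le> arrival \<zeta> k \<omega>} \<le> exp (- (?E / b))" if "1 < b" for b
  proof -
    have "prob (?A n) \<le> (\<integral>\<omega>. (\<Prod>i<n. Re (ramp 1 b (\<eta> i \<omega> / arrival \<zeta> i \<omega>))) \<partial>M)" for n
      unfolding ind[symmetric]
    proof (rule integral_mono_AE[OF ind_int prod_int])
      show "AE \<omega> in M. indicator (?A n) \<omega> \<le> (\<Prod>i<n. Re (ramp 1 b (\<eta> i \<omega> / arrival \<zeta> i \<omega>)))"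
        using AE_arrival_pos
      proof eventually_elim
        case (elim \<omega>)
        have "Re (ramp 1 b (\<eta> i \<omega> / arrival \<zeta> i \<omega>)) = 1" if "\<eta> i \<omega> \<le> arrival \<zeta> i \<omega>" for i
        proof -
          have "\<eta> i \<omega> / arrival \<zeta> i \<omega> \<le> 1" using that elim by simp
          then have "1 \<le> (b - \<eta> i \<omega> / arrival \<zeta> i \<omega>) / (b - 1)" using \<open>1 < b\<close> by simp
          then show ?thesis by (simp add: ramp_def)
        qed
        then show ?case by (auto simp: indicator_def ramp_def intro!: prod_nonneg)
      qed
    qed
    from LIMSEQ_le[OF lim expectation_prod_ramp[OF _ that int nonneg]] this
    have "prob {\<omega> \<in> space M. \<forall>k. \<eta> k \<omega> \<le> arrival \<zeta> k \<omega>} \<le> exp (- (enn2real (kernel_mass (ramp 1 b)) * ?E))"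
      by auto
    also have "\<dots> \<le> exp (- (?E / b))"
    proof -
      have "1 / b \<le> enn2real (kernel_mass (ramp 1 b))"
        using kernel_mass_ramp(2)[of 1 b] that by simp
      from mult_right_mono[OF this E0] show ?thesis by simp
    qed
    finally show ?thesis .
  qed
  have lower: "exp (- (?E / a)) \<le> prob {\<omega> \<in> space M. \<forall>k. \<eta> k \<omega> \<le> arrival \<zeta> k \<omega>}" if "0 < a" "a < 1" for a
  proof -
    have "(\<integral>\<omega>. (\<Prod>i<n. Re (ramp a 1 (\<eta> i \<omega> / arrival \<zeta> i \<omega>))) \<partial>M) \<le> prob (?A n)" for n
      unfolding ind[symmetric]
    proof (rule integral_mono_AE[OF prod_int ind_int])
      show "AE \<omega> in M. (\<Prod>i<n. Re (ramp a 1 (\<eta> i \<omega> / arrival \<zeta> i \<omega>))) \<le> indicator (?A n) \<omega>"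
        using AE_arrival_pos AE_space
      proof eventually_elim
        case (elim \<omega>)
        show ?case
        proof (cases "\<omega> \<in> ?A n")
          case True
          then show ?thesis by (auto simp: ramp_def intro!: prod_le_1)
        next
          case False
          then obtain i where i: "i < n" "arrival \<zeta> i \<omega> < \<eta> i \<omega>" using elim by (auto simp: not_le)
          then have "1 \<le> \<eta> i \<omega> / arrival \<zeta> i \<omega>" using elim by simp
          then have "(1 - \<eta> i \<omega> / arrival \<zeta> i \<omega>) / (1 - a) \<le> 0"
            using \<open>a < 1\<close> by (intro divide_nonpos_pos) auto
          then have "Re (ramp a 1 (\<eta> i \<omega> / arrival \<zeta> i \<omega>)) = 0" by (simp add: ramp_def)
          then have 0: "(\<Prod>i<n. Re (ramp a 1 (\<eta> i \<omega> / arrival \<zeta> i \<omega>))) = 0"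
            using i by (intro prod_zero) auto
          show ?thesis unfolding 0 by simp
        qed
      qed
    qed
    from LIMSEQ_le[OF expectation_prod_ramp[OF that int nonneg] lim] this
    have "exp (- (enn2real (kernel_mass (ramp a 1)) * ?E)) \<le> prob {\<omega> \<in> space M. \<forall>k. \<eta> k \<omega> \<le> arrival \<zeta> k \<omega>}"
      by auto
    moreover have "exp (- (?E / a)) \<le> exp (- (enn2real (kernel_mass (ramp a 1)) * ?E))"
    proof -
      have "enn2real (kernel_mass (ramp a 1)) \<le> 1 / a"
        by (rule kernel_mass_ramp(3)[OF that])
      from mult_right_mono[OF this E0] show ?thesis by simp
    qed
    ultimately show ?thesis by (rule order_trans[rotated])
  qed
  show ?thesis
  proof (rule antisym)
    have "((\<lambda>b. exp (- (?E / b))) \<longlongrightarrow> exp (- (?E / 1))) (at_right 1)"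
      by (intro tendsto_intros) auto
    then show "prob {\<omega> \<in> space M. \<forall>k. \<eta> k \<omega> \<le> arrival \<zeta> k \<omega>} \<le> exp (- ?E)"
      by (intro tendsto_lowerbound[where F="at_right (1::real)"])
         (auto intro!: always_eventually upper simp: eventually_at_filter)
    have "((\<lambda>a. exp (- (?E / a))) \<longlongrightarrow> exp (- (?E / 1))) (at_left 1)"
      by (intro tendsto_intros) auto
    then show "exp (- ?E) \<le> prob {\<omega> \<in> space M. \<forall>k. \<eta> k \<omega> \<le> arrival \<zeta> k \<omega>}"
      using eventually_at_left_real[of 0 "1::real"]
      by (intro tendsto_upperbound[where F="at_left (1::real)"])
         (auto elim!: eventually_mono intro: lower)
  qed
qed

end

subsection \<open>Uniqueness of multivariate laws\<close>

text \<open>A finite, unnormalised law: it hides the other coordinates of a vector in the weight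
  \<open>w\<close>, so that uniqueness theorems on the line can treat one coordinate at a
  time.\<close>

definition weighted_law :: "'a measure \<Rightarrow> ('a \<Rightarrow> real) \<Rightarrow> ('a \<Rightarrow> real) \<Rightarrow> real measure" where
  "weighted_law P w X = distr (density P (\<lambda>\<omega>. ennreal (w \<omega>))) borel X"

context
  fixes P :: "'a measure" and w X :: "'a \<Rightarrow> real"
  assumes w [measurable]: "w \<in> borel_measurable P" and X [measurable]: "X \<in> borel_measurable P"
    and w0: "\<And>\<omega>. 0 \<le> w \<omega>" and int: "integrable P w"
begin

lemma sets_weighted_law [simp, measurable_cong]: "sets (weighted_law P w X) = sets borel"
  by (simp add: weighted_law_def)

lemma integral_weighted_law:
  fixes g :: "real \<Rightarrow> 'b :: {banach, second_countable_topology}"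
  assumes [measurable]: "g \<in> borel_measurable borel"
  shows "(\<integral>x. g x \<partial>weighted_law P w X) = (\<integral>\<omega>. w \<omega> *\<^sub>R g (X \<omega>) \<partial>P)"
  unfolding weighted_law_def by (simp add: integral_distr integral_density w0)

lemma emeasure_weighted_law:
  assumes [measurable]: "B \<in> sets borel"
  shows "emeasure (weighted_law P w X) B = ennreal (\<integral>\<omega>. w \<omega> * indicator B (X \<omega>) \<partial>P)"
proof -
  have "emeasure (weighted_law P w X) B = (\<integral>\<^sup>+\<omega>. ennreal (w \<omega>) * indicator B (X \<omega>) \<partial>P)"
    unfolding weighted_law_def
    by (subst nn_integral_indicator[symmetric], simp, subst nn_integral_distr, simp, simp,
        subst nn_integral_density) simp_all
  also have "\<dots> = (\<integral>\<^sup>+\<omega>. ennreal (w \<omega> * indicator B (X \<omega>)) \<partial>P)"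
    by (intro nn_integral_cong) (simp add: indicator_def)
  also have "\<dots> = ennreal (\<integral>\<omega>. w \<omega> * indicator B (X \<omega>) \<partial>P)"
    using w0 by (intro nn_integral_eq_integral Bochner_Integration.integrable_bound[OF int])
      (auto simp: indicator_def)
  finally show ?thesis .
qed

lemma finite_borel_weighted_law: "finite_borel_measure (weighted_law P w X)"
proof -
  have "emeasure (weighted_law P w X) UNIV = ennreal (\<integral>\<omega>. w \<omega> \<partial>P)"
    using emeasure_weighted_law[of UNIV] by simp
  then show ?thesis
    by (intro finite_borel_measure.intro finite_measureI finite_borel_measure_axioms.intro)
       (auto simp: sets_eq_imp_space_eq[OF sets_weighted_law])
qed

lemma measure_weighted_law:
  assumes "B \<in> sets borel"
  shows "measure (weighted_law P w X) B = (\<integral>\<omega>. w \<omega> * indicator B (X \<omega>) \<partial>P)"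
  using emeasure_weighted_law[OF assms] by (simp add: measure_def w0)

end


text \<open>Levy's theorem after normalisation: the common total mass is the value at
  \<open>t = 0\<close>. Mass 0 has to be treated apart, since weights may vanish almost
  everywhere.\<close>

lemma finite_measure_char_unique:
  fixes \<mu> \<nu> :: "real measure"
  assumes \<mu>: "finite_borel_measure \<mu>" and \<nu>: "finite_borel_measure \<nu>"
    and eq: "\<And>t. (\<integral>x. iexp (t * x) \<partial>\<mu>) = (\<integral>x. iexp (t * x) \<partial>\<nu>)"
  shows "\<mu> = \<nu>"
proof -
  interpret \<mu>: finite_borel_measure \<mu> by (rule \<mu>)
  interpret \<nu>: finite_borel_measure \<nu> by (rule \<nu>)
  have [measurable_cong]: "sets \<mu> = sets borel" "sets \<nu> = sets borel"
    by (rule \<mu>.M_is_borel, rule \<nu>.M_is_borel)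
  have sp: "space \<mu> = UNIV" "space \<nu> = UNIV" by (rule \<mu>.borel_UNIV, rule \<nu>.borel_UNIV)
  define m where "m = measure \<mu> UNIV"
  have m: "measure \<nu> UNIV = m"
    using eq[of 0] sp by (simp add: m_def)
  have em: "emeasure \<mu> UNIV = ennreal m" "emeasure \<nu> UNIV = ennreal m"
    using m by (simp_all add: m_def \<mu>.emeasure_eq_measure \<nu>.emeasure_eq_measure)
  have sets_eq: "sets \<mu> = sets \<nu>" by (simp add: \<mu>.M_is_borel \<nu>.M_is_borel)
  show ?thesis
  proof (cases "m = 0")
    case True
    have "emeasure \<mu> A \<le> emeasure \<mu> UNIV" "emeasure \<nu> A \<le> emeasure \<nu> UNIV" for A
      using emeasure_space[of \<mu> A] emeasure_space[of \<nu> A] sp by simp_all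
    then show ?thesis using True em by (intro measure_eqI sets_eq) simp
  next
    case False
    then have "0 < m" by (simp add: m_def zero_less_measure_iff)
    then have inv: "ennreal (1 / m) * ennreal m = 1"
      by (simp add: ennreal_mult[symmetric] ennreal_1[symmetric] del: ennreal_1)
    have D: "real_distribution (density \<kappa> (\<lambda>_. ennreal (1 / m)))"
      if [measurable_cong]: "sets \<kappa> = sets borel" and "emeasure \<kappa> UNIV = ennreal m" for \<kappa> :: "real measure"
      using that inv sets_eq_imp_space_eq[OF that(1)]
      by (intro real_distribution.intro prob_spaceI real_distribution_axioms.intro)
         (auto simp: emeasure_density nn_integral_cmult)
    have "char (density \<mu> (\<lambda>_. ennreal (1 / m))) = char (density \<nu> (\<lambda>_. ennreal (1 / m)))"
      unfolding char_def using \<open>0 < m\<close> eq by (auto simp: integral_density fun_eq_iff)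
    then have *: "density \<mu> (\<lambda>_. ennreal (1 / m)) = density \<nu> (\<lambda>_. ennreal (1 / m))"
      using em by (intro Levy_uniqueness D) (simp_all add: \<mu>.M_is_borel \<nu>.M_is_borel)
    show ?thesis
    proof (rule measure_eqI[OF sets_eq])
      fix A assume "A \<in> sets \<mu>"
      then have A: "A \<in> sets \<mu>" "A \<in> sets \<nu>" using sets_eq by auto
      have "ennreal (1 / m) * emeasure \<mu> A = ennreal (1 / m) * emeasure \<nu> A"
        using arg_cong[OF *, of "\<lambda>\<kappa>. emeasure \<kappa> A"] A
        by (simp add: emeasure_density nn_integral_cmult_indicator)
      then show "emeasure \<mu> A = emeasure \<nu> A"
        using \<open>0 < m\<close> by (simp add: ennreal_mult_cancel_left)
    qed
  qed
qed

lemma integral_prod_indicator: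
  fixes n :: nat
  shows "(\<integral>\<omega>. (\<Prod>i<n. indicator (A i) (Z i \<omega>)) \<partial>R) = measure R {\<omega> \<in> space R. \<forall>i<n. Z i \<omega> \<in> A i}"
proof -
  have "(\<integral>\<omega>. (\<Prod>i<n. indicator (A i) (Z i \<omega>)) \<partial>R) = (\<integral>\<omega>. indicator {\<omega> \<in> space R. \<forall>i<n. Z i \<omega> \<in> A i} \<omega> \<partial>R :: real)"
  proof (rule Bochner_Integration.integral_cong[OF refl])
    fix \<omega> assume "\<omega> \<in> space R"
    then show "(\<Prod>i<n. indicator (A i) (Z i \<omega>)) = (indicator {\<omega> \<in> space R. \<forall>i<n. Z i \<omega> \<in> A i} \<omega> :: real)"
    proof (cases "\<forall>i<n. Z i \<omega> \<in> A i")
      case False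
      then have "\<exists>i\<in>{..<n}. indicator (A i) (Z i \<omega>) = (0 :: real)"
        by (auto simp: indicator_def)
      then have "(\<Prod>i<n. indicator (A i) (Z i \<omega>)) = (0 :: real)"
        by (intro prod_zero) auto
      then show ?thesis using False by simp
    qed simp
  qed
  then show ?thesis by (simp add: Int_absorb2)
qed

lemma emeasure_distr_PiM_box:
  fixes Z :: "nat \<Rightarrow> 'a \<Rightarrow> real"
  assumes "prob_space R" and Z: "\<And>i. i < n \<Longrightarrow> Z i \<in> borel_measurable R" and A: "\<And>i. A i \<in> sets borel"
  shows "emeasure (distr R (\<Pi>\<^sub>M i\<in>{..<n}. borel) (\<lambda>\<omega>. \<lambda>i\<in>{..<n}. Z i \<omega>)) (\<Pi>\<^sub>E i\<in>{..<n}. A i) =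
    ennreal (\<integral>\<omega>. (\<Prod>i<n. indicator (A i) (Z i \<omega>)) \<partial>R)"
proof -
  interpret R: prob_space R by fact
  have [measurable]: "(\<lambda>\<omega>. \<lambda>i\<in>{..<n}. Z i \<omega>) \<in> measurable R (\<Pi>\<^sub>M i\<in>{..<n}. borel)"
    using Z by (intro measurable_restrict) auto
  have [measurable]: "(\<Pi>\<^sub>E i\<in>{..<n}. A i) \<in> sets (\<Pi>\<^sub>M i\<in>{..<n}. borel)"
    using A by (intro sets_PiM_I_finite) auto
  have "(\<lambda>\<omega>. \<lambda>i\<in>{..<n}. Z i \<omega>) -` (\<Pi>\<^sub>E i\<in>{..<n}. A i) \<inter> space R = {\<omega> \<in> space R. \<forall>i<n. Z i \<omega> \<in> A i}"
    by (auto simp: PiE_def Pi_def)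
  then show ?thesis
    by (subst emeasure_distr) (simp_all add: R.emeasure_eq_measure integral_prod_indicator)
qed

lemma distr_PiM_lessThan_eqI:
  fixes X :: "nat \<Rightarrow> 'a \<Rightarrow> real" and Y :: "nat \<Rightarrow> 'b \<Rightarrow> real"
  assumes "prob_space P" "prob_space Q"
    and X: "\<And>i. i < n \<Longrightarrow> X i \<in> borel_measurable P" and Y: "\<And>i. i < n \<Longrightarrow> Y i \<in> borel_measurable Q"
    and eq: "\<And>A. (\<And>i. A i \<in> sets borel) \<Longrightarrow>
      (\<integral>\<omega>. (\<Prod>i<n. indicator (A i) (X i \<omega>)) \<partial>P) = (\<integral>\<omega>. (\<Prod>i<n. indicator (A i) (Y i \<omega>)) \<partial>Q :: real)"
  shows "distr P (\<Pi>\<^sub>M i\<in>{..<n}. borel) (\<lambda>\<omega>. \<lambda>i\<in>{..<n}. X i \<omega>) =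
    distr Q (\<Pi>\<^sub>M i\<in>{..<n}. borel) (\<lambda>\<omega>. \<lambda>i\<in>{..<n}. Y i \<omega>)"
proof -
  interpret P': prob_space "distr P (\<Pi>\<^sub>M i\<in>{..<n}. borel) (\<lambda>\<omega>. \<lambda>i\<in>{..<n}. X i \<omega>)"
    using X by (intro prob_space.prob_space_distr assms measurable_restrict) auto
  show ?thesis
  proof (rule measure_eqI_PiM_finite[where I="{..<n}" and M="\<lambda>_. borel" and A="\<lambda>_. \<Pi>\<^sub>E i\<in>{..<n}. UNIV"])
    fix A :: "nat \<Rightarrow> real set" assume A: "\<And>i. i \<in> {..<n} \<Longrightarrow> A i \<in> sets borel"
    let ?A = "\<lambda>i. if i < n then A i else UNIV"
    have "(\<Pi>\<^sub>E i\<in>{..<n}. A i) = (\<Pi>\<^sub>E i\<in>{..<n}. ?A i)"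
      by (rule PiE_cong) simp
    then show "emeasure (distr P (\<Pi>\<^sub>M i\<in>{..<n}. borel) (\<lambda>\<omega>. \<lambda>i\<in>{..<n}. X i \<omega>)) (\<Pi>\<^sub>E i\<in>{..<n}. A i) =
        emeasure (distr Q (\<Pi>\<^sub>M i\<in>{..<n}. borel) (\<lambda>\<omega>. \<lambda>i\<in>{..<n}. Y i \<omega>)) (\<Pi>\<^sub>E i\<in>{..<n}. A i)"
      using emeasure_distr_PiM_box[where A="?A", OF assms(1) X] emeasure_distr_PiM_box[where A="?A", OF assms(2) Y]
        eq[of "?A"] A by simp
  next
    show "range (\<lambda>_::nat. \<Pi>\<^sub>E i\<in>{..<n}. UNIV) \<subseteq> prod_algebra {..<n} (\<lambda>_. borel :: real measure)"
      by (auto intro!: prod_algebraI_finite)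
  qed (auto simp: space_PiM)
qed

text \<open>
  The coordinates are replaced one at a time: the first \<open>k\<close> enter through indicators, the
  others through a character. The weights \<open>1 + cos\<close> keep the measures of the induction step
  nonnegative, so that the one-dimensional uniqueness theorem applies.
\<close>

proposition distr_eq_of_char_eq:
  fixes X :: "nat \<Rightarrow> 'a \<Rightarrow> real" and Y :: "nat \<Rightarrow> 'b \<Rightarrow> real"
  assumes P: "prob_space P" and Q: "prob_space Q"
    and X: "\<And>i. i < n \<Longrightarrow> X i \<in> borel_measurable P" and Y: "\<And>i. i < n \<Longrightarrow> Y i \<in> borel_measurable Q"
    and eq: "\<And>u. (\<integral>\<omega>. iexp (\<Sum>i<n. u i * X i \<omega>) \<partial>P) = (\<integral>\<omega>. iexp (\<Sum>i<n. u i * Y i \<omega>) \<partial>Q)"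
  shows "distr P (\<Pi>\<^sub>M i\<in>{..<n}. borel) (\<lambda>\<omega>. \<lambda>i\<in>{..<n}. X i \<omega>) =
    distr Q (\<Pi>\<^sub>M i\<in>{..<n}. borel) (\<lambda>\<omega>. \<lambda>i\<in>{..<n}. Y i \<omega>)"
proof (rule distr_PiM_lessThan_eqI[OF P Q X Y])
  fix A :: "nat \<Rightarrow> real set" assume A [measurable]: "\<And>i. A i \<in> sets borel"
  interpret P: prob_space P by fact
  interpret Q: prob_space Q by fact
  define W where "W k x = (\<Prod>i<k. indicator (A i) (x i) :: real)" for k and x :: "nat \<Rightarrow> real"
  define S where "S k u x = (\<Sum>i\<in>{k..<n}. u i * x i :: real)" for k u and x :: "nat \<Rightarrow> real"
  have W01: "0 \<le> W k x" "W k x \<le> 1" for k x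
    unfolding W_def by (auto intro!: prod_nonneg prod_le_1)
  have measX: "(\<lambda>\<omega>. W k (\<lambda>i. X i \<omega>)) \<in> borel_measurable P" "(\<lambda>\<omega>. S k u (\<lambda>i. X i \<omega>)) \<in> borel_measurable P"
    and measY: "(\<lambda>\<omega>. W k (\<lambda>i. Y i \<omega>)) \<in> borel_measurable Q" "(\<lambda>\<omega>. S k u (\<lambda>i. Y i \<omega>)) \<in> borel_measurable Q"
    if "k \<le> n" for k u
    using that X Y unfolding W_def S_def
    by (auto intro!: borel_measurable_prod borel_measurable_sum borel_measurable_times
        measurable_compose[OF _ borel_measurable_indicator])
  have "\<forall>u. (\<integral>\<omega>. W k (\<lambda>i. X i \<omega>) * iexp (S k u (\<lambda>i. X i \<omega>)) \<partial>P) =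
      (\<integral>\<omega>. W k (\<lambda>i. Y i \<omega>) * iexp (S k u (\<lambda>i. Y i \<omega>)) \<partial>Q)" if "k \<le> n" for k
    using that
  proof (induction k)
    case 0
    show ?case using eq by (simp add: W_def S_def lessThan_atLeast0)
  next
    case (Suc k)
    then have k: "k < n" "k \<le> n" by auto
    note IH = Suc.IH[OF k(2), rule_format]
    note [measurable] = X[OF k(1)] Y[OF k(1)] measX[OF k(2)] measY[OF k(2)]
      measX[OF Suc.prems] measY[OF Suc.prems]
    \<comment> \<open>The free phase \<open>\<theta>\<close> makes one real identity serve for both
      the real and the imaginary part of the character.\<close>
    have step: "(\<integral>\<omega>. W k (\<lambda>i. X i \<omega>) * indicator (A k) (X k \<omega>) * (1 + cos (\<theta> + S (Suc k) u (\<lambda>i. X i \<omega>))) \<partial>P) =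
      (\<integral>\<omega>. W k (\<lambda>i. Y i \<omega>) * indicator (A k) (Y k \<omega>) * (1 + cos (\<theta> + S (Suc k) u (\<lambda>i. Y i \<omega>))) \<partial>Q)" for \<theta> u
    proof -
      define w where "w x = W k x * (1 + cos (\<theta> + S (Suc k) u x))" for x
      have w0: "0 \<le> w x" and w2: "w x \<le> 2" for x
      proof -
        have "0 \<le> 1 + cos (\<theta> + S (Suc k) u x)" using cos_ge_minus_one[of "\<theta> + S (Suc k) u x"] by linarith
        then show "0 \<le> w x" using W01 by (simp add: w_def)
        have "w x \<le> 1 * 2" unfolding w_def using W01 cos_le_one[of "\<theta> + S (Suc k) u x"]
          \<open>0 \<le> 1 + cos _\<close> by (intro mult_mono) auto
        then show "w x \<le> 2" by simp
      qed
      have [measurable]: "(\<lambda>\<omega>. w (\<lambda>i. X i \<omega>)) \<in> borel_measurable P" "(\<lambda>\<omega>. w (\<lambda>i. Y i \<omega>)) \<in> borel_measurable Q"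
        unfolding w_def by measurable
      have wint: "integrable P (\<lambda>\<omega>. w (\<lambda>i. X i \<omega>))" "integrable Q (\<lambda>\<omega>. w (\<lambda>i. Y i \<omega>))"
        using w0 w2 by (auto intro!: P.integrable_const_bound[where B=2] Q.integrable_const_bound[where B=2])
      let ?\<mu> = "weighted_law P (\<lambda>\<omega>. w (\<lambda>i. X i \<omega>)) (X k)"
      let ?\<nu> = "weighted_law Q (\<lambda>\<omega>. w (\<lambda>i. Y i \<omega>)) (Y k)"
      \<comment> \<open>Writing the cosine as two exponentials splits the weighted character of
        coordinate \<open>k\<close> into three instances of the induction hypothesis: coefficient
        \<open>t\<close> at \<open>k\<close>, and coefficients 0, \<open>u\<close> and
        \<open>- u\<close> beyond it.\<close>
      let ?R = "\<lambda>t x. of_real (W k x) * iexp (S k ((\<lambda>_. 0)(k := t)) x) +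
          (iexp \<theta> / 2 * (of_real (W k x) * iexp (S k (u(k := t)) x)) +
           iexp (- \<theta>) / 2 * (of_real (W k x) * iexp (S k ((\<lambda>i. - u i)(k := t)) x)))"
      have expand: "of_real (w x) * iexp (t * x k) = ?R t x" for x t
      proof -
        have S1: "S k (v(k := t)) x = t * x k + S (Suc k) v x" for v
          using k(1) unfolding S_def by (simp add: sum.atLeast_Suc_lessThan)
        have S2: "S (Suc k) (\<lambda>i. - u i) x = - S (Suc k) u x" "S (Suc k) (\<lambda>_. 0) x = 0"
          by (simp_all add: S_def sum_negf)
        have c: "complex_of_real (cos r) = iexp r / 2 + iexp (- r) / 2" for r
          using cos_exp_eq[of "complex_of_real r"] by (simp add: cos_of_real add_divide_distrib)
        show ?thesis
          unfolding w_def S1 S2 by (simp add: c exp_add exp_diff exp_minus field_simps)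
      qed
      have char_eq: "(\<integral>x. iexp (t * x) \<partial>?\<mu>) = (\<integral>x. iexp (t * x) \<partial>?\<nu>)" for t
      proof -
        have i: "integrable P (\<lambda>\<omega>. of_real (W k (\<lambda>i. X i \<omega>)) * iexp (S k v (\<lambda>i. X i \<omega>)))"
          "integrable Q (\<lambda>\<omega>. of_real (W k (\<lambda>i. Y i \<omega>)) * iexp (S k v (\<lambda>i. Y i \<omega>)))" for v
          by (rule P.integrable_const_bound[where B=1] Q.integrable_const_bound[where B=1],
              auto simp: norm_mult W01)+
        have "(\<integral>\<omega>. of_real (w (\<lambda>i. X i \<omega>)) * iexp (t * X k \<omega>) \<partial>P) =
            (\<integral>\<omega>. of_real (w (\<lambda>i. Y i \<omega>)) * iexp (t * Y k \<omega>) \<partial>Q)"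
        proof -
          have "(\<integral>\<omega>. of_real (w (\<lambda>i. X i \<omega>)) * iexp (t * X k \<omega>) \<partial>P) = (\<integral>\<omega>. ?R t (\<lambda>i. X i \<omega>) \<partial>P)"
            by (rule Bochner_Integration.integral_cong[OF refl expand])
          also have "\<dots> = (\<integral>\<omega>. ?R t (\<lambda>i. Y i \<omega>) \<partial>Q)"
            by (simp add: i IH del: of_real_mult)
          also have "\<dots> = (\<integral>\<omega>. of_real (w (\<lambda>i. Y i \<omega>)) * iexp (t * Y k \<omega>) \<partial>Q)"
            by (rule Bochner_Integration.integral_cong[OF refl expand[symmetric]])
          finally show ?thesis .
        qed
        then show ?thesis
          using wint w0 by (simp add: integral_weighted_law scaleR_conv_of_real)
      qed
      have "?\<mu> = ?\<nu>"
        using wint w0 by (intro finite_measure_char_unique finite_borel_weighted_law char_eq) auto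
      then have "measure ?\<mu> (A k) = measure ?\<nu> (A k)" by simp
      then show ?thesis
        using wint w0 by (simp add: measure_weighted_law w_def mult_ac)
    qed
    have wb: "\<bar>W k x * indicator (A k) (x k) * cos r\<bar> \<le> 1 * 1 * 1" for x r
      unfolding abs_mult by (intro mult_mono) (auto simp: W01 indicator_def)
    have bndX: "integrable P (\<lambda>\<omega>. W k (\<lambda>i. X i \<omega>) * indicator (A k) (X k \<omega>) * cos (\<theta> + S (Suc k) u (\<lambda>i. X i \<omega>)))"
      and bndY: "integrable Q (\<lambda>\<omega>. W k (\<lambda>i. Y i \<omega>) * indicator (A k) (Y k \<omega>) * cos (\<theta> + S (Suc k) u (\<lambda>i. Y i \<omega>)))" for u \<theta>
      using wb[of "\<lambda>i. X i \<omega>" for \<omega>] wb[of "\<lambda>i. Y i \<omega>" for \<omega>]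
      by (auto intro!: P.integrable_const_bound[where B=1] Q.integrable_const_bound[where B=1] simp del: abs_mult)
    have cos_eq: "(\<integral>\<omega>. W k (\<lambda>i. X i \<omega>) * indicator (A k) (X k \<omega>) * cos (\<theta> + S (Suc k) u (\<lambda>i. X i \<omega>)) \<partial>P) =
      (\<integral>\<omega>. W k (\<lambda>i. Y i \<omega>) * indicator (A k) (Y k \<omega>) * cos (\<theta> + S (Suc k) u (\<lambda>i. Y i \<omega>)) \<partial>Q)" for \<theta> u
    proof -
      have c0: "S (Suc k) (\<lambda>_. 0) x = 0" for x by (simp add: S_def)
      \<comment> \<open>With zero coefficients and phase \<open>pi / 2\<close> the cosine vanishes.
        This isolates the contribution of the summand 1 in the weight, which can then be
        subtracted.\<close>
      have "(\<integral>\<omega>. W k (\<lambda>i. X i \<omega>) * indicator (A k) (X k \<omega>) \<partial>P) = (\<integral>\<omega>. W k (\<lambda>i. Y i \<omega>) * indicator (A k) (Y k \<omega>) \<partial>Q)"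
        using step[of "pi / 2" "\<lambda>_. 0"] by (simp add: c0)
      moreover have "integrable P (\<lambda>\<omega>. W k (\<lambda>i. X i \<omega>) * indicator (A k) (X k \<omega>))"
        "integrable Q (\<lambda>\<omega>. W k (\<lambda>i. Y i \<omega>) * indicator (A k) (Y k \<omega>))"
        using bndX[of 0 "\<lambda>_. 0"] bndY[of 0 "\<lambda>_. 0"] by (simp_all add: c0)
      ultimately show ?thesis
        using step[of \<theta> u] bndX[of \<theta> u] bndY[of \<theta> u] by (simp add: distrib_left)
    qed
    \<comment> \<open>The imaginary part is a cosine with phase \<open>- pi / 2\<close>.\<close>
    have W_Suc: "of_real (W (Suc k) x) * iexp (S (Suc k) u x) =
        of_real (W k x * indicator (A k) (x k) * cos (0 + S (Suc k) u x)) +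
        \<i> * of_real (W k x * indicator (A k) (x k) * cos (- (pi / 2) + S (Suc k) u x))" for x u
      unfolding cis_conv_exp[symmetric]
      by (simp add: W_def complex_eq_iff cos_diff)
    show ?case
    proof
      fix u
      show "(\<integral>\<omega>. W (Suc k) (\<lambda>i. X i \<omega>) * iexp (S (Suc k) u (\<lambda>i. X i \<omega>)) \<partial>P) =
        (\<integral>\<omega>. W (Suc k) (\<lambda>i. Y i \<omega>) * iexp (S (Suc k) u (\<lambda>i. Y i \<omega>)) \<partial>Q)"
        unfolding W_Suc
        by (subst (1 2) Bochner_Integration.integral_add)
           (simp_all only: integral_mult_right_zero integral_complex_of_real cos_eq
             integrable_mult_right complex_of_real_integrable_eq bndX bndY)
    qed
  qed
  from this[of n] have "complex_of_real (\<integral>\<omega>. W n (\<lambda>i. X i \<omega>) \<partial>P) = complex_of_real (\<integral>\<omega>. W n (\<lambda>i. Y i \<omega>) \<partial>Q)"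
    by (simp add: S_def flip: integral_complex_of_real)
  then show "(\<integral>\<omega>. (\<Prod>i<n. indicator (A i) (X i \<omega>)) \<partial>P) = (\<integral>\<omega>. (\<Prod>i<n. indicator (A i) (Y i \<omega>)) \<partial>Q :: real)"
    by (simp add: W_def)
qed

text \<open>Coordinatewise as before, with half-lines in place of characters.\<close>

lemma distr_eq_of_cdf_eq:
  fixes X :: "nat \<Rightarrow> 'a \<Rightarrow> real" and Y :: "nat \<Rightarrow> 'b \<Rightarrow> real"
  assumes P: "prob_space P" and Q: "prob_space Q"
    and X: "\<And>i. i < n \<Longrightarrow> X i \<in> borel_measurable P" and Y: "\<And>i. i < n \<Longrightarrow> Y i \<in> borel_measurable Q"
    and eq: "\<And>a. measure P {\<omega> \<in> space P. \<forall>i<n. X i \<omega> \<le> a i} = measure Q {\<omega> \<in> space Q. \<forall>i<n. Y i \<omega> \<le> a i}"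
  shows "distr P (\<Pi>\<^sub>M i\<in>{..<n}. borel) (\<lambda>\<omega>. \<lambda>i\<in>{..<n}. X i \<omega>) =
    distr Q (\<Pi>\<^sub>M i\<in>{..<n}. borel) (\<lambda>\<omega>. \<lambda>i\<in>{..<n}. Y i \<omega>)"
proof (rule distr_PiM_lessThan_eqI[OF P Q X Y])
  fix A :: "nat \<Rightarrow> real set" assume A [measurable]: "\<And>i. A i \<in> sets borel"
  interpret P: prob_space P by fact
  interpret Q: prob_space Q by fact
  define W where "W B x = (\<Prod>i<n. indicator (B i) (x i) :: real)" for B and x :: "nat \<Rightarrow> real"
  \<comment> \<open>The product without factor \<open>k\<close>: it serves as the weight under which
    the law of coordinate \<open>k\<close> is identified.\<close>
  define W' where "W' k B x = (\<Prod>i\<in>{..<n} - {k}. indicator (B i) (x i) :: real)" for k B and x :: "nat \<Rightarrow> real"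
  have W'01: "0 \<le> W' k B x" "W' k B x \<le> 1" for k B x
    unfolding W'_def by (auto intro!: prod_nonneg prod_le_1)
  have W_split: "W B x = W' k B x * indicator (B k) (x k)" if "k < n" for k B x
    unfolding W_def W'_def using that by (subst prod.remove[of _ k]) auto
  \<comment> \<open>The first \<open>k\<close> sets are already arbitrary Borel sets, the others are
    still half-lines; each induction step frees one more.\<close>
  have claim: "\<forall>B. (\<forall>i<k. B i \<in> sets borel) \<longrightarrow> (\<forall>i. k \<le> i \<longrightarrow> B i \<in> range atMost) \<longrightarrow>
      (\<integral>\<omega>. W B (\<lambda>i. X i \<omega>) \<partial>P) = (\<integral>\<omega>. W B (\<lambda>i. Y i \<omega>) \<partial>Q)" if "k \<le> n" for k
    using that
  proof (induction k)
    case 0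
    show ?case
    proof (intro allI impI)
      fix B :: "nat \<Rightarrow> real set" assume "\<forall>i. 0 \<le> i \<longrightarrow> B i \<in> range atMost"
      then have "\<forall>i. \<exists>a. B i = {..a}" by blast
      then obtain a where "B = (\<lambda>i. {..a i})" by metis
      then show "(\<integral>\<omega>. W B (\<lambda>i. X i \<omega>) \<partial>P) = (\<integral>\<omega>. W B (\<lambda>i. Y i \<omega>) \<partial>Q)"
        using eq[of a] by (simp add: W_def integral_prod_indicator)
    qed
  next
    case (Suc k)
    show ?case
    proof (intro allI impI)
      fix B :: "nat \<Rightarrow> real set"
      assume B: "\<forall>i<Suc k. B i \<in> sets borel" "\<forall>i. Suc k \<le> i \<longrightarrow> B i \<in> range atMost"
      have k: "k < n" "k \<le> n" using Suc.prems by auto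
      have Bm [measurable]: "B i \<in> sets borel" for i
      proof (cases "i < Suc k")
        case False
        then have "B i \<in> range atMost" using B(2) by simp
        then show ?thesis by auto
      qed (use B(1) in simp)
      have [measurable]: "(\<lambda>\<omega>. W' k B (\<lambda>i. X i \<omega>)) \<in> borel_measurable P" "(\<lambda>\<omega>. W' k B (\<lambda>i. Y i \<omega>)) \<in> borel_measurable Q"
        unfolding W'_def
        by (auto intro!: borel_measurable_prod measurable_compose[OF X borel_measurable_indicator]
            measurable_compose[OF Y borel_measurable_indicator] Bm)
      note [measurable] = X[OF k(1)] Y[OF k(1)]
      have int: "integrable P (\<lambda>\<omega>. W' k B (\<lambda>i. X i \<omega>))" "integrable Q (\<lambda>\<omega>. W' k B (\<lambda>i. Y i \<omega>))"
        using W'01 by (auto intro!: P.integrable_const_bound[where B=1] Q.integrable_const_bound[where B=1])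
      let ?\<mu> = "weighted_law P (\<lambda>\<omega>. W' k B (\<lambda>i. X i \<omega>)) (X k)"
      let ?\<nu> = "weighted_law Q (\<lambda>\<omega>. W' k B (\<lambda>i. Y i \<omega>)) (Y k)"
      have "cdf ?\<mu> a = cdf ?\<nu> a" for a
      proof -
        let ?B = "B(k := {..a})"
        have "(\<integral>\<omega>. W ?B (\<lambda>i. X i \<omega>) \<partial>P) = (\<integral>\<omega>. W ?B (\<lambda>i. Y i \<omega>) \<partial>Q)"
          using B by (intro Suc.IH[OF k(2), rule_format]) auto
        moreover have "W ?B x = W' k B x * indicator {..a} (x k)" for x
          unfolding W_split[OF k(1)] by (simp add: W'_def)
        ultimately show ?thesis
          using int W'01 by (simp add: cdf_def measure_weighted_law)
      qed
      then have "?\<mu> = ?\<nu>"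
        using int W'01 by (intro cdf_unique' finite_borel_weighted_law ext) auto
      then have "measure ?\<mu> (B k) = measure ?\<nu> (B k)" by simp
      then show "(\<integral>\<omega>. W B (\<lambda>i. X i \<omega>) \<partial>P) = (\<integral>\<omega>. W B (\<lambda>i. Y i \<omega>) \<partial>Q)"
        using int W'01 by (simp add: measure_weighted_law W_split[OF k(1)])
    qed
  qed
  \<comment> \<open>The claim asks for half-lines from index \<open>n\<close> on. Which one is
    chosen does not affect \<open>W\<close>.\<close>
  let ?A = "\<lambda>i. if i < n then A i else {..0}"
  have "W ?A x = (\<Prod>i<n. indicator (A i) (x i))" for x
    by (auto simp: W_def intro!: prod.cong)
  moreover have "(\<integral>\<omega>. W ?A (\<lambda>i. X i \<omega>) \<partial>P) = (\<integral>\<omega>. W ?A (\<lambda>i. Y i \<omega>) \<partial>Q)"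
    by (rule claim[rule_format, of n]) auto
  ultimately show "(\<integral>\<omega>. (\<Prod>i<n. indicator (A i) (X i \<omega>)) \<partial>P) = (\<integral>\<omega>. (\<Prod>i<n. indicator (A i) (Y i \<omega>)) \<partial>Q :: real)"
    by simp
qed

subsection \<open>Zonoids and max-zonoids of positive vectors\<close>

text \<open>As a function of \<open>c\<close>, \<open>max c u\<close> has right derivative 1 if
  \<open>u \<le> c\<close> and 0 otherwise. The difference quotients lie between 0 and 1, so
  differentiation passes under the expectation; taking it from the right yields the event with
  \<open>\<le>\<close>.\<close>

lemma (in prob_space) cdf_from_max:
  assumes U: "integrable M U"
  shows "(\<lambda>n. real (Suc n) * ((\<integral>\<omega>. max (c + 1 / real (Suc n)) (U \<omega>) \<partial>M) - (\<integral>\<omega>. max c (U \<omega>) \<partial>M)))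
    \<longlonglongrightarrow> prob {\<omega> \<in> space M. U \<omega> \<le> c}"
proof -
  have [measurable]: "U \<in> borel_measurable M" using U by simp
  have imax: "integrable M (\<lambda>\<omega>. max a (U \<omega>))" for a
    using U by (intro integrable_max) auto
  let ?g = "\<lambda>n \<omega>. real (Suc n) * (max (c + 1 / real (Suc n)) (U \<omega>) - max c (U \<omega>))"
  have "(\<lambda>n. \<integral>\<omega>. ?g n \<omega> \<partial>M) \<longlonglongrightarrow> (\<integral>\<omega>. indicator {\<omega> \<in> space M. U \<omega> \<le> c} \<omega> \<partial>M)"
  proof (rule integral_dominated_convergence[where w="\<lambda>_. 1"])
    show "AE \<omega> in M. (\<lambda>n. ?g n \<omega>) \<longlonglongrightarrow> indicator {\<omega> \<in> space M. U \<omega> \<le> c} \<omega>"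
    proof (rule AE_I2)
      fix \<omega> assume w: "\<omega> \<in> space M"
      show "(\<lambda>n. ?g n \<omega>) \<longlonglongrightarrow> indicator {\<omega> \<in> space M. U \<omega> \<le> c} \<omega>"
      proof (cases "U \<omega> \<le> c")
        case True
        then have "?g n \<omega> = 1" for n
          by (subst max_absorb1, simp add: add_increasing2, subst max_absorb1, simp) (simp add: field_simps)
        then show ?thesis using True w by simp
      next
        case False
        then obtain n0 where n0: "inverse (real (Suc n0)) < U \<omega> - c"
          using reals_Archimedean[of "U \<omega> - c"] by auto
        have "?g n \<omega> = 0" if "n0 \<le> n" for n
        proof -
          have "1 / real (Suc n) \<le> inverse (real (Suc n0))"
            using that by (simp add: inverse_eq_divide frac_le)
          then have "c + 1 / real (Suc n) \<le> U \<omega>" using n0 by linarith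
          then have 1: "max (c + 1 / real (Suc n)) (U \<omega>) = U \<omega>" by (rule max_absorb2)
          have 2: "max c (U \<omega>) = U \<omega>" using False by (intro max_absorb2) simp
          show ?thesis unfolding 1 2 by simp
        qed
        then have "\<forall>\<^sub>F n in sequentially. ?g n \<omega> = 0"
          by (auto simp: eventually_sequentially)
        then show ?thesis using False by (simp add: tendsto_eventually)
      qed
    qed
    show "AE \<omega> in M. norm (?g n \<omega>) \<le> 1" for n
    proof (rule AE_I2)
      fix \<omega>
      have d: "0 \<le> max (c + d) r - max c r \<and> max (c + d) r - max c r \<le> d" if "0 \<le> d" for d r :: real
        using that by (auto simp: max_def)
      have "0 \<le> max (c + 1 / real (Suc n)) (U \<omega>) - max c (U \<omega>)"
        "max (c + 1 / real (Suc n)) (U \<omega>) - max c (U \<omega>) \<le> 1 / real (Suc n)"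
        using d[of "1 / real (Suc n)" "U \<omega>"] by simp_all
      then have "real (Suc n) * (max (c + 1 / real (Suc n)) (U \<omega>) - max c (U \<omega>)) \<le> real (Suc n) * (1 / real (Suc n))"
        and "0 \<le> ?g n \<omega>" by (intro mult_left_mono, simp_all)
      then show "norm (?g n \<omega>) \<le> 1" by simp
    qed
  qed auto
  then show ?thesis
    using imax by (simp add: Int_absorb2)
qed

text \<open>Only thresholds above \<open>a\<close> are compared, and the right difference quotient
  at \<open>c\<close> never leaves that range. The bound serves max functionals, which are given for
  positive coefficients only.\<close>

lemma cdf_eq_of_max_eq:
  fixes U :: "'a \<Rightarrow> real" and V :: "'b \<Rightarrow> real"
  assumes P: "prob_space P" and Q: "prob_space Q" and U: "integrable P U" and V: "integrable Q V"
    and eq: "\<And>c. a < c \<Longrightarrow> (\<integral>\<omega>. max c (U \<omega>) \<partial>P) = (\<integral>\<omega>. max c (V \<omega>) \<partial>Q)" and "a < c"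
  shows "measure P {\<omega> \<in> space P. U \<omega> \<le> c} = measure Q {\<omega> \<in> space Q. V \<omega> \<le> c}"
proof -
  have "(\<integral>\<omega>. max (c + 1 / real (Suc n)) (U \<omega>) \<partial>P) = (\<integral>\<omega>. max (c + 1 / real (Suc n)) (V \<omega>) \<partial>Q)" for n
    by (rule eq) (simp add: add_strict_increasing2 \<open>a < c\<close> less_add_same_cancel1 order_less_trans[OF \<open>a < c\<close>])
  then show ?thesis
    using prob_space.cdf_from_max[OF P U, of c] prob_space.cdf_from_max[OF Q V, of c] eq[OF \<open>a < c\<close>]
    by (simp add: LIMSEQ_unique)
qed

lemma integrable_Max_lessThan:
  fixes f :: "nat \<Rightarrow> 'a \<Rightarrow> real"
  assumes n: "0 < n" and int: "\<And>i. i < n \<Longrightarrow> integrable M (f i)"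
  shows "integrable M (\<lambda>\<omega>. Max ((\<lambda>i. f i \<omega>) ` {..<n}))"
proof (rule Bochner_Integration.integrable_bound)
  show "integrable M (\<lambda>\<omega>. \<Sum>i<n. \<bar>f i \<omega>\<bar>)"
    using int by (intro Bochner_Integration.integrable_sum integrable_abs) auto
  show "(\<lambda>\<omega>. Max ((\<lambda>i. f i \<omega>) ` {..<n})) \<in> borel_measurable M"
    using int by (intro borel_measurable_Max) auto
  show "AE \<omega> in M. norm (Max ((\<lambda>i. f i \<omega>) ` {..<n})) \<le> norm (\<Sum>i<n. \<bar>f i \<omega>\<bar>)"
  proof (rule AE_I2)
    fix \<omega>
    have "Max ((\<lambda>i. f i \<omega>) ` {..<n}) \<in> (\<lambda>i. f i \<omega>) ` {..<n}"
      using n by (intro Max_in) auto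
    then obtain j where j: "j < n" "Max ((\<lambda>i. f i \<omega>) ` {..<n}) = f j \<omega>" by auto
    have "\<bar>f j \<omega>\<bar> \<le> (\<Sum>i<n. \<bar>f i \<omega>\<bar>)"
      using j by (intro member_le_sum) auto
    then show "norm (Max ((\<lambda>i. f i \<omega>) ` {..<n})) \<le> norm (\<Sum>i<n. \<bar>f i \<omega>\<bar>)"
      by (simp add: j(2) sum_nonneg)
  qed
qed

text \<open>
  Under the measure with density \<open>\<xi>\<^sub>0\<close>, the
  expectation of a function of the ratios \<open>\<xi>\<^sub>i / \<xi>\<^sub>0\<close> is the original expectation of the
  1-homogeneous extension of that function.
\<close>

locale positive_vector = prob_space N for N :: "'w measure" +
  fixes n :: nat and \<xi> :: "nat \<Rightarrow> 'w \<Rightarrow> real"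
  assumes n: "0 < n" and integrable: "\<And>i. i < n \<Longrightarrow> integrable N (\<xi> i)"
    and pos: "\<And>i. i < n \<Longrightarrow> AE \<omega> in N. 0 < \<xi> i \<omega>" and unit: "(\<integral>\<omega>. \<xi> 0 \<omega> \<partial>N) = 1"
begin

definition tilted :: "'w measure" where
  "tilted = density N (\<lambda>\<omega>. ennreal (\<xi> 0 \<omega>))"

definition ratio :: "nat \<Rightarrow> 'w \<Rightarrow> real" where
  "ratio i \<omega> = \<xi> i \<omega> / \<xi> 0 \<omega>"

lemma measurable_vector [measurable]: "i < n \<Longrightarrow> \<xi> i \<in> borel_measurable N"
  using integrable by auto

lemma measurable_vector_0 [measurable]: "\<xi> 0 \<in> borel_measurable N"
  using n by simp

lemma space_tilted [simp]: "space tilted = space N"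
  and sets_tilted [simp, measurable_cong]: "sets tilted = sets N"
  by (simp_all add: tilted_def)

lemma measurable_ratio: "i < n \<Longrightarrow> ratio i \<in> borel_measurable N"
  unfolding ratio_def by measurable

lemma AE_pos: "AE \<omega> in N. \<forall>i<n. 0 < \<xi> i \<omega>"
  using pos by (subst AE_all_countable) (auto intro: AE_impI)

lemma AE_tilted: "AE \<omega> in N. Q \<omega> \<Longrightarrow> AE \<omega> in tilted. Q \<omega>"
  unfolding tilted_def by (subst AE_density) (auto elim: eventually_mono)

lemma prob_space_tilted: "prob_space tilted"
proof
  have "emeasure tilted (space tilted) = (\<integral>\<^sup>+\<omega>. ennreal (\<xi> 0 \<omega>) \<partial>N)"
    by (simp add: tilted_def emeasure_density nn_integral_set_ennreal cong: nn_integral_cong)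
  also have "\<dots> = ennreal (\<integral>\<omega>. \<xi> 0 \<omega> \<partial>N)"
    using pos[OF n] by (intro nn_integral_eq_integral integrable n) (auto elim: eventually_mono)
  finally show "emeasure tilted (space tilted) = 1" by (simp add: unit)
qed

lemma
  fixes f :: "(nat \<Rightarrow> real) \<Rightarrow> real"
  assumes hom: "\<And>c x. 0 < c \<Longrightarrow> f (\<lambda>i. x i / c) = f x / c"
    and [measurable]: "(\<lambda>\<omega>. f (\<lambda>i. \<xi> i \<omega>)) \<in> borel_measurable N"
      "(\<lambda>\<omega>. f (\<lambda>i. ratio i \<omega>)) \<in> borel_measurable N"
  shows integral_tilted: "(\<integral>\<omega>. f (\<lambda>i. ratio i \<omega>) \<partial>tilted) = (\<integral>\<omega>. f (\<lambda>i. \<xi> i \<omega>) \<partial>N)"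
    and integrable_tilted: "integrable N (\<lambda>\<omega>. f (\<lambda>i. \<xi> i \<omega>)) \<Longrightarrow> integrable tilted (\<lambda>\<omega>. f (\<lambda>i. ratio i \<omega>))"
proof -
  have nn: "AE \<omega> in N. 0 \<le> \<xi> 0 \<omega>"
    using pos[OF n] by (auto elim: eventually_mono)
  have eq: "AE \<omega> in N. \<xi> 0 \<omega> * f (\<lambda>i. ratio i \<omega>) = f (\<lambda>i. \<xi> i \<omega>)"
    using pos[OF n] by eventually_elim (simp add: ratio_def hom)
  show "(\<integral>\<omega>. f (\<lambda>i. ratio i \<omega>) \<partial>tilted) = (\<integral>\<omega>. f (\<lambda>i. \<xi> i \<omega>) \<partial>N)"
    unfolding tilted_def
    by (subst integral_density) (auto intro!: nn integral_cong_AE eq)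
  show "integrable tilted (\<lambda>\<omega>. f (\<lambda>i. ratio i \<omega>))" if "integrable N (\<lambda>\<omega>. f (\<lambda>i. \<xi> i \<omega>))"
  proof -
    have "integrable N (\<lambda>\<omega>. \<xi> 0 \<omega> * f (\<lambda>i. ratio i \<omega>))"
      using that by (subst integrable_cong_AE[OF _ _ eq]) auto
    then show ?thesis
      unfolding tilted_def by (subst integrable_density) (auto intro!: nn)
  qed
qed

lemma integral_tilted_abs_sum:
  "(\<integral>\<omega>. \<bar>\<Sum>i<n. u i * ratio i \<omega>\<bar> \<partial>tilted) = (\<integral>\<omega>. \<bar>\<Sum>i<n. u i * \<xi> i \<omega>\<bar> \<partial>N)"
  using measurable_ratio
  by (intro integral_tilted[where f="\<lambda>x. \<bar>\<Sum>i<n. u i * x i\<bar>"])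
     (auto simp: sum_divide_distrib[symmetric] abs_divide intro!: borel_measurable_abs borel_measurable_sum borel_measurable_times)

lemma
  shows integral_tilted_sum: "(\<integral>\<omega>. (\<Sum>i<n. u i * ratio i \<omega>) \<partial>tilted) = (\<Sum>i<n. u i * (\<integral>\<omega>. \<xi> i \<omega> \<partial>N))"
    and integrable_tilted_sum: "integrable tilted (\<lambda>\<omega>. \<Sum>i<n. u i * ratio i \<omega>)"
proof -
  have *: "(\<integral>\<omega>. (\<Sum>i<n. u i * \<xi> i \<omega>) \<partial>N) = (\<Sum>i<n. u i * (\<integral>\<omega>. \<xi> i \<omega> \<partial>N))"
    using integrable by (subst Bochner_Integration.integral_sum) auto
  show "(\<integral>\<omega>. (\<Sum>i<n. u i * ratio i \<omega>) \<partial>tilted) = (\<Sum>i<n. u i * (\<integral>\<omega>. \<xi> i \<omega> \<partial>N))"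
    unfolding *[symmetric] using measurable_ratio
    by (intro integral_tilted[where f="\<lambda>x. \<Sum>i<n. u i * x i"])
       (auto simp: sum_divide_distrib[symmetric] intro!: borel_measurable_sum borel_measurable_times)
  show "integrable tilted (\<lambda>\<omega>. \<Sum>i<n. u i * ratio i \<omega>)"
    using measurable_ratio integrable
    by (intro integrable_tilted[where f="\<lambda>x. \<Sum>i<n. u i * x i"])
       (auto simp: sum_divide_distrib[symmetric] intro!: borel_measurable_sum borel_measurable_times)
qed

lemma Max_divide_lessThan:
  fixes x :: "nat \<Rightarrow> real"
  assumes "0 < c"
  shows "Max ((\<lambda>i. x i / c) ` {..<n}) = Max (x ` {..<n}) / c"
proof -
  have "mono (\<lambda>y. y / c)" using assms by (auto intro!: monoI divide_right_mono)
  moreover have "{..<n} \<noteq> {}" using n by auto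
  ultimately show ?thesis
    using mono_Max_commute[of "\<lambda>y. y / c" "x ` {..<n}"] by (simp add: image_image)
qed

lemma
  shows integral_tilted_Max:
      "(\<integral>\<omega>. Max ((\<lambda>i. a i * ratio i \<omega>) ` {..<n}) \<partial>tilted) = (\<integral>\<omega>. Max ((\<lambda>i. a i * \<xi> i \<omega>) ` {..<n}) \<partial>N)"
    and integrable_tilted_Max: "integrable tilted (\<lambda>\<omega>. Max ((\<lambda>i. a i * ratio i \<omega>) ` {..<n}))"
proof -
  have m: "(\<lambda>\<omega>. Max ((\<lambda>i. a i * \<xi> i \<omega>) ` {..<n})) \<in> borel_measurable N"
    "(\<lambda>\<omega>. Max ((\<lambda>i. a i * ratio i \<omega>) ` {..<n})) \<in> borel_measurable N"
    using measurable_ratio by (intro borel_measurable_Max borel_measurable_times; simp)+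
  have hom: "Max ((\<lambda>i. a i * (x i / c)) ` {..<n}) = Max ((\<lambda>i. a i * x i) ` {..<n}) / c" if "0 < c" for x c
    using Max_divide_lessThan[OF that, of "\<lambda>i. a i * x i"] by simp
  show "(\<integral>\<omega>. Max ((\<lambda>i. a i * ratio i \<omega>) ` {..<n}) \<partial>tilted) = (\<integral>\<omega>. Max ((\<lambda>i. a i * \<xi> i \<omega>) ` {..<n}) \<partial>N)"
    using m by (intro integral_tilted[where f="\<lambda>x. Max ((\<lambda>i. a i * x i) ` {..<n})"] hom)
  have int: "integrable N (\<lambda>\<omega>. Max ((\<lambda>i. a i * \<xi> i \<omega>) ` {..<n}))"
    using integrable by (intro integrable_Max_lessThan n integrable_mult_right)
  show "integrable tilted (\<lambda>\<omega>. Max ((\<lambda>i. a i * ratio i \<omega>) ` {..<n}))"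
    using m int by (intro integrable_tilted[where f="\<lambda>x. Max ((\<lambda>i. a i * x i) ` {..<n})"] hom)
qed

lemma AE_ratio: "AE \<omega> in tilted. ratio 0 \<omega> = 1 \<and> (\<forall>i<n. 0 < ratio i \<omega>)"
  using AE_pos n by (intro AE_tilted) (auto elim!: eventually_mono simp: ratio_def)

lemma measurable_ratio_tilted: "i < n \<Longrightarrow> ratio i \<in> borel_measurable tilted"
  using measurable_ratio by (simp add: measurable_cong_sets[OF sets_tilted refl])

definition ratio_law :: "(nat \<Rightarrow> real) measure" where
  "ratio_law = distr tilted (\<Pi>\<^sub>M i\<in>{..<n}. borel) (\<lambda>\<omega>. \<lambda>i\<in>{..<n}. ratio i \<omega>)"

lemma measurable_ratio_vector: "(\<lambda>\<omega>. \<lambda>i\<in>{..<n}. ratio i \<omega>) \<in> measurable tilted (\<Pi>\<^sub>M i\<in>{..<n}. borel)"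
  by (intro measurable_restrict measurable_ratio_tilted) simp

lemma abs_sum_ratio_law: "(\<integral>x. \<bar>\<Sum>i<n. u i * x i\<bar> \<partial>ratio_law) = (\<integral>\<omega>. \<bar>\<Sum>i<n. u i * \<xi> i \<omega>\<bar> \<partial>N)"
  unfolding ratio_law_def integral_tilted_abs_sum[symmetric]
  by (subst integral_distr[OF measurable_ratio_vector]) simp_all

lemma Max_ratio_law:
  "(\<integral>x. Max ((\<lambda>i. a i * x i) ` {..<n}) \<partial>ratio_law) = (\<integral>\<omega>. Max ((\<lambda>i. a i * \<xi> i \<omega>) ` {..<n}) \<partial>N)"
  unfolding ratio_law_def integral_tilted_Max[symmetric]
proof (subst integral_distr[OF measurable_ratio_vector])
  show "(\<lambda>x. Max ((\<lambda>i. a i * x i) ` {..<n})) \<in> borel_measurable (\<Pi>\<^sub>M i\<in>{..<n}. borel)"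
    by (intro borel_measurable_Max borel_measurable_times) simp_all
qed (simp cong: image_cong_simp)

text \<open>\<open>max c (- z)\<close> is half of \<open>\<bar>c + z\<bar> + c - z\<close>, and
  \<open>ratio 0\<close> is 1 almost surely, so the constant \<open>c\<close> can be absorbed into
  the coefficient of index 0. Varying that coefficient is thus the same as moving the threshold
  \<open>c\<close>.\<close>

lemma integral_max_sum:
  "(\<integral>\<omega>. max c (- (\<Sum>i<n. u i * ratio i \<omega>)) \<partial>tilted) =
    ((\<integral>\<omega>. \<bar>\<Sum>i<n. (u(0 := u 0 + c)) i * \<xi> i \<omega>\<bar> \<partial>N) + c - (\<Sum>i<n. u i * (\<integral>\<omega>. \<xi> i \<omega> \<partial>N))) / 2"
proof -
  interpret T: prob_space tilted by (rule prob_space_tilted)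
  let ?Z = "\<lambda>\<omega>. \<Sum>i<n. u i * ratio i \<omega>"
  have i: "integrable tilted ?Z" by (rule integrable_tilted_sum)
  have m: "max c (- z) = (\<bar>c + z\<bar> + c - z) / 2" for z :: real by (simp add: max_def abs_if field_simps)
  have "(\<integral>\<omega>. max c (- ?Z \<omega>) \<partial>tilted) = ((\<integral>\<omega>. \<bar>c + ?Z \<omega>\<bar> \<partial>tilted) + c - (\<integral>\<omega>. ?Z \<omega> \<partial>tilted)) / 2"
    unfolding m using i T.prob_space by simp
  also have "(\<integral>\<omega>. \<bar>c + ?Z \<omega>\<bar> \<partial>tilted) = (\<integral>\<omega>. \<bar>\<Sum>i<n. (u(0 := u 0 + c)) i * ratio i \<omega>\<bar> \<partial>tilted)"
  proof (rule integral_cong_AE)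
    show "AE \<omega> in tilted. \<bar>c + ?Z \<omega>\<bar> = \<bar>\<Sum>i<n. (u(0 := u 0 + c)) i * ratio i \<omega>\<bar>"
      using AE_ratio
    proof eventually_elim
      case (elim \<omega>)
      have "(\<Sum>i<n. (u(0 := u 0 + c)) i * ratio i \<omega>) = (\<Sum>i<n. u i * ratio i \<omega> + (if i = 0 then c else 0))"
        using elim by (intro sum.cong) (auto simp: distrib_right)
      also have "\<dots> = ?Z \<omega> + c"
        using n by (simp add: sum.distrib sum.delta)
      finally show ?case by (simp add: add.commute)
    qed
  qed (use measurable_ratio in \<open>auto intro!: borel_measurable_abs borel_measurable_sum borel_measurable_times borel_measurable_add\<close>)
  finally show ?thesis
    by (simp add: integral_tilted_sum integral_tilted_abs_sum)
qed

text \<open>As \<open>ratio 0\<close> is 1 almost surely, the threshold \<open>c\<close> competes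
  only with \<open>a 0\<close> and merges with it into one coefficient.\<close>

lemma integral_max_Max:
  "(\<integral>\<omega>. max c (Max ((\<lambda>i. a i * ratio i \<omega>) ` {..<n})) \<partial>tilted) =
    (\<integral>\<omega>. Max ((\<lambda>i. (a(0 := max c (a 0))) i * \<xi> i \<omega>) ` {..<n}) \<partial>N)"
  unfolding integral_tilted_Max[symmetric]
proof (rule integral_cong_AE)
  show "AE \<omega> in tilted. max c (Max ((\<lambda>i. a i * ratio i \<omega>) ` {..<n})) =
      Max ((\<lambda>i. (a(0 := max c (a 0))) i * ratio i \<omega>) ` {..<n})"
    using AE_ratio
  proof eventually_elim
    case (elim \<omega>)
    \<comment> \<open>Two reals with the same upper bounds are equal, which avoids rearranging the
      maxima.\<close>
    have le: "max c (Max ((\<lambda>i. a i * ratio i \<omega>) ` {..<n})) \<le> t \<longleftrightarrow>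
        Max ((\<lambda>i. (a(0 := max c (a 0))) i * ratio i \<omega>) ` {..<n}) \<le> t" for t
    proof -
      have "c \<le> t \<and> (\<forall>i<n. a i * ratio i \<omega> \<le> t) \<longleftrightarrow> (\<forall>i<n. (a(0 := max c (a 0))) i * ratio i \<omega> \<le> t)"
        using elim n by (auto simp: le_max_iff_disj)
      moreover have "Max (g ` {..<n}) \<le> t \<longleftrightarrow> (\<forall>i<n. g i \<le> t)" for g :: "nat \<Rightarrow> real"
        using n by (subst Max_le_iff) auto
      ultimately show ?thesis by (simp only: max.bounded_iff)
    qed
    show ?case
      by (rule antisym[OF le[THEN iffD2, OF order_refl] le[THEN iffD1, OF order_refl]])
  qed
qed (use measurable_ratio in \<open>auto intro!: borel_measurable_max borel_measurable_Max borel_measurable_times\<close>)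

end

text \<open>Both sides are equivalent to equality of the two ratio laws: each functional is an
  integral against the ratio law, and each determines it, the absolute sums through one-dimensional
  projections, the maxima through the joint distribution function.\<close>

proposition zonoid_iff_max_zonoid:
  assumes "positive_vector P n \<xi>" and "positive_vector Q n \<xi>'"
  shows "(\<forall>u. (\<integral>\<omega>. \<bar>\<Sum>i<n. u i * \<xi> i \<omega>\<bar> \<partial>P) = (\<integral>\<omega>. \<bar>\<Sum>i<n. u i * \<xi>' i \<omega>\<bar> \<partial>Q)) \<longleftrightarrow>
    (\<forall>a. (\<forall>i. 0 < a i) \<longrightarrow>
      (\<integral>\<omega>. Max ((\<lambda>i. a i * \<xi> i \<omega>) ` {..<n}) \<partial>P) = (\<integral>\<omega>. Max ((\<lambda>i. a i * \<xi>' i \<omega>) ` {..<n}) \<partial>Q))"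
    (is "?sum \<longleftrightarrow> ?max")
proof -
  interpret P: positive_vector P n \<xi> by fact
  interpret Q: positive_vector Q n \<xi>' by fact
  interpret TP: prob_space P.tilted by (rule P.prob_space_tilted)
  interpret TQ: prob_space Q.tilted by (rule Q.prob_space_tilted)
  have "P.ratio_law = Q.ratio_law" if ?sum
    unfolding P.ratio_law_def Q.ratio_law_def
  proof (rule distr_eq_of_char_eq)
    fix u :: "nat \<Rightarrow> real"
    \<comment> \<open>\<open>integral_max_sum\<close> concerns a negated sum, so the coefficients
      are negated too; \<open>?Z\<close> is the projection with coefficients
      \<open>u\<close>.\<close>
    let ?Z = "\<lambda>\<omega>. - (\<Sum>i<n. - u i * P.ratio i \<omega>)" and ?Z' = "\<lambda>\<omega>. - (\<Sum>i<n. - u i * Q.ratio i \<omega>)"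
    \<comment> \<open>The linear term of \<open>integral_max_sum\<close> involves the means. By
      positivity these are themselves absolute moments, obtained at unit coefficient
      vectors.\<close>
    have mean: "(\<integral>\<omega>. \<xi> i \<omega> \<partial>P) = (\<integral>\<omega>. \<xi>' i \<omega> \<partial>Q)" if "i < n" for i
    proof -
      have d: "(\<Sum>j<n. (if j = i then 1 else 0) * x j) = x i" for x :: "nat \<Rightarrow> real"
        using that by (subst sum.remove[of _ i]) auto
      have "(\<integral>\<omega>. \<bar>\<xi> i \<omega>\<bar> \<partial>P) = (\<integral>\<omega>. \<bar>\<xi>' i \<omega>\<bar> \<partial>Q)"
        using \<open>?sum\<close>[rule_format, of "\<lambda>j. if j = i then 1 else 0"] unfolding d .
      moreover have "(\<integral>\<omega>. \<bar>\<xi> i \<omega>\<bar> \<partial>P) = (\<integral>\<omega>. \<xi> i \<omega> \<partial>P)"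
        using P.pos[OF that] P.integrable[OF that] by (intro integral_cong_AE) (auto elim: eventually_mono)
      moreover have "(\<integral>\<omega>. \<bar>\<xi>' i \<omega>\<bar> \<partial>Q) = (\<integral>\<omega>. \<xi>' i \<omega> \<partial>Q)"
        using Q.pos[OF that] Q.integrable[OF that] by (intro integral_cong_AE) (auto elim: eventually_mono)
      ultimately show ?thesis by simp
    qed
    have iZ: "integrable P.tilted ?Z" "integrable Q.tilted ?Z'"
      by (intro Bochner_Integration.integrable_minus P.integrable_tilted_sum Q.integrable_tilted_sum)+
    have max_eq: "(\<integral>\<omega>. max c (?Z \<omega>) \<partial>P.tilted) = (\<integral>\<omega>. max c (?Z' \<omega>) \<partial>Q.tilted)" for c
      unfolding P.integral_max_sum Q.integral_max_sum
      using \<open>?sum\<close> mean by (simp del: fun_upd_apply)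
    \<comment> \<open>The Cramer-Wold argument: equal laws of all projections give equal joint
      characteristic functions.\<close>
    have "distr P.tilted borel ?Z = distr Q.tilted borel ?Z'"
    proof (rule cdf_unique)
      show "real_distribution (distr P.tilted borel ?Z)" by (rule TP.real_distribution_distr) (rule borel_measurable_integrable[OF iZ(1)])
      show "real_distribution (distr Q.tilted borel ?Z')" by (rule TQ.real_distribution_distr) (rule borel_measurable_integrable[OF iZ(2)])
      show "cdf (distr P.tilted borel ?Z) = cdf (distr Q.tilted borel ?Z')"
      proof
        fix c
        have "measure P.tilted {\<omega> \<in> space P.tilted. ?Z \<omega> \<le> c} = measure Q.tilted {\<omega> \<in> space Q.tilted. ?Z' \<omega> \<le> c}"
          by (rule cdf_eq_of_max_eq[where a="c - 1"])
             (use iZ max_eq TP.prob_space_axioms TQ.prob_space_axioms in auto)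
        then show "cdf (distr P.tilted borel ?Z) c = cdf (distr Q.tilted borel ?Z') c"
          unfolding cdf_def
          by (subst measure_distr[OF borel_measurable_integrable[OF iZ(1)]], simp,
              subst measure_distr[OF borel_measurable_integrable[OF iZ(2)]], simp)
             (simp add: vimage_def Int_def conj_commute)
      qed
    qed
    then have "(\<integral>x. iexp x \<partial>distr P.tilted borel ?Z) = (\<integral>x. iexp x \<partial>distr Q.tilted borel ?Z')"
      by simp
    then have "(\<integral>\<omega>. iexp (?Z \<omega>) \<partial>P.tilted) = (\<integral>\<omega>. iexp (?Z' \<omega>) \<partial>Q.tilted)"
      using iZ by (subst (asm) (1 2) integral_distr) auto
    then show "(\<integral>\<omega>. iexp (\<Sum>i<n. u i * P.ratio i \<omega>) \<partial>P.tilted) = (\<integral>\<omega>. iexp (\<Sum>i<n. u i * Q.ratio i \<omega>) \<partial>Q.tilted)"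
      by (simp add: sum_negf)
  qed (auto intro: TP.prob_space_axioms TQ.prob_space_axioms P.measurable_ratio_tilted Q.measurable_ratio_tilted)
  moreover have "P.ratio_law = Q.ratio_law" if ?max
    unfolding P.ratio_law_def Q.ratio_law_def
  proof (rule distr_eq_of_cdf_eq)
    fix y :: "nat \<Rightarrow> real"
    let ?S = "{\<omega> \<in> space P.tilted. \<forall>i<n. P.ratio i \<omega> \<le> y i}" and ?S' = "{\<omega> \<in> space Q.tilted. \<forall>i<n. Q.ratio i \<omega> \<le> y i}"
    show "measure P.tilted ?S = measure Q.tilted ?S'"
    proof (cases "\<forall>i<n. 0 < y i")
      case True
      \<comment> \<open>The event that all ratios stay below \<open>y\<close> is a bound 1 on one
        weighted maximum. The value 1 off range keeps \<open>a\<close> positive everywhere, as the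
        max hypothesis demands.\<close>
      define a where "a i = (if i < n then 1 / y i else 1)" for i
      have a: "0 < a i" for i using True by (simp add: a_def)
      have le: "(\<forall>i<n. x i \<le> y i) \<longleftrightarrow> Max ((\<lambda>i. a i * x i) ` {..<n}) \<le> 1" for x
      proof -
        have "Max ((\<lambda>i. a i * x i) ` {..<n}) \<le> 1 \<longleftrightarrow> (\<forall>i<n. a i * x i \<le> 1)"
          using P.n by (subst Max_le_iff) auto
        also have "\<dots> \<longleftrightarrow> (\<forall>i<n. x i \<le> y i)"
          using True by (auto simp: a_def divide_le_eq)
        finally show ?thesis ..
      qed
      show ?thesis
        unfolding le
      proof (rule cdf_eq_of_max_eq[where a=0])
        fix c :: real assume "0 < c"
        then show "(\<integral>\<omega>. max c (Max ((\<lambda>i. a i * P.ratio i \<omega>) ` {..<n})) \<partial>P.tilted) =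
            (\<integral>\<omega>. max c (Max ((\<lambda>i. a i * Q.ratio i \<omega>) ` {..<n})) \<partial>Q.tilted)"
          unfolding P.integral_max_Max Q.integral_max_Max using a
          by (intro \<open>?max\<close>[rule_format]) (auto simp: less_max_iff_disj)
      qed (auto intro: TP.prob_space_axioms TQ.prob_space_axioms P.integrable_tilted_Max Q.integrable_tilted_Max)
    next
      case False
      then obtain i where i: "i < n" "y i \<le> 0" by (auto simp: not_less)
      have all: "(\<forall>i<n. R i) \<longleftrightarrow> (\<forall>i\<in>{..<n}. R i)" for R by auto
      have S: "?S \<in> sets P.tilted" unfolding all
        by (intro sets.sets_Collect_finite_All borel_measurable_le P.measurable_ratio_tilted) auto
      have S': "?S' \<in> sets Q.tilted" unfolding all
        by (intro sets.sets_Collect_finite_All borel_measurable_le Q.measurable_ratio_tilted) auto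
      have "measure P.tilted ?S = 0"
        unfolding TP.prob_eq_0[OF S]
        using P.AE_ratio by eventually_elim (use i in \<open>fastforce simp: not_le\<close>)
      moreover have "measure Q.tilted ?S' = 0"
        unfolding TQ.prob_eq_0[OF S']
        using Q.AE_ratio by eventually_elim (use i in \<open>fastforce simp: not_le\<close>)
      ultimately show ?thesis by simp
    qed
  qed (auto intro: TP.prob_space_axioms TQ.prob_space_axioms P.measurable_ratio_tilted Q.measurable_ratio_tilted)
  ultimately have law: "P.ratio_law = Q.ratio_law" if "?sum \<or> ?max"
    using that by blast
  show ?thesis
  proof
    assume ?sum
    then show ?max
      unfolding P.Max_ratio_law[symmetric] Q.Max_ratio_law[symmetric] using law by simp
  next
    assume ?max
    then show ?sum
      unfolding P.abs_sum_ratio_law[symmetric] Q.abs_sum_ratio_law[symmetric] using law by simp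
  qed
qed

subsection \<open>LePage representations\<close>

text \<open>A finite intersection splits into an event of \<open>A\<close> and an event of
  \<open>B\<close>; their independence separates the two, and independence within each family
  finishes the factorisation.\<close>

lemma (in prob_space) indep_vars_case_sum:
  fixes X :: "'i \<Rightarrow> 'a \<Rightarrow> 'b" and Y :: "'j \<Rightarrow> 'a \<Rightarrow> 'b"
  assumes X: "indep_vars (\<lambda>_. S) X UNIV" and Y: "indep_vars (\<lambda>_. S) Y UNIV"
    and ind: "indep_set (sets A) (sets B)" and sp: "space A = space M" "space B = space M"
    and XA: "\<And>i. X i \<in> measurable A S" and YB: "\<And>j. Y j \<in> measurable B S"
  shows "indep_vars (\<lambda>_. S) (case_sum X Y) UNIV"
  unfolding indep_vars_def2
proof
  show rv: "\<forall>k\<in>UNIV. random_variable S (case_sum X Y k)"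
    using X Y by (auto simp: indep_vars_def split: sum.split)
  let ?F = "\<lambda>k. {case_sum X Y k -` E \<inter> space M | E. E \<in> sets S}"
  show "indep_sets ?F UNIV"
  proof (rule indep_setsI)
    show "?F k \<subseteq> events" for k
      using rv by (auto intro: measurable_sets)
    fix C :: "'i + 'j \<Rightarrow> 'a set" and J :: "('i + 'j) set"
    assume J: "J \<noteq> {}" "finite J" and C: "\<forall>k\<in>J. C k \<in> ?F k"
    define I1 where "I1 = Inl -` J"
    define I2 where "I2 = Inr -` J"
    have fin: "finite I1" "finite I2"
      using J by (auto simp: I1_def I2_def intro!: finite_vimageI)
    have J_eq: "J = Inl ` I1 \<union> Inr ` I2"
      by (auto simp: I1_def I2_def image_iff) (metis sum.exhaust)
    have C1: "C (Inl i) \<in> {X i -` E \<inter> space M | E. E \<in> sets S}" if "i \<in> I1" for i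
      using bspec[OF C, of "Inl i"] that by (simp add: I1_def)
    have C2: "C (Inr j) \<in> {Y j -` E \<inter> space M | E. E \<in> sets S}" if "j \<in> I2" for j
      using bspec[OF C, of "Inr j"] that by (simp add: I2_def)
    \<comment> \<open>The factor \<open>space M\<close> gives the correct event when no index of
      this side occurs, where the bare intersection would be \<open>UNIV\<close>.\<close>
    define S1 where "S1 = space M \<inter> (\<Inter>i\<in>I1. C (Inl i))"
    define S2 where "S2 = space M \<inter> (\<Inter>j\<in>I2. C (Inr j))"
    have p1: "prob S1 = (\<Prod>i\<in>I1. prob (C (Inl i)))"
    proof (cases "I1 = {}")
      case False
      then have "S1 = (\<Inter>i\<in>I1. C (Inl i))"
        using C1 by (fastforce simp: S1_def)
      then show ?thesis
        using indep_setsD[OF X[unfolded indep_vars_def2, THEN conjunct2], of I1 "\<lambda>i. C (Inl i)"] False fin C1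
        by auto
    qed (simp add: S1_def prob_space)
    have p2: "prob S2 = (\<Prod>j\<in>I2. prob (C (Inr j)))"
    proof (cases "I2 = {}")
      case False
      then have "S2 = (\<Inter>j\<in>I2. C (Inr j))"
        using C2 by (fastforce simp: S2_def)
      then show ?thesis
        using indep_setsD[OF Y[unfolded indep_vars_def2, THEN conjunct2], of I2 "\<lambda>j. C (Inr j)"] False fin C2
        by auto
    qed (simp add: S2_def prob_space)
    have "C (Inl i) \<in> sets A" if "i \<in> I1" for i
      using C1[OF that] measurable_sets[OF XA[of i]] sp by auto
    then have S1: "S1 \<in> sets A"
      unfolding S1_def using fin sp(1) sets.top[of A] by (cases "I1 = {}") (auto intro!: sets.Int sets.finite_INT)
    have "C (Inr j) \<in> sets B" if "j \<in> I2" for j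
      using C2[OF that] measurable_sets[OF YB[of j]] sp by auto
    then have S2: "S2 \<in> sets B"
      unfolding S2_def using fin sp(2) sets.top[of B] by (cases "I2 = {}") (auto intro!: sets.Int sets.finite_INT)
    have "(\<Inter>k\<in>J. C k) = S1 \<inter> S2"
    proof -
      have "C k \<subseteq> space M" if "k \<in> J" for k using C that by blast
      then show ?thesis using J(1) unfolding S1_def S2_def J_eq by blast
    qed
    then have "prob (\<Inter>k\<in>J. C k) = prob S1 * prob S2"
      using indep_setD[OF ind S1 S2] by simp
    also have "\<dots> = (\<Prod>k\<in>J. prob (C k))"
      unfolding p1 p2 J_eq using fin
      by (subst prod.union_disjoint) (auto simp: prod.reindex)
    finally show "prob (\<Inter>k\<in>J. C k) = (\<Prod>k\<in>J. prob (C k))" .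
  qed
qed

text \<open>Closure under addition is what the lattice and the full space share; it keeps the
  shifted times \<open>t i + s\<close> inside \<open>T\<close>.\<close>

locale lepage = N: prob_space N + M: prob_space M
  for N :: "'w measure" and M :: "'v measure" +
  fixes T :: "'t :: plus set" and \<xi> :: "'t \<Rightarrow> 'w \<Rightarrow> real"
    and \<zeta> :: "nat \<Rightarrow> 'v \<Rightarrow> real" and \<Xi> :: "nat \<Rightarrow> 't \<Rightarrow> 'v \<Rightarrow> real"
  assumes add_T: "\<And>s t. s \<in> T \<Longrightarrow> t \<in> T \<Longrightarrow> s + t \<in> T"
    and integrable: "\<And>t. t \<in> T \<Longrightarrow> integrable N (\<xi> t)"
    and exp_\<zeta>: "iid_std_exponential M \<zeta>" and copies: "iid_copies T M \<Xi> N \<xi>"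
    and indep_\<Xi>: "indep_seq_processes T M (arrival \<zeta>) \<Xi>"
begin

abbreviation X :: "'t \<Rightarrow> 'v \<Rightarrow> real" where
  "X \<equiv> lepage_series (arrival \<zeta>) \<Xi>"

abbreviation Y :: "'t \<Rightarrow> 'v \<Rightarrow> real" where
  "Y \<equiv> lepage_max (arrival \<zeta>) \<Xi>"

lemma measurable_\<xi>: "t \<in> T \<Longrightarrow> \<xi> t \<in> borel_measurable N"
  using integrable by auto

lemma measurable_path: "sample_path T (\<Xi> k) \<in> measurable M (\<Pi>\<^sub>M t\<in>T. borel)"
  using copies by (auto simp: iid_copies_def M.indep_vars_def)

lemma measurable_\<Xi>: "t \<in> T \<Longrightarrow> \<Xi> k t \<in> borel_measurable M"
proof -
  assume t: "t \<in> T"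
  have "(\<lambda>\<omega>. sample_path T (\<Xi> k) \<omega> t) \<in> borel_measurable M"
    by (rule measurable_compose[OF measurable_path measurable_component_singleton[OF t]])
  then show ?thesis using t by (simp add: sample_path_def)
qed

text \<open>A measurable function of finitely many values of the k-th copy is again a legitimate
  mark. Linear forms are used for the series, weighted maxima for the max-stable process, and so
  vectors reduce to real marks.\<close>

lemma marked_arrivals:
  assumes t: "t \<in> {..<n::nat} \<rightarrow> T" and F: "F \<in> borel_measurable (\<Pi>\<^sub>M i\<in>{..<n}. (borel :: real measure))"
  shows "marked_arrivals M \<zeta> (\<lambda>k \<omega>. F (\<lambda>i\<in>{..<n}. \<Xi> k (t i) \<omega>)) (distr N borel (\<lambda>\<omega>. F (\<lambda>i\<in>{..<n}. \<xi> (t i) \<omega>)))"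
proof (intro marked_arrivals.intro marked_arrivals_axioms.intro M.prob_space_axioms)
  let ?\<eta> = "\<lambda>k \<omega>. F (\<lambda>i\<in>{..<n}. \<Xi> k (t i) \<omega>)"
  let ?g = "\<lambda>x. F (\<lambda>i\<in>{..<n}. x (t i))"
  show "distributed M lborel (\<zeta> k) (exponential_density 1)" for k
    using exp_\<zeta> by (simp add: iid_std_exponential_def)
  have g: "?g \<in> borel_measurable (\<Pi>\<^sub>M t\<in>T. borel)"
    using t by (intro measurable_compose[OF measurable_restrict F] measurable_component_singleton) auto
  have eta: "?\<eta> k = (\<lambda>\<omega>. ?g (sample_path T (\<Xi> k) \<omega>))" for k
    using t by (intro ext arg_cong[where f=F] restrict_ext) (auto simp: sample_path_def)
  have vX: "(\<lambda>\<omega>. \<lambda>i\<in>{..<n}. \<Xi> k (t i) \<omega>) \<in> measurable M (\<Pi>\<^sub>M i\<in>{..<n}. borel)" for k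
    using t by (intro measurable_restrict measurable_\<Xi>) auto
  have v\<xi>: "(\<lambda>\<omega>. \<lambda>i\<in>{..<n}. \<xi> (t i) \<omega>) \<in> measurable N (\<Pi>\<^sub>M i\<in>{..<n}. borel)"
    using t by (intro measurable_restrict measurable_\<xi>) auto
  show "distr M borel (?\<eta> k) = distr N borel (\<lambda>\<omega>. F (\<lambda>i\<in>{..<n}. \<xi> (t i) \<omega>))" for k
  proof -
    have "distr M (\<Pi>\<^sub>M i\<in>{..<n}. borel) (\<lambda>\<omega>. \<lambda>i\<in>{..<n}. \<Xi> k (t i) \<omega>) =
        distr N (\<Pi>\<^sub>M i\<in>{..<n}. borel) (\<lambda>\<omega>. \<lambda>i\<in>{..<n}. \<xi> (t i) \<omega>)"
      using copies t by (auto simp: iid_copies_def same_fdd_def)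
    from arg_cong[OF this, of "\<lambda>\<mu>. distr \<mu> borel F"] show ?thesis
      by (simp add: distr_distr[OF F vX] distr_distr[OF F v\<xi>] comp_def)
  qed
  let ?A = "vimage_algebra (space M) (\<lambda>\<omega> k. arrival \<zeta> k \<omega>) (\<Pi>\<^sub>M k\<in>UNIV. borel)"
  let ?B = "vimage_algebra (space M) (\<lambda>\<omega> k. sample_path T (\<Xi> k) \<omega>) (\<Pi>\<^sub>M k\<in>UNIV. \<Pi>\<^sub>M t\<in>T. borel)"
  have arr: "arrival \<zeta> k \<in> borel_measurable ?A" for k
    by (rule measurable_compose[OF measurable_vimage_algebra1 measurable_component_singleton[OF UNIV_I[of k]]])
       (auto simp: space_PiM)
  show "M.indep_vars (\<lambda>_. borel) (case_sum \<zeta> ?\<eta>) UNIV"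
  proof (rule M.indep_vars_case_sum[where A="?A" and B="?B"])
    show "M.indep_vars (\<lambda>_. borel) \<zeta> UNIV"
      using exp_\<zeta> by (simp add: iid_std_exponential_def)
    show "M.indep_vars (\<lambda>_. borel) ?\<eta> UNIV"
      unfolding eta using copies by (intro M.indep_vars_compose2[OF _ g]) (auto simp: iid_copies_def)
    show "M.indep_set (sets ?A) (sets ?B)"
      using indep_\<Xi> by (simp add: indep_seq_processes_def)
    \<comment> \<open>Independence is assumed for the arrival times; the gaps inherit it as
      differences of consecutive arrivals, with gap 0 equal to arrival 0.\<close>
    show "\<zeta> k \<in> borel_measurable ?A" for k
    proof (cases k)
      case 0
      then have "\<zeta> k = arrival \<zeta> 0" by (simp add: arrival_def fun_eq_iff)
      then show ?thesis using arr by simp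
    next
      case (Suc j)
      then have "\<zeta> k = (\<lambda>\<omega>. arrival \<zeta> k \<omega> - arrival \<zeta> j \<omega>)" by (simp add: arrival_def fun_eq_iff)
      then show ?thesis using arr by simp
    qed
    show "?\<eta> k \<in> borel_measurable ?B" for k
      unfolding eta
    proof (rule measurable_compose[OF _ g])
      show "sample_path T (\<Xi> k) \<in> measurable ?B (\<Pi>\<^sub>M t\<in>T. borel)"
        by (rule measurable_compose[OF measurable_vimage_algebra1 measurable_component_singleton[OF UNIV_I[of k]]])
           (auto simp: space_PiM sample_path_def)
    qed
  qed simp_all
qed

lemma marked_arrivals_single:
  assumes t: "t \<in> T"
  shows "marked_arrivals M \<zeta> (\<lambda>k. \<Xi> k t) (distr N borel (\<xi> t))"
  using marked_arrivals[of "\<lambda>_. t" 1 "\<lambda>x. x 0"] t by simp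

lemma integrable_distr_\<xi>: "t \<in> T \<Longrightarrow> integrable (distr N borel (\<xi> t)) (\<lambda>y. y)"
  using integrable by (subst integrable_distr_eq) (auto intro: measurable_\<xi>)

lemma measurable_series: "t \<in> T \<Longrightarrow> X t \<in> borel_measurable M"
proof -
  assume t: "t \<in> T"
  interpret marked_arrivals M \<zeta> "\<lambda>k. \<Xi> k t" "distr N borel (\<xi> t)"
    by (rule marked_arrivals_single[OF t])
  show ?thesis unfolding lepage_series_def by measurable
qed

lemma symmetric_linear:
  assumes sym: "symmetric_process T N \<xi>" and t: "t \<in> {..<n::nat} \<rightarrow> T"
  shows "distr (distr N borel (\<lambda>\<omega>. \<Sum>i<n. u i * \<xi> (t i) \<omega>)) borel uminus = distr N borel (\<lambda>\<omega>. \<Sum>i<n. u i * \<xi> (t i) \<omega>)"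
proof -
  let ?F = "\<lambda>x. \<Sum>i<n. u i * x i :: real"
  have F: "?F \<in> borel_measurable (\<Pi>\<^sub>M i\<in>{..<n}. borel)" by measurable
  have v: "(\<lambda>\<omega>. \<lambda>i\<in>{..<n}. \<xi> (t i) \<omega>) \<in> measurable N (\<Pi>\<^sub>M i\<in>{..<n}. borel)"
    using t by (intro measurable_restrict measurable_\<xi>) auto
  have v': "(\<lambda>\<omega>. \<lambda>i\<in>{..<n}. - \<xi> (t i) \<omega>) \<in> measurable N (\<Pi>\<^sub>M i\<in>{..<n}. borel)"
    using t by (intro measurable_restrict borel_measurable_uminus measurable_\<xi>) auto
  have m: "(\<lambda>\<omega>. \<Sum>i<n. u i * \<xi> (t i) \<omega>) \<in> borel_measurable N"
    using t by (intro borel_measurable_sum borel_measurable_times measurable_\<xi>) auto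
  have "distr N (\<Pi>\<^sub>M i\<in>{..<n}. borel) (\<lambda>\<omega>. \<lambda>i\<in>{..<n}. \<xi> (t i) \<omega>) =
      distr N (\<Pi>\<^sub>M i\<in>{..<n}. borel) (\<lambda>\<omega>. \<lambda>i\<in>{..<n}. - \<xi> (t i) \<omega>)"
    using sym t by (auto simp: symmetric_process_def same_fdd_def)
  from arg_cong[OF this, of "\<lambda>\<mu>. distr \<mu> borel ?F"]
  have "distr N borel (\<lambda>\<omega>. \<Sum>i<n. u i * \<xi> (t i) \<omega>) = distr N borel (\<lambda>\<omega>. - (\<Sum>i<n. u i * \<xi> (t i) \<omega>))"
    by (simp add: distr_distr[OF F v] distr_distr[OF F v'] comp_def sum_negf)
  also have "\<dots> = distr (distr N borel (\<lambda>\<omega>. \<Sum>i<n. u i * \<xi> (t i) \<omega>)) borel uminus"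
    by (subst distr_distr[OF _ m]) (auto simp: comp_def)
  finally show ?thesis ..
qed

lemma AE_series_summable:
  assumes sym: "symmetric_process T N \<xi>" and t: "t \<in> T"
  shows "AE \<omega> in M. summable (\<lambda>k. inverse (arrival \<zeta> k \<omega>) * \<Xi> k t \<omega>)"
proof -
  interpret marked_arrivals M \<zeta> "\<lambda>k. \<Xi> k t" "distr N borel (\<xi> t)"
    by (rule marked_arrivals_single[OF t])
  show ?thesis
    using symmetric_linear[OF sym, of "\<lambda>_. t" 1 "\<lambda>_. 1"] t
    by (intro AE_summable_marks integrable_distr_\<xi>) auto
qed

text \<open>A linear combination of values of the series is itself such a series, with the linear
  combination as mark. The interchange of sums is legitimate almost surely because each component
  series converges.\<close>

lemma char_series:
  assumes sym: "symmetric_process T N \<xi>" and t: "t \<in> {..<n::nat} \<rightarrow> T"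
  shows "(\<integral>\<omega>. iexp (\<Sum>i<n. u i * X (t i) \<omega>) \<partial>M) =
    of_real (exp (- (enn2real (kernel_mass iexp) * (\<integral>\<omega>. \<bar>\<Sum>i<n. u i * \<xi> (t i) \<omega>\<bar> \<partial>N))))"
proof -
  have F: "(\<lambda>x. \<Sum>i<n. u i * x i :: real) \<in> borel_measurable (\<Pi>\<^sub>M i\<in>{..<n}. borel)" by measurable
  let ?\<eta> = "\<lambda>k \<omega>. \<Sum>i<n. u i * \<Xi> k (t i) \<omega>" and ?D = "distr N borel (\<lambda>\<omega>. \<Sum>i<n. u i * \<xi> (t i) \<omega>)"
  interpret A: marked_arrivals M \<zeta> ?\<eta> ?D
    using marked_arrivals[OF t F] by simp
  have int: "integrable N (\<lambda>\<omega>. \<Sum>i<n. u i * \<xi> (t i) \<omega>)"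
    using t by (intro Bochner_Integration.integrable_sum integrable_mult_right integrable) auto
  then have m: "(\<lambda>\<omega>. \<Sum>i<n. u i * \<xi> (t i) \<omega>) \<in> borel_measurable N" by simp
  have intD: "integrable ?D (\<lambda>y. y)"
    using int by (subst integrable_distr_eq[OF m]) auto
  have mX: "(\<lambda>\<omega>. \<Sum>i<n. u i * X (t i) \<omega>) \<in> borel_measurable M"
    using t by (intro borel_measurable_sum borel_measurable_times measurable_series) auto
  have "AE \<omega> in M. \<forall>i<n. summable (\<lambda>k. inverse (arrival \<zeta> k \<omega>) * \<Xi> k (t i) \<omega>)"
    using t by (subst AE_all_countable) (auto intro!: AE_impI AE_series_summable[OF sym])
  then have eq: "AE \<omega> in M. (\<Sum>i<n. u i * X (t i) \<omega>) = (\<Sum>k. inverse (arrival \<zeta> k \<omega>) * ?\<eta> k \<omega>)"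
  proof eventually_elim
    case (elim \<omega>)
    have "(\<Sum>i<n. u i * X (t i) \<omega>) = (\<Sum>i<n. \<Sum>k. u i * (inverse (arrival \<zeta> k \<omega>) * \<Xi> k (t i) \<omega>))"
      using elim by (intro sum.cong) (auto simp: lepage_series_def suminf_mult)
    also have "\<dots> = (\<Sum>k. \<Sum>i<n. u i * (inverse (arrival \<zeta> k \<omega>) * \<Xi> k (t i) \<omega>))"
      using elim by (intro suminf_sum[symmetric] summable_mult) auto
    also have "\<dots> = (\<Sum>k. inverse (arrival \<zeta> k \<omega>) * ?\<eta> k \<omega>)"
      by (simp add: sum_distrib_left mult.left_commute)
    finally show ?case .
  qed
  have "(\<integral>\<omega>. iexp (\<Sum>i<n. u i * X (t i) \<omega>) \<partial>M) = (\<integral>\<omega>. iexp (\<Sum>k. inverse (arrival \<zeta> k \<omega>) * ?\<eta> k \<omega>) \<partial>M)"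
  proof (rule integral_cong_AE)
    show "(\<lambda>\<omega>. iexp (\<Sum>i<n. u i * X (t i) \<omega>)) \<in> borel_measurable M"
      by (rule measurable_compose[OF mX]) simp
    have "(\<lambda>\<omega>. \<Sum>k. inverse (arrival \<zeta> k \<omega>) * ?\<eta> k \<omega>) \<in> borel_measurable M"
      by (intro borel_measurable_suminf borel_measurable_times borel_measurable_inverse A.measurable_arrival A.measurable_eta)
    then show "(\<lambda>\<omega>. iexp (\<Sum>k. inverse (arrival \<zeta> k \<omega>) * ?\<eta> k \<omega>)) \<in> borel_measurable M"
      by (rule measurable_compose) simp
    show "AE \<omega> in M. iexp (\<Sum>i<n. u i * X (t i) \<omega>) = iexp (\<Sum>k. inverse (arrival \<zeta> k \<omega>) * ?\<eta> k \<omega>)"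
      using eq by eventually_elim (simp only:)
  qed
  also have "\<dots> = of_real (exp (- (enn2real (kernel_mass iexp) * (\<integral>y. \<bar>y\<bar> \<partial>?D))))"
    by (rule A.char_lepage_series[OF intD symmetric_linear[OF sym t]])
  also have "(\<integral>y. \<bar>y\<bar> \<partial>?D) = (\<integral>\<omega>. \<bar>\<Sum>i<n. u i * \<xi> (t i) \<omega>\<bar> \<partial>N)"
    by (rule integral_distr[OF m]) simp
  finally show ?thesis .
qed

lemma stationary_series_iff:
  assumes sym: "symmetric_process T N \<xi>"
  shows "stationary T M X \<longleftrightarrow> zonoid_stationary T N \<xi>"
proof
  assume stat: "stationary T M X"
  show "zonoid_stationary T N \<xi>"
    unfolding zonoid_stationary_def zonoid_equiv_def zonoid_equiv_vec_def
  proof (intro ballI allI impI conjI)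
    fix s and n :: nat and t and u :: "nat \<Rightarrow> real"
    assume s: "s \<in> T" and t: "t \<in> {..<n} \<rightarrow> T"
    then have ts: "(\<lambda>i. t i + s) \<in> {..<n} \<rightarrow> T" using add_T by auto
    show "integrable N (\<xi> (t i))" if "i < n" for i using t that by (auto intro: integrable)
    show "integrable N (\<xi> (t i + s))" if "i < n" for i using ts that by (auto intro: integrable)
    have g: "(\<lambda>x. iexp (\<Sum>i<n. u i * x i)) \<in> borel_measurable (\<Pi>\<^sub>M i\<in>{..<n}. (borel :: real measure))"
      by measurable
    have v: "(\<lambda>\<omega>. \<lambda>i\<in>{..<n}. X (t i) \<omega>) \<in> measurable M (\<Pi>\<^sub>M i\<in>{..<n}. borel)"
      "(\<lambda>\<omega>. \<lambda>i\<in>{..<n}. X (t i + s) \<omega>) \<in> measurable M (\<Pi>\<^sub>M i\<in>{..<n}. borel)"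
      using t ts by (intro measurable_restrict measurable_series; auto)+
    have "distr M (\<Pi>\<^sub>M i\<in>{..<n}. borel) (\<lambda>\<omega>. \<lambda>i\<in>{..<n}. X (t i) \<omega>) =
        distr M (\<Pi>\<^sub>M i\<in>{..<n}. borel) (\<lambda>\<omega>. \<lambda>i\<in>{..<n}. X (t i + s) \<omega>)"
      using stat s t by (auto simp: stationary_def same_fdd_def)
    from arg_cong[OF this, of "\<lambda>\<mu>. \<integral>x. iexp (\<Sum>i<n. u i * x i) \<partial>\<mu>"]
    have "(\<integral>\<omega>. iexp (\<Sum>i<n. u i * X (t i) \<omega>) \<partial>M) = (\<integral>\<omega>. iexp (\<Sum>i<n. u i * X (t i + s) \<omega>) \<partial>M)"
      unfolding integral_distr[OF v(1) g] integral_distr[OF v(2) g] by simp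
    then show "(\<integral>\<omega>. \<bar>\<Sum>i<n. u i * \<xi> (t i) \<omega>\<bar> \<partial>N) = (\<integral>\<omega>. \<bar>\<Sum>i<n. u i * \<xi> (t i + s) \<omega>\<bar> \<partial>N)"
      unfolding char_series[OF sym t] char_series[OF sym ts] of_real_eq_iff exp_inj_iff
      using kernel_mass_iexp_pos by simp
  qed
next
  assume zon: "zonoid_stationary T N \<xi>"
  show "stationary T M X"
    unfolding stationary_def same_fdd_def
  proof (intro ballI allI)
    fix s and n :: nat and t
    assume s: "s \<in> T" and t: "t \<in> {..<n} \<rightarrow> T"
    then have ts: "(\<lambda>i. t i + s) \<in> {..<n} \<rightarrow> T" using add_T by auto
    show "distr M (\<Pi>\<^sub>M i\<in>{..<n}. borel) (\<lambda>\<omega>. \<lambda>i\<in>{..<n}. X (t i) \<omega>) =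
        distr M (\<Pi>\<^sub>M i\<in>{..<n}. borel) (\<lambda>\<omega>. \<lambda>i\<in>{..<n}. X (t i + s) \<omega>)"
    proof (rule distr_eq_of_char_eq)
      fix u :: "nat \<Rightarrow> real"
      have "(\<integral>\<omega>. \<bar>\<Sum>i<n. u i * \<xi> (t i) \<omega>\<bar> \<partial>N) = (\<integral>\<omega>. \<bar>\<Sum>i<n. u i * \<xi> (t i + s) \<omega>\<bar> \<partial>N)"
      \<comment> \<open>\<open>same_fdd\<close> includes the empty tuple, zonoid equivalence starts
        at length 1.\<close>
      proof (cases "n = 0")
        case False
        then have "1 \<le> n" by simp
        then show ?thesis
          using zon s t unfolding zonoid_stationary_def zonoid_equiv_def zonoid_equiv_vec_def by blast
      qed simp
      then show "(\<integral>\<omega>. iexp (\<Sum>i<n. u i * X (t i) \<omega>) \<partial>M) = (\<integral>\<omega>. iexp (\<Sum>i<n. u i * X (t i + s) \<omega>) \<partial>M)"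
        unfolding char_series[OF sym t] char_series[OF sym ts] by simp
    qed (use t ts in \<open>auto intro: M.prob_space_axioms measurable_series\<close>)
  qed
qed

text \<open>A real-valued \<open>SUP\<close> is meaningful only for bounded families. Here all but
  finitely many terms are at most 1.\<close>

lemma AE_bdd_above:
  assumes t: "t \<in> T"
  shows "AE \<omega> in M. bdd_above (range (\<lambda>k. inverse (arrival \<zeta> k \<omega>) * \<Xi> k t \<omega>))"
proof -
  interpret marked_arrivals M \<zeta> "\<lambda>k. \<Xi> k t" "distr N borel (\<xi> t)"
    by (rule marked_arrivals_single[OF t])
  show ?thesis
    using AE_eventually_mark_le[OF integrable_distr_\<xi>[OF t] zero_less_one] AE_arrival_pos
  proof eventually_elim
    case (elim \<omega>)
    have "\<forall>\<^sub>F k in sequentially. inverse (arrival \<zeta> k \<omega>) * \<Xi> k t \<omega> \<le> 1"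
      using elim(1)
    proof (rule eventually_mono)
      fix k assume "\<bar>\<Xi> k t \<omega>\<bar> \<le> 1 * arrival \<zeta> k \<omega>"
      then show "inverse (arrival \<zeta> k \<omega>) * \<Xi> k t \<omega> \<le> 1"
        using elim(2)[rule_format, of k] by (auto simp: field_simps)
    qed
    then obtain n where n: "\<And>k. n \<le> k \<Longrightarrow> inverse (arrival \<zeta> k \<omega>) * \<Xi> k t \<omega> \<le> 1"
      by (auto simp: eventually_sequentially)
    let ?f = "\<lambda>k. inverse (arrival \<zeta> k \<omega>) * \<Xi> k t \<omega>"
    have "range ?f \<subseteq> ?f ` {..<n} \<union> ?f ` {n..}"
      unfolding image_Un[symmetric] by (intro image_mono) auto
    moreover have "bdd_above (?f ` {n..})" using n by (auto intro!: bdd_aboveI[of _ 1])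
    ultimately show ?case by (meson bdd_above_Un bdd_above_finite bdd_above_mono finite_imageI finite_lessThan)
  qed
qed

text \<open>The values of \<open>Y\<close> at all times stay below \<open>1 / a i\<close> exactly if
  every mark, the maximum of \<open>a i * \<Xi> k (t i)\<close> over \<open>i\<close>, is at most
  its arrival time. This holds almost surely, where arrivals are positive and suprema finite, and
  reduces the joint distribution function to \<open>prob_marks_le\<close>.\<close>

lemma prob_max_le:
  fixes n :: nat
  assumes pos: "positive_process T N \<xi>" and mY: "\<And>t. t \<in> T \<Longrightarrow> Y t \<in> borel_measurable M"
    and t: "t \<in> {..<n} \<rightarrow> T" and n: "0 < n" and a: "\<And>i. 0 < a i"
  shows "M.prob {\<omega> \<in> space M. \<forall>i<n. Y (t i) \<omega> \<le> 1 / a i} = exp (- (\<integral>\<omega>. Max ((\<lambda>i. a i * \<xi> (t i) \<omega>) ` {..<n}) \<partial>N))"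
proof -
  let ?F = "\<lambda>x. Max ((\<lambda>i. a i * x i :: real) ` {..<n})"
  have F: "?F \<in> borel_measurable (\<Pi>\<^sub>M i\<in>{..<n}. borel)"
    by (intro borel_measurable_Max borel_measurable_times) simp_all
  have int: "integrable N (\<lambda>\<omega>. Max ((\<lambda>i. a i * \<xi> (t i) \<omega>) ` {..<n}))"
    using t by (intro integrable_Max_lessThan n integrable_mult_right integrable) auto
  then have m: "(\<lambda>\<omega>. Max ((\<lambda>i. a i * \<xi> (t i) \<omega>) ` {..<n})) \<in> borel_measurable N" by simp
  let ?D = "distr N borel (\<lambda>\<omega>. Max ((\<lambda>i. a i * \<xi> (t i) \<omega>) ` {..<n}))"
  let ?\<eta> = "\<lambda>k \<omega>. Max ((\<lambda>i. a i * \<Xi> k (t i) \<omega>) ` {..<n})"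
  have "(\<lambda>i. a i * (\<lambda>i\<in>{..<n}. x i) i) ` {..<n} = (\<lambda>i. a i * x i) ` {..<n}" for x :: "nat \<Rightarrow> real"
    by (rule image_cong) auto
  then interpret A: marked_arrivals M \<zeta> ?\<eta> ?D
    using marked_arrivals[OF t F] by simp
  have intD: "integrable ?D (\<lambda>y. y)"
    using int by (subst integrable_distr_eq[OF m]) auto
  have "AE \<omega> in N. \<forall>i<n. 0 < \<xi> (t i) \<omega>"
    using pos t by (subst AE_all_countable) (auto intro!: AE_impI simp: positive_process_def)
  then have "AE \<omega> in N. 0 \<le> Max ((\<lambda>i. a i * \<xi> (t i) \<omega>) ` {..<n})"
  proof eventually_elim
    case (elim \<omega>)
    have "0 \<le> a 0 * \<xi> (t 0) \<omega>" using elim n a[of 0] by (simp add: less_imp_le)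
    also have "\<dots> \<le> Max ((\<lambda>i. a i * \<xi> (t i) \<omega>) ` {..<n})" using n by (intro Max_ge) auto
    finally show ?case .
  qed
  then have nonneg: "AE y in ?D. 0 \<le> y"
    by (subst AE_distr_iff[OF m]) auto
  have bdd: "AE \<omega> in M. \<forall>i<n. bdd_above (range (\<lambda>k. inverse (arrival \<zeta> k \<omega>) * \<Xi> k (t i) \<omega>))"
    using t by (subst AE_all_countable) (auto intro!: AE_impI AE_bdd_above)
  have "M.prob {\<omega> \<in> space M. \<forall>i<n. Y (t i) \<omega> \<le> 1 / a i} = M.prob {\<omega> \<in> space M. \<forall>k. ?\<eta> k \<omega> \<le> arrival \<zeta> k \<omega>}"
  proof (rule M.finite_measure_eq_AE)
    show "AE \<omega> in M. (\<omega> \<in> {\<omega> \<in> space M. \<forall>i<n. Y (t i) \<omega> \<le> 1 / a i}) =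
        (\<omega> \<in> {\<omega> \<in> space M. \<forall>k. ?\<eta> k \<omega> \<le> arrival \<zeta> k \<omega>})"
      using bdd A.AE_arrival_pos
    proof eventually_elim
      case (elim \<omega>)
      have "Y (t i) \<omega> \<le> 1 / a i \<longleftrightarrow> (\<forall>k. a i * \<Xi> k (t i) \<omega> \<le> arrival \<zeta> k \<omega>)" if "i < n" for i
      proof -
        have "Y (t i) \<omega> \<le> 1 / a i \<longleftrightarrow> (\<forall>k. inverse (arrival \<zeta> k \<omega>) * \<Xi> k (t i) \<omega> \<le> 1 / a i)"
          unfolding lepage_max_def using elim(1) that by (subst cSUP_le_iff) auto
        also have "\<dots> \<longleftrightarrow> (\<forall>k. a i * \<Xi> k (t i) \<omega> \<le> arrival \<zeta> k \<omega>)"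
        proof (intro all_cong1)
          fix k
          show "inverse (arrival \<zeta> k \<omega>) * \<Xi> k (t i) \<omega> \<le> 1 / a i \<longleftrightarrow> a i * \<Xi> k (t i) \<omega> \<le> arrival \<zeta> k \<omega>"
            using elim(2)[rule_format, of k] a[of i] by (simp add: field_simps)
        qed
        finally show ?thesis .
      qed
      moreover have "?\<eta> k \<omega> \<le> arrival \<zeta> k \<omega> \<longleftrightarrow> (\<forall>i<n. a i * \<Xi> k (t i) \<omega> \<le> arrival \<zeta> k \<omega>)" for k
        using n by (subst Max_le_iff) auto
      ultimately show ?case by auto
    qed
    have all: "(\<forall>i<n. R i) \<longleftrightarrow> (\<forall>i\<in>{..<n}. R i)" for R by auto
    show "{\<omega> \<in> space M. \<forall>i<n. Y (t i) \<omega> \<le> 1 / a i} \<in> M.events"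
      unfolding all using t by (intro sets.sets_Collect_finite_All borel_measurable_le mY) auto
    show "{\<omega> \<in> space M. \<forall>k. ?\<eta> k \<omega> \<le> arrival \<zeta> k \<omega>} \<in> M.events"
      by (intro sets.sets_Collect_countable_All borel_measurable_le A.measurable_eta A.measurable_arrival)
  qed
  also have "\<dots> = exp (- (\<integral>y. y \<partial>?D))"
    by (rule A.prob_marks_le[OF intD nonneg])
  also have "(\<integral>y. y \<partial>?D) = (\<integral>\<omega>. Max ((\<lambda>i. a i * \<xi> (t i) \<omega>) ` {..<n}) \<partial>N)"
    by (rule integral_distr[OF m]) simp
  finally show ?thesis .
qed

text \<open>Already the term \<open>k = 0\<close> is positive. This settles nonpositive thresholds,
  which lie outside the range of \<open>prob_max_le\<close>.\<close>

lemma AE_max_pos: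
  assumes pos: "positive_process T N \<xi>" and t: "t \<in> T"
  shows "AE \<omega> in M. 0 < Y t \<omega>"
proof -
  interpret marked_arrivals M \<zeta> "\<lambda>k. \<Xi> k t" "distr N borel (\<xi> t)"
    by (rule marked_arrivals_single[OF t])
  have "AE y in distr N borel (\<xi> t). 0 < y"
    using pos t by (subst AE_distr_iff[OF measurable_\<xi>[OF t]]) (auto simp: positive_process_def)
  then have "AE \<omega> in M. 0 < \<Xi> 0 t \<omega>"
    unfolding law[of 0, symmetric] by (subst (asm) AE_distr_iff) (auto intro: measurable_\<Xi>[OF t])
  then show ?thesis
    using AE_bdd_above[OF t] AE_arrival_pos
  proof eventually_elim
    case (elim \<omega>)
    have "0 < inverse (arrival \<zeta> 0 \<omega>) * \<Xi> 0 t \<omega>" using elim by simp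
    also have "\<dots> \<le> Y t \<omega>"
      unfolding lepage_max_def using elim(2) by (intro cSUP_upper) auto
    finally show ?case .
  qed
qed

lemma stationary_max_iff:
  assumes pos: "positive_process T N \<xi>" and frechet: "\<And>t. t \<in> T \<Longrightarrow> unit_frechet M (Y t)"
  shows "stationary T M Y \<longleftrightarrow> zonoid_stationary T N \<xi>"
proof -
  \<comment> \<open>Measurability is taken from the Frechet condition, since \<open>SUP\<close> has
    unspecified values on the null set of unbounded families.\<close>
  have mY: "Y t \<in> borel_measurable M" if "t \<in> T" for t
    using frechet[OF that] by (simp add: unit_frechet_def)
  \<comment> \<open>Comparing the distribution function of one marginal at 1,
    \<open>exp (- 1)\<close>, with the general formula gives mean 1, so any time may play the role
    of coordinate 0.\<close>
  have unit: "(\<integral>\<omega>. \<xi> t \<omega> \<partial>N) = 1" if t: "t \<in> T" for t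
  proof -
    have "exp (- 1 / 1) = cdf (distr M borel (Y t)) 1"
      using frechet[OF t] by (simp add: unit_frechet_def)
    also have "\<dots> = M.prob {\<omega> \<in> space M. Y t \<omega> \<le> 1}"
      by (simp add: cdf_def measure_distr[OF mY[OF t]] vimage_def Int_def conj_commute)
    also have "\<dots> = exp (- (\<integral>\<omega>. \<xi> t \<omega> \<partial>N))"
      using prob_max_le[OF pos mY, of "\<lambda>_. t" 1 "\<lambda>_. 1"] t by (simp add: lessThan_Suc)
    finally show ?thesis by simp
  qed
  have vec: "positive_vector N n (\<lambda>i. \<xi> (t i))" if "0 < n" "t \<in> {..<n} \<rightarrow> T" for n t
    using that pos
    by (intro positive_vector.intro positive_vector_axioms.intro N.prob_space_axioms)
       (auto simp: positive_process_def intro!: integrable unit)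
  show ?thesis
  proof
    assume stat: "stationary T M Y"
    show "zonoid_stationary T N \<xi>"
      unfolding zonoid_stationary_def zonoid_equiv_def zonoid_equiv_vec_def
    proof (intro ballI allI impI conjI)
      fix s and n :: nat and t and u :: "nat \<Rightarrow> real"
      assume s: "s \<in> T" and t: "t \<in> {..<n} \<rightarrow> T" and n: "1 \<le> n"
      then have ts: "(\<lambda>i. t i + s) \<in> {..<n} \<rightarrow> T" using add_T by auto
      have n0: "0 < n" using n by simp
      show "integrable N (\<xi> (t i))" if "i < n" for i using t that by (auto intro: integrable)
      show "integrable N (\<xi> (t i + s))" if "i < n" for i using ts that by (auto intro: integrable)
      have v: "(\<lambda>\<omega>. \<lambda>i\<in>{..<n}. Y (t i) \<omega>) \<in> measurable M (\<Pi>\<^sub>M i\<in>{..<n}. borel)"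
        "(\<lambda>\<omega>. \<lambda>i\<in>{..<n}. Y (t i + s) \<omega>) \<in> measurable M (\<Pi>\<^sub>M i\<in>{..<n}. borel)"
        using t ts by (intro measurable_restrict mY; auto)+
      have law: "distr M (\<Pi>\<^sub>M i\<in>{..<n}. borel) (\<lambda>\<omega>. \<lambda>i\<in>{..<n}. Y (t i) \<omega>) =
          distr M (\<Pi>\<^sub>M i\<in>{..<n}. borel) (\<lambda>\<omega>. \<lambda>i\<in>{..<n}. Y (t i + s) \<omega>)"
        using stat s t by (auto simp: stationary_def same_fdd_def)
      have "(\<integral>\<omega>. Max ((\<lambda>i. a i * \<xi> (t i) \<omega>) ` {..<n}) \<partial>N) = (\<integral>\<omega>. Max ((\<lambda>i. a i * \<xi> (t i + s) \<omega>) ` {..<n}) \<partial>N)"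
        if a: "\<forall>i. 0 < a i" for a
      proof -
        let ?E = "\<Pi>\<^sub>E i\<in>{..<n}. {..1 / a i}"
        have E: "?E \<in> sets (\<Pi>\<^sub>M i\<in>{..<n}. borel)"
          by (intro sets_PiM_I_finite) auto
        have pre: "(\<lambda>\<omega>. \<lambda>i\<in>{..<n}. Z i \<omega>) -` ?E \<inter> space M = {\<omega> \<in> space M. \<forall>i<n. Z i \<omega> \<le> 1 / a i}" for Z
          by (auto simp: PiE_def Pi_def)
        have "M.prob {\<omega> \<in> space M. \<forall>i<n. Y (t i) \<omega> \<le> 1 / a i} = M.prob {\<omega> \<in> space M. \<forall>i<n. Y (t i + s) \<omega> \<le> 1 / a i}"
          using arg_cong[OF law, of "\<lambda>\<mu>. measure \<mu> ?E"]
          unfolding measure_distr[OF v(1) E] measure_distr[OF v(2) E] pre .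
        then show ?thesis
          using prob_max_le[OF pos mY t n0, of a] prob_max_le[OF pos mY ts n0, of a] a by simp
      qed
      then show "(\<integral>\<omega>. \<bar>\<Sum>i<n. u i * \<xi> (t i) \<omega>\<bar> \<partial>N) = (\<integral>\<omega>. \<bar>\<Sum>i<n. u i * \<xi> (t i + s) \<omega>\<bar> \<partial>N)"
        using zonoid_iff_max_zonoid[OF vec[OF n0 t] vec[OF n0 ts]] by blast
    qed
  next
    assume zon: "zonoid_stationary T N \<xi>"
    show "stationary T M Y"
      unfolding stationary_def same_fdd_def
    proof (intro ballI allI)
      fix s and n :: nat and t
      assume s: "s \<in> T" and t: "t \<in> {..<n} \<rightarrow> T"
      then have ts: "(\<lambda>i. t i + s) \<in> {..<n} \<rightarrow> T" using add_T by auto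
      show "distr M (\<Pi>\<^sub>M i\<in>{..<n}. borel) (\<lambda>\<omega>. \<lambda>i\<in>{..<n}. Y (t i) \<omega>) =
          distr M (\<Pi>\<^sub>M i\<in>{..<n}. borel) (\<lambda>\<omega>. \<lambda>i\<in>{..<n}. Y (t i + s) \<omega>)"
      proof (rule distr_eq_of_cdf_eq)
        fix y :: "nat \<Rightarrow> real"
        \<comment> \<open>A nonpositive threshold makes both events null, since \<open>Y\<close> is
          almost surely positive; only all-positive thresholds need the max functional.\<close>
        consider "n = 0" | i where "i < n" "y i \<le> 0" | "0 < n" "\<forall>i<n. 0 < y i"
          by (metis gr0I not_le)
        then show "M.prob {\<omega> \<in> space M. \<forall>i<n. Y (t i) \<omega> \<le> y i} = M.prob {\<omega> \<in> space M. \<forall>i<n. Y (t i + s) \<omega> \<le> y i}"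
        proof cases
          case (2 i)
          have null: "M.prob {\<omega> \<in> space M. \<forall>i<n. Y (r i) \<omega> \<le> y i} = 0" if r: "r \<in> {..<n} \<rightarrow> T" for r
          proof -
            have all: "(\<forall>i<n. R i) \<longleftrightarrow> (\<forall>i\<in>{..<n}. R i)" for R by auto
            have "{\<omega> \<in> space M. \<forall>i<n. Y (r i) \<omega> \<le> y i} \<in> M.events"
              unfolding all using r by (intro sets.sets_Collect_finite_All borel_measurable_le mY) auto
            moreover have "AE \<omega> in M. 0 < Y (r i) \<omega>"
              using r 2 by (intro AE_max_pos[OF pos]) auto
            then have "AE \<omega> in M. \<omega> \<notin> {\<omega> \<in> space M. \<forall>i<n. Y (r i) \<omega> \<le> y i}"
              by eventually_elim (use 2 in \<open>fastforce simp: not_le\<close>)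
            ultimately show ?thesis by (subst M.prob_eq_0)
          qed
          show ?thesis using null[OF t] null[OF ts] by simp
        next
          case 3
          define a where "a i = (if i < n then 1 / y i else 1)" for i
          have a: "0 < a i" for i using 3 by (simp add: a_def)
          have "\<forall>u. (\<integral>\<omega>. \<bar>\<Sum>i<n. u i * \<xi> (t i) \<omega>\<bar> \<partial>N) = (\<integral>\<omega>. \<bar>\<Sum>i<n. u i * \<xi> (t i + s) \<omega>\<bar> \<partial>N)"
          proof -
            have "1 \<le> n" using 3 by simp
            then show ?thesis
              using zon s t unfolding zonoid_stationary_def zonoid_equiv_def zonoid_equiv_vec_def by blast
          qed
          then have "(\<integral>\<omega>. Max ((\<lambda>i. a i * \<xi> (t i) \<omega>) ` {..<n}) \<partial>N) = (\<integral>\<omega>. Max ((\<lambda>i. a i * \<xi> (t i + s) \<omega>) ` {..<n}) \<partial>N)"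
            using zonoid_iff_max_zonoid[OF vec[OF 3(1) t] vec[OF 3(1) ts]] a by blast
          then have "M.prob {\<omega> \<in> space M. \<forall>i<n. Y (t i) \<omega> \<le> 1 / a i} = M.prob {\<omega> \<in> space M. \<forall>i<n. Y (t i + s) \<omega> \<le> 1 / a i}"
            using prob_max_le[OF pos mY t 3(1) a] prob_max_le[OF pos mY ts 3(1) a] by simp
          moreover have "(\<forall>i<n. z i \<le> 1 / a i) \<longleftrightarrow> (\<forall>i<n. z i \<le> y i)" for z :: "nat \<Rightarrow> real"
            by (auto simp: a_def)
          ultimately show ?thesis by simp
        qed simp
      qed (use t ts in \<open>auto intro: M.prob_space_axioms mY\<close>)
    qed
  qed
qed

end

theorem corollary11:
  fixes T :: "(real ^ 'd) set"
    and N :: "'w measure" and \<xi> :: "real ^ 'd \<Rightarrow> 'w \<Rightarrow> real"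
    and M :: "'v measure" and \<zeta> :: "nat \<Rightarrow> 'v \<Rightarrow> real" and \<Xi> :: "nat \<Rightarrow> real ^ 'd \<Rightarrow> 'v \<Rightarrow> real"
  assumes "T = {t. \<forall>i. t $ i \<in> \<int>} \<or> T = UNIV"
    and "prob_space N" and "prob_space M"
    and "\<forall>t\<in>T. integrable N (\<xi> t)"
    and "iid_std_exponential M \<zeta>"
    and "iid_copies T M \<Xi> N \<xi>"
    and "indep_seq_processes T M (arrival \<zeta>) \<Xi>"
  shows
    "(symmetric_process T N \<xi> \<longrightarrow>
        (stationary T M (lepage_series (arrival \<zeta>) \<Xi>) \<longleftrightarrow> zonoid_stationary T N \<xi>)) \<and>
     (positive_process T N \<xi> \<and> (\<forall>t\<in>T. unit_frechet M (lepage_max (arrival \<zeta>) \<Xi> t)) \<longrightarrow>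
        (stationary T M (lepage_max (arrival \<zeta>) \<Xi>) \<longleftrightarrow> zonoid_stationary T N \<xi>))"
proof -
  have "s + t \<in> T" if "s \<in> T" "t \<in> T" for s t
    using assms(1) that by auto
  then interpret lepage N M T \<xi> \<zeta> \<Xi>
    using assms by (intro lepage.intro lepage_axioms.intro) auto
  show ?thesis
    using stationary_series_iff stationary_max_iff by blast
qed

end
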